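(* Consider the problem $\min_{x\in\Omega} f(x)=\frac1n\sum_{i=1}^n f_i(x)$ with $f_i(x)=\mathbb{E}_{\xi_i}[F_i(x,\xi_i)]$, and suppose that Assumptions (A1)--(A6) listed in the context hold. For a horizon $T\ge 1$ let $\{x_{i,k}\}$ be generated by the variance-reduced algorithm VR-Com-DSZO with batch sizes $b_1,b_2$ (described in the context) with parameters $\mu=1/\sqrt{T}$, $\epsilon=\mu/(2\underline{R})$, $\psi\in(0,r^{-1}]$, $\eta_k=\frac{1}{M_1\sqrt{k+c}}$, where $M_1=\left(5+\frac{10}{n}\right)4dL_m$ and $c>4$, and $\gamma>0$ satisfying $\gamma<\min\{1,\delta\kappa_1^{-1},c_0\kappa_2^{-1}\}$. Suppose further that the contraction factor (see the context) is $\kappa_0=1-\frac{\psi r\omega}{2}$. Then for any optimal point $x^*\in\Omega$, with $\bar x_k=\frac1n\sum_{i=1}^nx_{i,k}$, $$\sum_{k=1}^T\mathbb{E}[f(\bar x_k)-f(x^* )]\le\mathcal O\left(\frac{d^2\sqrt{T+c}}{b_1b_2(\psi r\omega)^2}\right).$$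
   Context: Setting. There are $n$ agents $\mathcal V=\{1,\dots,n\}$; $\Omega\subseteq\mathbb{R}^d$; $\xi_i$ is a random sample from an unknown distribution $\mathcal P_i$; $F_i(\cdot,\xi_i)$ is real-valued and $f_i(x)=\mathbb{E}_{\xi_i}[F_i(x,\xi_i)]$. $\mathcal N_i$ is the set of agents with which $i$ interacts (including $i$ itself in the sums below), and $\mathbf W\in\mathbb{R}^{n\times n}$ is the weight matrix of the communication graph $\mathcal G$ ($\mathbf W_{i,j}=0$ for $j\notin\mathcal N_i$). Assumptions. (A1) $\mathcal G$ is undirected, connected and balanced, so $\mathbf W$ is doubly stochastic; $\mathbf W^{\mathsf T}=\mathbf W$; $\mathrm{null}(\mathbf I-\mathbf W)=\mathrm{span}(\mathbf 1)$; $\mathbf I+\mathbf W\succ0$. Write $\mathbf H=\frac1n\mathbf 1\mathbf 1^{\mathsf T}$; the spectral gap $\delta\in(0,1]$ is defined by $\|\mathbf W-\mathbf H\|_2=1-\delta$, and $\beta=\|\mathbf I-\mathbf W\|_2\in(0,2)$. (A2) $\Omega$ is closed and convex, and there are $\bar R,\underline R>0$ such that $\Omega$ contains the Euclidean ball of radius $\underline R$ centered at $0$ and is contained in the ball of radius $\bar R$ centered at $0$. (A3) For each $i$, $F_i(x,\xi_i)$ is convex and $L_f$-Lipschitz continuous in $x$ on $\Omega$, with $L_f>0$. (A4) There is $\hat\sigma>0$ with $\mathbb{E}_{\xi_i}[\|\nabla_xF_i(x,\xi_i)-\nabla f_i(x)\|^2]\le\hat\sigma^2$ for all $x\in\Omega$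 and all $i$. (A5) The (possibly random) compressor $\mathcal C:\mathbb{R}^d\to\mathbb{R}^d$ is such that, for a scaling factor $r\ge1$, $\mathcal C_r(x)=\frac1r\mathcal C(x)$ satisfies $\mathbb{E}_{\mathcal C}[\|\mathcal C_r(x)-x\|^2]\le(1-\omega)\|x\|^2$ for all $x\in\mathbb{R}^d$, where $\omega\in(0,1]$ and the expectation is over the internal randomness of $\mathcal C$. (A6) Each $f_i$ has $L_m$-Lipschitz gradient: $\|\nabla f_i(x)-\nabla f_i(y)\|\le L_m\|x-y\|$ for all $x,y\in\Omega$. Algorithm VR-Com-DSZO. Inputs $\eta_k,\mu,\epsilon,\psi,\gamma$ and positive integers $b_1,b_2$; $\Omega_\epsilon=\{(1-\epsilon)x: x\in\Omega\}$; $\Pi_{\Omega_\epsilon}$ is Euclidean projection. Initialize $x_{i,0}\in\Omega$, $\hat x_{i,0}=b_{i,0}=\mathbf 0_d$, $q_{i,0}=\mathcal C(x_{i,0})$. For $k=0,1,\dots$ each agent $i$ draws fresh $u_{i,k,1},\dots,u_{i,k,b_1}$ uniformly from the unit sphere of $\mathbb{R}^d$ and fresh independent samples $\xi_{i,k,1},\dots,\xi_{i,k,b_2}\sim\mathcal P_i$, forms the doubly batched gradient estimator $$\tilde{\mathbf g}_i^\mu(x_{i,k})=\frac{d}{b_1b_2\mu}\sum_{\tau_1=1}^{b_1}\sum_{\tau_2=1}^{b_2}\big(F_i(x_{i,k}+\mu u_{i,k,\tau_1},\xi_{i,k,\tau_2})-F_i(x_{i,k},\xi_{i,k,\tau_2})\big)u_{i,k,\tau_1},$$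 and sets $\hat x_{i,k+1}=\hat x_{i,k}+\psi q_{i,k}$; $b_{i,k+1}=b_{i,k}+\psi\big(q_{i,k}-\sum_{j\in\mathcal N_i}\mathbf W_{i,j}q_{j,k}\big)$; $x_{i,k+1}=\Pi_{\Omega_\epsilon}[x_{i,k}-\gamma b_{i,k+1}-\eta_k\tilde{\mathbf g}_i^\mu(x_{i,k})]$; $q_{i,k+1}=\mathcal C(x_{i,k+1}-\hat x_{i,k+1})$. Constants. $c_0=\frac{\psi r\omega}{2}$; $\kappa_1=\frac\delta4+2(1+c_0^{-1})^2\gamma\beta^2$; $\kappa_2=(1+c_0^{-1})^2\gamma\beta^2+(1+\frac2\delta)\beta^2$ (so the condition on $\gamma$ is implicit in $\gamma$). Contraction factor. Let $\mathbf X_k,\widehat{\mathbf X}_k,\mathbf G_k^\mu\in\mathbb{R}^{n\times d}$ have rows $x_{i,k}^{\mathsf T},\hat x_{i,k}^{\mathsf T},\tilde{\mathbf g}_i^\mu(x_{i,k})^{\mathsf T}$, let $\overline{\mathbf X}_k=\mathbf H\mathbf X_k$, and $\mathbf e_k=\mathbb{E}[\|\mathbf X_k-\overline{\mathbf X}_k\|_F^2+\|\widehat{\mathbf X}_{k+1}-\mathbf X_k\|_F^2]$. The contraction factor $\kappa_0$ is the constant in the error recursion $\mathbf e_{k+1}\le\kappa_0\mathbf e_k+\mathbf C_3\eta_k^2\mathbb{E}[\|\mathbf G_k^\mu\|_F^2]$, $k\ge0$, where $\mathbf C_3=4(1+\frac{\gamma\delta}2)(1+\frac2{\gamma\delta})+2(1+c_0^{-1})(1+c_0)(1-\psi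 r\omega)$. $\beta(k)=\mathcal O(\alpha(k))$ means $\limsup_{k\to\infty}\beta(k)/\alpha(k)<+\infty$ (here in the variable $T$).
   Formalization: Query points x+μu may leave Ω, where (A3) says nothing about F_i and the claim can fail; so (A3) is required on a convex Borel set D containing Ω in which all query points lie almost surely. L_m>0 and measurability and integrability of F_i are made explicit. *)

theory Defs
  imports "HOL-Probability.Probability"
begin

(* Agents are the elements of a finite type 'n, so n = CARD('n); points live in real^'d, so
   d = CARD('d).  Stacked variables are matrices of type real^'d^'n with one row per agent;
   the norm of that type is the Frobenius norm. *)

section \<open>Communication graph\<close>

definition avg_matrix :: "real^'n^'n" where
  "avg_matrix = (\<chi> i j. 1 / real CARD('n))"

definition spectral_norm :: "real^'n^'n \<Rightarrow> real" where
  "spectral_norm A = onorm (\<lambda>v. A *v v)"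

definition spectral_gap :: "real^'n^'n \<Rightarrow> real" where
  "spectral_gap W = 1 - spectral_norm (W - avg_matrix)"

definition laplacian_norm :: "real^'n^'n \<Rightarrow> real" where
  "laplacian_norm W = spectral_norm (mat 1 - W)"

(* N i contains i itself. *)
definition undirected_connected :: "('n \<Rightarrow> 'n set) \<Rightarrow> bool" where
  "undirected_connected N \<longleftrightarrow>
     (\<forall>i. i \<in> N i) \<and> (\<forall>i j. j \<in> N i \<longleftrightarrow> i \<in> N j) \<and>
     (\<forall>i j. (i, j) \<in> {(a, b). b \<in> N a}\<^sup>*)"

definition balanced :: "real^'n^'n \<Rightarrow> bool" where
  "balanced W \<longleftrightarrow> (\<forall>i. (\<Sum>j\<in>UNIV. W $ i $ j) = (\<Sum>j\<in>UNIV. W $ j $ i))"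

definition doubly_stochastic :: "real^'n^'n \<Rightarrow> bool" where
  "doubly_stochastic W \<longleftrightarrow>
     (\<forall>i j. 0 \<le> W $ i $ j) \<and>
     (\<forall>i. (\<Sum>j\<in>UNIV. W $ i $ j) = 1) \<and> (\<forall>j. (\<Sum>i\<in>UNIV. W $ i $ j) = 1)"

definition positive_definite :: "real^'n^'n \<Rightarrow> bool" where
  "positive_definite A \<longleftrightarrow> transpose A = A \<and> (\<forall>v. v \<noteq> 0 \<longrightarrow> 0 < v \<bullet> (A *v v))"

definition network :: "('n \<Rightarrow> 'n set) \<Rightarrow> real^'n^'n \<Rightarrow> bool" where
  "network N W \<longleftrightarrow>
     undirected_connected N \<and> (\<forall>i j. j \<notin> N i \<longrightarrow> W $ i $ j = 0) \<and>
     balanced W \<and> doubly_stochastic W \<and> transpose W = W \<and>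
     {v. (mat 1 - W) *v v = 0} = span {\<chi> i. 1} \<and>
     positive_definite (mat 1 + W) \<and>
     spectral_gap W \<in> {0<..1} \<and> laplacian_norm W \<in> {0<..<2}"


section \<open>Problem\<close>

definition feasible_region :: "(real^'d) set \<Rightarrow> real \<Rightarrow> real \<Rightarrow> bool" where
  "feasible_region \<Omega> R_out R_in \<longleftrightarrow>
     closed \<Omega> \<and> convex \<Omega> \<and> R_out > 0 \<and> R_in > 0 \<and> cball 0 R_in \<subseteq> \<Omega> \<and> \<Omega> \<subseteq> cball 0 R_out"

definition local_objective ::
  "('n \<Rightarrow> 's measure) \<Rightarrow> ('n \<Rightarrow> real^'d \<Rightarrow> 's \<Rightarrow> real) \<Rightarrow> 'n \<Rightarrow> real^'d \<Rightarrow> real" where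
  "local_objective P F i x = (\<integral>\<xi>. F i x \<xi> \<partial>P i)"

definition objective ::
  "('n \<Rightarrow> 's measure) \<Rightarrow> ('n \<Rightarrow> real^'d \<Rightarrow> 's \<Rightarrow> real) \<Rightarrow> real^'d \<Rightarrow> real" where
  "objective P F x = (\<Sum>i\<in>UNIV. local_objective P F i x) / real CARD('n)"

definition optimal_point ::
  "('n \<Rightarrow> 's measure) \<Rightarrow> ('n \<Rightarrow> real^'d \<Rightarrow> 's \<Rightarrow> real) \<Rightarrow> (real^'d) set \<Rightarrow> real^'d \<Rightarrow> bool" where
  "optimal_point P F \<Omega> x \<longleftrightarrow> x \<in> \<Omega> \<and> (\<forall>y\<in>\<Omega>. objective P F x \<le> objective P F y)"

definition random_functions ::
  "('n \<Rightarrow> 's measure) \<Rightarrow> ('n \<Rightarrow> real^'d \<Rightarrow> 's \<Rightarrow> real) \<Rightarrow> (real^'d) set \<Rightarrow> bool" where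
  "random_functions P F \<Omega> \<longleftrightarrow>
     (\<forall>i. prob_space (P i) \<and>
          (\<lambda>(x, \<xi>). F i x \<xi>) \<in> borel_measurable (borel \<Otimes>\<^sub>M P i) \<and>
          (\<forall>x\<in>\<Omega>. integrable (P i) (F i x)))"

(* The algorithm evaluates F at x + \<mu> u with x in (1 - \<epsilon>) \<Omega>, norm u = 1 and \<epsilon> = \<mu> / (2 R_in);
   this point may lie outside \<Omega>.  D is a region containing \<Omega> on which the functions are
   regular, and the query points are required to stay in D (see queries_in below); D = \<Omega> and
   D = UNIV are both allowed. *)
definition convex_lipschitz_functions ::
  "('n \<Rightarrow> 's measure) \<Rightarrow> ('n \<Rightarrow> real^'d \<Rightarrow> 's \<Rightarrow> real) \<Rightarrow> (real^'d) set \<Rightarrow> (real^'d) set \<Rightarrow>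
   real \<Rightarrow> bool" where
  "convex_lipschitz_functions P F \<Omega> D Lf \<longleftrightarrow>
     \<Omega> \<subseteq> D \<and> convex D \<and> D \<in> sets borel \<and> Lf > 0 \<and>
     (\<forall>i. AE \<xi> in P i. convex_on D (\<lambda>x. F i x \<xi>) \<and> Lf-lipschitz_on D (\<lambda>x. F i x \<xi>))"

(* The derivative is taken within S because F is only required to be regular on \<Omega>; it is
   unique for convex S with nonempty interior. *)
definition has_gradient_within ::
  "(real^'d \<Rightarrow> real) \<Rightarrow> real^'d \<Rightarrow> real^'d \<Rightarrow> (real^'d) set \<Rightarrow> bool" where
  "has_gradient_within f g x S \<longleftrightarrow> (f has_derivative (\<lambda>h. g \<bullet> h)) (at x within S)"

definition bounded_gradient_variance ::
  "('n \<Rightarrow> 's measure) \<Rightarrow> ('n \<Rightarrow> real^'d \<Rightarrow> 's \<Rightarrow> real) \<Rightarrow> (real^'d) set \<Rightarrow>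
   ('n \<Rightarrow> real^'d \<Rightarrow> 's \<Rightarrow> real^'d) \<Rightarrow> ('n \<Rightarrow> real^'d \<Rightarrow> real^'d) \<Rightarrow> real \<Rightarrow> bool" where
  "bounded_gradient_variance P F \<Omega> gradF gradf \<sigma> \<longleftrightarrow>
     \<sigma> > 0 \<and>
     (\<forall>i. \<forall>x\<in>\<Omega>.
        (AE \<xi> in P i. has_gradient_within (\<lambda>y. F i y \<xi>) (gradF i x \<xi>) x \<Omega>) \<and>
        integrable (P i) (\<lambda>\<xi>. (norm (gradF i x \<xi> - gradf i x))\<^sup>2) \<and>
        (\<integral>\<xi>. (norm (gradF i x \<xi> - gradf i x))\<^sup>2 \<partial>P i) \<le> \<sigma>\<^sup>2)"

definition lipschitz_gradients ::
  "('n \<Rightarrow> 's measure) \<Rightarrow> ('n \<Rightarrow> real^'d \<Rightarrow> 's \<Rightarrow> real) \<Rightarrow> (real^'d) set \<Rightarrow>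
   ('n \<Rightarrow> real^'d \<Rightarrow> real^'d) \<Rightarrow> real \<Rightarrow> bool" where
  "lipschitz_gradients P F \<Omega> gradf Lm \<longleftrightarrow>
     Lm > 0 \<and>
     (\<forall>i. (\<forall>x\<in>\<Omega>. has_gradient_within (local_objective P F i) (gradf i x) x \<Omega>) \<and>
          Lm-lipschitz_on \<Omega> (gradf i))"

(* K is the law of the internal randomness of the compressor. *)
definition compressor ::
  "'c measure \<Rightarrow> ('c \<Rightarrow> real^'d \<Rightarrow> real^'d) \<Rightarrow> real \<Rightarrow> real \<Rightarrow> bool" where
  "compressor K C r \<omega> \<longleftrightarrow>
     prob_space K \<and> (\<lambda>(z, x). C z x) \<in> borel_measurable (K \<Otimes>\<^sub>M borel) \<and>
     r \<ge> 1 \<and> \<omega> \<in> {0<..1} \<and>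
     (\<forall>x. integrable K (\<lambda>z. (norm ((1 / r) *\<^sub>R C z x - x))\<^sup>2) \<and>
          (\<integral>z. (norm ((1 / r) *\<^sub>R C z x - x))\<^sup>2 \<partial>K) \<le> (1 - \<omega>) * (norm x)\<^sup>2)"


section \<open>Algorithm\<close>

(* The normalized surface measure of the unit sphere, as the law of b / norm b for b uniform in
   the unit ball. *)
definition uniform_sphere :: "(real^'d) measure" where
  "uniform_sphere = distr (uniform_measure lborel (ball 0 1)) borel sgn"

(* The randomness used by one agent in one round: compressor noise, b1 directions, b2 samples. *)
definition round_law ::
  "'c measure \<Rightarrow> 's measure \<Rightarrow> nat \<Rightarrow> nat \<Rightarrow>
   ('c \<times> (nat \<Rightarrow> real^'d) \<times> (nat \<Rightarrow> 's)) measure" where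
  "round_law K S b1 b2 =
     K \<Otimes>\<^sub>M (PiM {1..b1} (\<lambda>_. uniform_sphere) \<Otimes>\<^sub>M PiM {1..b2} (\<lambda>_. S))"

definition round_draw ::
  "(nat \<Rightarrow> 'n \<Rightarrow> 'w \<Rightarrow> 'c) \<Rightarrow> (nat \<Rightarrow> 'n \<Rightarrow> nat \<Rightarrow> 'w \<Rightarrow> real^'d) \<Rightarrow>
   (nat \<Rightarrow> 'n \<Rightarrow> nat \<Rightarrow> 'w \<Rightarrow> 's) \<Rightarrow> nat \<Rightarrow> nat \<Rightarrow> nat \<Rightarrow> 'n \<Rightarrow> 'w \<Rightarrow>
   'c \<times> (nat \<Rightarrow> real^'d) \<times> (nat \<Rightarrow> 's)" where
  "round_draw \<zeta> u \<xi> b1 b2 k i w =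
     (\<zeta> k i w, (\<lambda>\<tau>\<in>{1..b1}. u k i \<tau> w), (\<lambda>\<tau>\<in>{1..b2}. \<xi> k i \<tau> w))"

(* All draws (over rounds, agents, batch indices and the three sources) are mutually independent:
   the rounds and agents by indep_vars, the rest because round_law is a product measure. *)
definition fresh_draws ::
  "'w measure \<Rightarrow> 'c measure \<Rightarrow> ('n \<Rightarrow> 's measure) \<Rightarrow> nat \<Rightarrow> nat \<Rightarrow>
   (nat \<Rightarrow> 'n \<Rightarrow> 'w \<Rightarrow> 'c) \<Rightarrow> (nat \<Rightarrow> 'n \<Rightarrow> nat \<Rightarrow> 'w \<Rightarrow> real^'d) \<Rightarrow>
   (nat \<Rightarrow> 'n \<Rightarrow> nat \<Rightarrow> 'w \<Rightarrow> 's) \<Rightarrow> bool" where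
  "fresh_draws M K P b1 b2 \<zeta> u \<xi> \<longleftrightarrow>
     prob_space M \<and>
     prob_space.indep_vars M (\<lambda>(k, i). round_law K (P i) b1 b2)
       (\<lambda>(k, i). round_draw \<zeta> u \<xi> b1 b2 k i) UNIV \<and>
     (\<forall>k i. distr M (round_law K (P i) b1 b2) (round_draw \<zeta> u \<xi> b1 b2 k i) =
            round_law K (P i) b1 b2)"

definition gradient_estimator ::
  "(real^'d \<Rightarrow> 's \<Rightarrow> real) \<Rightarrow> real \<Rightarrow> nat \<Rightarrow> nat \<Rightarrow> (nat \<Rightarrow> real^'d) \<Rightarrow> (nat \<Rightarrow> 's) \<Rightarrow>
   real^'d \<Rightarrow> real^'d" where
  "gradient_estimator Fi \<mu> b1 b2 v s x =
     (real CARD('d) / (real b1 * real b2 * \<mu>)) *\<^sub>R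
     (\<Sum>\<tau>1 = 1..b1. \<Sum>\<tau>2 = 1..b2. (Fi (x + \<mu> *\<^sub>R v \<tau>1) (s \<tau>2) - Fi x (s \<tau>2)) *\<^sub>R v \<tau>1)"

definition estimator_matrix ::
  "('n \<Rightarrow> real^'d \<Rightarrow> 's \<Rightarrow> real) \<Rightarrow> real \<Rightarrow> nat \<Rightarrow> nat \<Rightarrow>
   (nat \<Rightarrow> 'n \<Rightarrow> nat \<Rightarrow> 'w \<Rightarrow> real^'d) \<Rightarrow> (nat \<Rightarrow> 'n \<Rightarrow> nat \<Rightarrow> 'w \<Rightarrow> 's) \<Rightarrow>
   (nat \<Rightarrow> 'w \<Rightarrow> real^'d^'n) \<Rightarrow> nat \<Rightarrow> 'w \<Rightarrow> real^'d^'n" where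
  "estimator_matrix F \<mu> b1 b2 u \<xi> X k w =
     (\<chi> i. gradient_estimator (F i) \<mu> b1 b2 (\<lambda>\<tau>. u k i \<tau> w) (\<lambda>\<tau>. \<xi> k i \<tau> w) (X k w $ i))"

definition shrunk :: "real \<Rightarrow> (real^'d) set \<Rightarrow> (real^'d) set" where
  "shrunk \<epsilon> \<Omega> = (\<lambda>x. (1 - \<epsilon>) *\<^sub>R x) ` \<Omega>"

(* Rows of X, Xh, B, Q at round k: x_{i,k}, hat x_{i,k}, b_{i,k}, q_{i,k}. *)
definition vr_com_dszo ::
  "'w measure \<Rightarrow> ('n \<Rightarrow> 'n set) \<Rightarrow> real^'n^'n \<Rightarrow> (real^'d) set \<Rightarrow>
   ('n \<Rightarrow> real^'d \<Rightarrow> 's \<Rightarrow> real) \<Rightarrow> ('c \<Rightarrow> real^'d \<Rightarrow> real^'d) \<Rightarrow>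
   (nat \<Rightarrow> real) \<Rightarrow> real \<Rightarrow> real \<Rightarrow> real \<Rightarrow> real \<Rightarrow> nat \<Rightarrow> nat \<Rightarrow> real^'d^'n \<Rightarrow>
   (nat \<Rightarrow> 'n \<Rightarrow> 'w \<Rightarrow> 'c) \<Rightarrow> (nat \<Rightarrow> 'n \<Rightarrow> nat \<Rightarrow> 'w \<Rightarrow> real^'d) \<Rightarrow>
   (nat \<Rightarrow> 'n \<Rightarrow> nat \<Rightarrow> 'w \<Rightarrow> 's) \<Rightarrow>
   (nat \<Rightarrow> 'w \<Rightarrow> real^'d^'n) \<Rightarrow> (nat \<Rightarrow> 'w \<Rightarrow> real^'d^'n) \<Rightarrow>
   (nat \<Rightarrow> 'w \<Rightarrow> real^'d^'n) \<Rightarrow> (nat \<Rightarrow> 'w \<Rightarrow> real^'d^'n) \<Rightarrow> bool" where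
  "vr_com_dszo M N W \<Omega> F C \<eta> \<mu> \<epsilon> \<psi> \<gamma> b1 b2 x0 \<zeta> u \<xi> X Xh B Q \<longleftrightarrow>
     (\<forall>i. x0 $ i \<in> \<Omega>) \<and>
     (\<forall>w\<in>space M. \<forall>i.
        X 0 w $ i = x0 $ i \<and> Xh 0 w $ i = 0 \<and> B 0 w $ i = 0 \<and>
        Q 0 w $ i = C (\<zeta> 0 i w) (x0 $ i) \<and>
        (\<forall>k.
           Xh (Suc k) w $ i = Xh k w $ i + \<psi> *\<^sub>R Q k w $ i \<and>
           B (Suc k) w $ i =
             B k w $ i + \<psi> *\<^sub>R (Q k w $ i - (\<Sum>j\<in>N i. W $ i $ j *\<^sub>R Q k w $ j)) \<and>
           X (Suc k) w $ i =
             closest_point (shrunk \<epsilon> \<Omega>)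
               (X k w $ i - \<gamma> *\<^sub>R B (Suc k) w $ i
                 - \<eta> k *\<^sub>R estimator_matrix F \<mu> b1 b2 u \<xi> X k w $ i) \<and>
           Q (Suc k) w $ i = C (\<zeta> (Suc k) i w) (X (Suc k) w $ i - Xh (Suc k) w $ i)))"

definition queries_in ::
  "(real^'d) set \<Rightarrow> 'w measure \<Rightarrow> real \<Rightarrow> nat \<Rightarrow>
   (nat \<Rightarrow> 'n \<Rightarrow> nat \<Rightarrow> 'w \<Rightarrow> real^'d) \<Rightarrow> (nat \<Rightarrow> 'w \<Rightarrow> real^'d^'n) \<Rightarrow> bool" where
  "queries_in D M \<mu> b1 u X \<longleftrightarrow>
     (\<forall>k i. \<forall>\<tau>\<in>{1..b1}. AE w in M. X k w $ i + \<mu> *\<^sub>R u k i \<tau> w \<in> D)"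

definition row_average :: "real^'d^'n \<Rightarrow> real^'d" where
  "row_average Y = (1 / real CARD('n)) *\<^sub>R (\<Sum>i\<in>UNIV. Y $ i)"


section \<open>Constants and error recursion\<close>

definition c0_const :: "real \<Rightarrow> real \<Rightarrow> real \<Rightarrow> real" where
  "c0_const \<psi> r \<omega> = \<psi> * r * \<omega> / 2"

definition kappa1 :: "real \<Rightarrow> real \<Rightarrow> real \<Rightarrow> real \<Rightarrow> real" where
  "kappa1 \<delta> \<beta> c0 \<gamma> = \<delta> / 4 + 2 * (1 + 1 / c0)\<^sup>2 * \<gamma> * \<beta>\<^sup>2"

definition kappa2 :: "real \<Rightarrow> real \<Rightarrow> real \<Rightarrow> real \<Rightarrow> real" where
  "kappa2 \<delta> \<beta> c0 \<gamma> = (1 + 1 / c0)\<^sup>2 * \<gamma> * \<beta>\<^sup>2 + (1 + 2 / \<delta>) * \<beta>\<^sup>2"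

definition C3_const :: "real \<Rightarrow> real \<Rightarrow> real \<Rightarrow> real \<Rightarrow> real \<Rightarrow> real" where
  "C3_const \<delta> \<gamma> \<psi> r \<omega> =
     4 * (1 + \<gamma> * \<delta> / 2) * (1 + 2 / (\<gamma> * \<delta>)) +
     2 * (1 + 1 / c0_const \<psi> r \<omega>) * (1 + c0_const \<psi> r \<omega>) * (1 - \<psi> * r * \<omega>)"

definition consensus_error ::
  "'w measure \<Rightarrow> (nat \<Rightarrow> 'w \<Rightarrow> real^'d^'n) \<Rightarrow> (nat \<Rightarrow> 'w \<Rightarrow> real^'d^'n) \<Rightarrow> nat \<Rightarrow> real" where
  "consensus_error M X Xh k =
     (\<integral>w. (norm (X k w - avg_matrix ** X k w))\<^sup>2 + (norm (Xh (Suc k) w - X k w))\<^sup>2 \<partial>M)"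

definition error_recursion ::
  "'w measure \<Rightarrow> (nat \<Rightarrow> 'w \<Rightarrow> real^'d^'n) \<Rightarrow> (nat \<Rightarrow> 'w \<Rightarrow> real^'d^'n) \<Rightarrow>
   (nat \<Rightarrow> 'w \<Rightarrow> real^'d^'n) \<Rightarrow> (nat \<Rightarrow> real) \<Rightarrow> real \<Rightarrow> real \<Rightarrow> bool" where
  "error_recursion M X Xh G \<eta> C3 \<kappa>0 \<longleftrightarrow>
     (\<forall>k. consensus_error M X Xh (Suc k) \<le>
            \<kappa>0 * consensus_error M X Xh k + C3 * (\<eta> k)\<^sup>2 * (\<integral>w. (norm (G k w))\<^sup>2 \<partial>M))"

end

theory Submission
  imports Defs
begin

text \<open>
  Every iterate stays in \<open>\<Omega>\<close>, so the regret can be controlled by the classical potential argument for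
  projected subgradient steps, run for all agents at once.  Fix the comparison point
  \<open>y = (1 - \<epsilon>) x\<^sup>*\<close>, which lies in the set projected onto, and let \<open>S\<^sub>k\<close> be the expected sum over the
  agents of the squared distances to \<open>y\<close> (\<open>spread\<close> below).  Nonexpansiveness of the projection bounds
  \<open>S\<^sub>k\<^sub>+\<^sub>1 - S\<^sub>k\<close> by a first-order term \<open>2 \<eta>\<^sub>k \<Sum> E g\<^sub>i \<bullet> (y - x\<^sub>i)\<close>, a term of order \<open>\<eta>\<^sub>k\<^sup>2 E |G|\<^sup>2\<close>, and a
  contribution of the communication variable, which is \<open>B = (I - W) Xh\<close>.  The columns of \<open>B\<close> sum to
  zero and \<open>I - W\<close> annihilates consensus, hence that contribution is quadratic: a multiple of the
  consensus error \<open>e\<^sub>k\<close> (\<open>projected_step_le\<close>).  Three facts turn this into a bound of order \<open>sqrt T\<close>.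

  First, the estimator is bounded by \<open>d Lf\<close> whatever \<open>\<mu>\<close> is, because the Lipschitz increments it is made
  of have size \<open>Lf \<mu>\<close>, which compensates the prefactor \<open>1 / \<mu>\<close> (\<open>AE_estimator_le\<close>).

  Second, in the mean the estimator satisfies the subgradient inequality up to \<open>2 \<mu> Lf\<close>
  (\<open>sphere_estimator_le\<close>).  The query points may leave \<open>\<Omega>\<close>, so a Taylor expansion at \<open>x\<close> is not at
  hand.  Instead one uses that the spherical mean of \<open>(d / \<mu>) f(x + \<mu> u) u\<close> is, by the divergence
  theorem, the gradient of the average of \<open>f\<close> over a ball, and this average inherits the
  subgradient inequality from \<open>f\<close>.  The divergence theorem enters in a hands-on form: integrate the
  convexity inequality against a radial cutoff, move the translation from \<open>f\<close> to the cutoff, and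
  let the shell on which the cutoff varies shrink to the sphere.  To integrate against the law of
  the current iterate, the draws of a round have to be independent of the state at its start;
  this follows from the measurability of the state with respect to the earlier draws
  (\<open>state_filtration\<close>, \<open>distr_filtration_draw\<close>).

  Third, the consensus error is absorbed by the potential \<open>V\<^sub>k = S\<^sub>k + \<kappa> e\<^sub>k\<close>: the error recursion
  \<open>e\<^sub>k\<^sub>+\<^sub>1 \<le> (1 - a) e\<^sub>k + O(\<eta>\<^sub>k\<^sup>2)\<close> gives \<open>a e\<^sub>k \<le> e\<^sub>k - e\<^sub>k\<^sub>+\<^sub>1 + O(\<eta>\<^sub>k\<^sup>2)\<close>, so the error terms telescope along
  with \<open>S\<^sub>k\<close>.  Since the integral of a non-integrable function is 0 by convention, \<open>e\<^sub>k\<close> bounds the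
  expected disagreement only once the compressed messages are known to be square integrable; this is
  proved from the compressor bound (\<open>compression_error\<close>), which also controls \<open>e\<^sub>0\<close> uniformly in the
  horizon.

  Dividing by \<open>\<eta>\<^sub>k\<close> and summing by parts, the bounded potential contributes \<open>O(1 / \<eta>\<^sub>T) = O(sqrt T)\<close>, the
  terms of order \<open>\<eta>\<^sub>k\<close> sum to \<open>O(sqrt T)\<close>, and the bias of order \<open>\<mu> = 1 / sqrt T\<close> per round sums to
  \<open>O(sqrt T)\<close> as well.
\<close>

section \<open>Lipschitz extension of convex functions\<close>

text \<open>The infimal convolution of \<open>f\<close> with \<open>L |x|\<close> is convex as a partial minimum of a jointly convex
function, and it does not change \<open>f\<close> on \<open>D\<close> because \<open>f\<close> is \<open>L\<close>-Lipschitz there.  It allows the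
integration argument below to evaluate the function at arbitrary points.\<close>

lemma convex_lipschitz_extension:
  fixes f :: "'a::real_normed_vector \<Rightarrow> real"
  assumes cvx: "convex_on D f" and lip: "L-lipschitz_on D f" and ne: "D \<noteq> {}"
  obtains g where "convex_on UNIV g" "L-lipschitz_on UNIV g" "\<And>x. x \<in> D \<Longrightarrow> g x = f x"
proof -
  have L0: "L \<ge> 0" using lip by (rule lipschitz_on_nonneg)
  define g where "g x = (INF w\<in>D. f w + L * norm (x - w))" for x
  have fl: "f a \<le> f w + L * norm (a - w)" if "a \<in> D" "w \<in> D" for a w
    using lipschitz_onD[OF lip that] by (simp add: dist_norm)
  have bdd: "bdd_below ((\<lambda>w. f w + L * norm (x - w)) ` D)" for x
  proof -
    obtain a where a: "a \<in> D" using ne by blast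
    show ?thesis
    proof (rule bdd_belowI2)
      fix w assume w: "w \<in> D"
      have "norm (a - w) \<le> norm (a - x) + norm (x - w)"
        by (rule norm_diff_triangle_ineq[of a x x w, simplified])
      then have "L * norm (a - w) \<le> L * norm (a - x) + L * norm (x - w)"
        using L0 by (metis distrib_left mult_left_mono)
      then show "f a - L * norm (a - x) \<le> f w + L * norm (x - w)"
        using fl[OF a w] by linarith
    qed
  qed
  have upper: "g x \<le> f w + L * norm (x - w)" if "w \<in> D" for x w
    unfolding g_def by (rule cINF_lower[OF bdd that])
  have lower: "m \<le> g x" if "\<And>w. w \<in> D \<Longrightarrow> m \<le> f w + L * norm (x - w)" for m x
    unfolding g_def by (rule cINF_greatest[OF ne]) (rule that)
  have approx: "\<exists>w\<in>D. f w + L * norm (x - w) < g x + e" if "e > 0" for x e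
    using cINF_less_iff[OF ne bdd, of x "g x + e"] that unfolding g_def by simp
  have "g x = f x" if "x \<in> D" for x
    using upper[OF that, of x] lower[of "f x" x] fl[OF that] by force
  moreover have "L-lipschitz_on UNIV g"
  proof (rule lipschitz_onI)
    have half: "g x \<le> g y + L * norm (x - y)" for x y
    proof -
      have "g x - L * norm (x - y) \<le> g y"
      proof (rule lower)
        fix w assume "w \<in> D"
        have "norm (x - w) \<le> norm (x - y) + norm (y - w)"
          by (rule norm_diff_triangle_ineq[of x y y w, simplified])
        then have "L * norm (x - w) \<le> L * norm (x - y) + L * norm (y - w)"
          using L0 by (metis distrib_left mult_left_mono)
        then show "g x - L * norm (x - y) \<le> f w + L * norm (y - w)"
          using upper[OF \<open>w \<in> D\<close>, of x] by linarith
      qed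
      then show ?thesis by simp
    qed
    show "dist (g x) (g y) \<le> L * dist x y" for x y
      using half[of x y] half[of y x] by (simp add: dist_norm abs_le_iff norm_minus_commute)
  qed (rule L0)
  moreover have "convex_on UNIV g"
  proof (rule convex_onI)
    fix t :: real and x y :: 'a assume t: "0 < t" "t < 1"
    show "g ((1 - t) *\<^sub>R x + t *\<^sub>R y) \<le> (1 - t) * g x + t * g y"
    proof (rule field_le_epsilon)
      fix e :: real assume "e > 0"
      obtain v where v: "v \<in> D" "f v + L * norm (x - v) < g x + e" using approx[OF \<open>e > 0\<close>] by blast
      obtain w where w: "w \<in> D" "f w + L * norm (y - w) < g y + e" using approx[OF \<open>e > 0\<close>] by blast
      have cD: "(1 - t) *\<^sub>R v + t *\<^sub>R w \<in> D"
        using cvx v(1) w(1) t unfolding convex_on_def convex_def by auto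
      have "norm (((1 - t) *\<^sub>R x + t *\<^sub>R y) - ((1 - t) *\<^sub>R v + t *\<^sub>R w))
            = norm ((1 - t) *\<^sub>R (x - v) + t *\<^sub>R (y - w))"
        by (simp add: algebra_simps)
      also have "\<dots> \<le> (1 - t) * norm (x - v) + t * norm (y - w)"
        using norm_triangle_ineq[of "(1 - t) *\<^sub>R (x - v)" "t *\<^sub>R (y - w)"] t by simp
      finally have n: "L * norm (((1 - t) *\<^sub>R x + t *\<^sub>R y) - ((1 - t) *\<^sub>R v + t *\<^sub>R w))
          \<le> L * ((1 - t) * norm (x - v) + t * norm (y - w))"
        using L0 by (rule mult_left_mono)
      have "g ((1 - t) *\<^sub>R x + t *\<^sub>R y) \<le> f ((1 - t) *\<^sub>R v + t *\<^sub>R w)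
          + L * norm (((1 - t) *\<^sub>R x + t *\<^sub>R y) - ((1 - t) *\<^sub>R v + t *\<^sub>R w))"
        by (rule upper[OF cD])
      also have "\<dots> \<le> (1 - t) * f v + t * f w + L * ((1 - t) * norm (x - v) + t * norm (y - w))"
        using convex_onD[OF cvx, of t v w] t v(1) w(1) n by simp
      also have "\<dots> = (1 - t) * (f v + L * norm (x - v)) + t * (f w + L * norm (y - w))"
        by (simp add: algebra_simps)
      also have "\<dots> \<le> (1 - t) * (g x + e) + t * (g y + e)"
        using v(2) w(2) t by (intro add_mono[of _ "(1 - t) * (g x + e)"] mult_left_mono) (simp_all add: less_imp_le)
      also have "\<dots> = (1 - t) * g x + t * g y + e" by (simp add: algebra_simps)
      finally show "g ((1 - t) *\<^sub>R x + t *\<^sub>R y) \<le> (1 - t) * g x + t * g y + e" .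
    qed
  qed simp
  ultimately show ?thesis using that by blast
qed

section \<open>The gradient estimate on the sphere\<close>

lemma borel_measurable_sgn_vec [measurable (raw)]:
  fixes g :: "'a \<Rightarrow> real^'d::finite"
  assumes [measurable]: "g \<in> borel_measurable M"
  shows "(\<lambda>x. sgn (g x)) \<in> borel_measurable M"
  unfolding sgn_div_norm by measurable

lemma sets_ball [measurable]: "ball (a::'a::metric_space) s \<in> sets borel"
  by simp

lemma ball_measure_pos: "measure lborel (ball (0::real^'d::finite) 1) > 0"
  by (simp add: content_ball_pos)

lemma emeasure_ball_eq: "emeasure lborel (ball (0::real^'d::finite) 1) = ennreal (measure lborel (ball (0::real^'d) 1))"
  using emeasure_lborel_ball_finite[of "0::real^'d" 1] by (subst emeasure_eq_ennreal_measure) auto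

lemma prob_space_uniform_sphere: "prob_space (uniform_sphere :: (real^'d::finite) measure)"
  unfolding uniform_sphere_def
  by (intro prob_space.prob_space_distr prob_space_uniform_measure)
     (use ball_measure_pos[where 'd='d] in \<open>auto simp: emeasure_ball_eq\<close>)

lemma sets_uniform_sphere [simp, measurable_cong]: "sets (uniform_sphere :: (real^'d::finite) measure) = sets borel"
  unfolding uniform_sphere_def by simp

lemma AE_uniform_sphere_norm: "AE u in (uniform_sphere :: (real^'d::finite) measure). norm u \<le> 1"
  unfolding uniform_sphere_def by (subst AE_distr_iff) (auto simp: norm_sgn)

lemma integral_uniform_sphere:
  fixes f :: "real^'d::finite \<Rightarrow> real"
  assumes [measurable]: "f \<in> borel_measurable borel"
  shows "(\<integral>u. f u \<partial>uniform_sphere) =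
    (\<integral>v. indicator (ball 0 1) v * f (sgn v) \<partial>lborel) / measure lborel (ball (0::real^'d) 1)"
proof -
  let ?V = "measure lborel (ball (0::real^'d) 1)"
  have V: "?V > 0" by (rule ball_measure_pos)
  have "(\<integral>u. f u \<partial>uniform_sphere) = (\<integral>v. f (sgn v) \<partial>uniform_measure lborel (ball (0::real^'d) 1))"
    unfolding uniform_sphere_def by (rule integral_distr) auto
  also have "uniform_measure lborel (ball (0::real^'d) 1) =
      density lborel (\<lambda>v. ennreal (indicator (ball 0 1) v / ?V))"
    unfolding uniform_measure_def
  proof (rule density_cong)
    show "AE v in lborel. indicator (ball (0::real^'d) 1) v / emeasure lborel (ball (0::real^'d) 1)
        = ennreal (indicator (ball 0 1) v / ?V)"
      using V by (intro AE_I2)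
        (auto simp: emeasure_ball_eq divide_ennreal[symmetric] split: split_indicator)
  qed measurable
  also have "(\<integral>v. f (sgn v) \<partial>\<dots>) = (\<integral>v. (indicator (ball 0 1) v / ?V) *\<^sub>R f (sgn v) \<partial>lborel)"
    by (rule integral_density) (use V in auto)
  also have "\<dots> = (\<integral>v. indicator (ball 0 1) v * f (sgn v) / ?V \<partial>lborel)"
    by (simp add: mult.commute)
  finally show ?thesis by simp
qed

text \<open>Direction and radius decouple: a function of the direction alone is integrated over a ball by
scaling the unit ball.  This replaces polar coordinates.\<close>

lemma integral_ball_angular:
  fixes f :: "real^'d::finite \<Rightarrow> real"
  assumes [measurable]: "f \<in> borel_measurable borel" and s: "s > 0"
  shows "(\<integral>v. indicator (ball 0 s) v * f (sgn v) \<partial>lborel) =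
    s ^ CARD('d) * (\<integral>v. indicator (ball 0 1) v * f (sgn v) \<partial>lborel)"
proof -
  have [measurable]: "(\<lambda>v. indicator (ball 0 s) v * f (sgn v)) \<in> borel_measurable borel"
    by measurable
  have "(\<integral>v. indicator (ball 0 s) v * f (sgn v) \<partial>lborel) =
      (\<integral>v. indicator (ball 0 s) v * f (sgn v)
        \<partial>density (distr lborel borel (\<lambda>x. 0 + s *\<^sub>R x)) (\<lambda>_. ennreal (\<bar>s\<bar> ^ DIM(real^'d))))"
    using s by (subst lborel_affine[of s 0]) auto
  also have "\<dots> = (\<integral>v. (\<bar>s\<bar> ^ DIM(real^'d)) *\<^sub>R (indicator (ball 0 s) v * f (sgn v))
       \<partial>distr lborel borel (\<lambda>x::real^'d. 0 + s *\<^sub>R x))"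
    by (rule integral_density) auto
  also have "\<dots> = (\<integral>v. (\<bar>s\<bar> ^ DIM(real^'d)) *\<^sub>R (indicator (ball 0 s) (0 + s *\<^sub>R v) * f (sgn (0 + s *\<^sub>R v)))
       \<partial>(lborel :: (real^'d) measure))"
    by (rule integral_distr) auto
  also have "\<dots> = (\<integral>v. s ^ CARD('d) * (indicator (ball 0 1) v * f (sgn v)) \<partial>lborel)"
    by (rule Bochner_Integration.integral_cong)
       (use s in \<open>auto simp: indicator_def sgn_scaleR\<close>)
  finally show ?thesis by simp
qed

text \<open>A radial Lipschitz cutoff of the unit ball whose gradient is \<open>- sgn v / h\<close> on the shell
\<open>1 - h \<le> |v| \<le> 1\<close> and zero elsewhere.  As \<open>h\<close> tends to zero, integrating against this gradient
becomes integrating over the sphere.\<close>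

definition cutoff :: "real \<Rightarrow> 'a::real_normed_vector \<Rightarrow> real" where
  "cutoff h v = max 0 (min 1 ((1 - norm v) / h))"

lemma cutoff_bounds: "0 \<le> cutoff h v" "cutoff h v \<le> 1"
  by (auto simp: cutoff_def)

lemma cutoff_eq_0: "h > 0 \<Longrightarrow> norm v \<ge> 1 \<Longrightarrow> cutoff h v = 0"
  by (auto simp: cutoff_def max_def min_def divide_nonpos_pos field_simps)

lemma cutoff_eq_1: "h > 0 \<Longrightarrow> norm v \<le> 1 - h \<Longrightarrow> cutoff h v = 1"
  by (auto simp: cutoff_def max_def min_def field_simps)

lemma cutoff_shell: "h > 0 \<Longrightarrow> norm v \<le> 1 \<Longrightarrow> norm v \<ge> 1 - h \<Longrightarrow> cutoff h v = (1 - norm v) / h"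
  by (auto simp: cutoff_def max_def min_def field_simps)

lemma cutoff_lipschitz:
  assumes "h > 0"
  shows "\<bar>cutoff h v - cutoff h w\<bar> \<le> norm (v - w) / h"
proof -
  have "\<bar>cutoff h v - cutoff h w\<bar> \<le> \<bar>(1 - norm v) / h - (1 - norm w) / h\<bar>"
    unfolding cutoff_def by (auto simp: max_def min_def)
  also have "\<dots> = \<bar>norm v - norm w\<bar> / h"
    using assms by (simp add: diff_divide_distrib[symmetric] abs_minus_commute)
  also have "\<dots> \<le> norm (v - w) / h"
    using assms by (intro divide_right_mono norm_triangle_ineq3) auto
  finally show ?thesis .
qed

lemma continuous_on_cutoff: "h > 0 \<Longrightarrow> continuous_on S (cutoff h)"
  unfolding cutoff_def by (intro continuous_intros) auto

lemma cutoff_deriv: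
  fixes v p :: "'a::real_inner"
  assumes h: "0 < h" "h < 1" and v: "norm v \<noteq> 1" "norm v \<noteq> 1 - h"
  shows "((\<lambda>t. cutoff h (v - t *\<^sub>R p)) has_real_derivative
    (indicator (ball 0 1 - ball 0 (1 - h)) v * (sgn v \<bullet> p) / h)) (at 0)"
proof -
  have ev: "\<forall>\<^sub>F t in at 0. P (norm (v - t *\<^sub>R p))" if "open (Collect P)" "P (norm v)" for P
  proof -
    have "((\<lambda>t. norm (v - t *\<^sub>R p)) \<longlongrightarrow> norm (v - 0 *\<^sub>R p)) (at (0::real))"
      by (intro tendsto_intros)
    then show ?thesis using that topological_tendstoD[of _ "norm v" _ "Collect P"] by auto
  qed
  have ev': "\<forall>\<^sub>F t in nhds 0. P (norm (v - t *\<^sub>R p))" if "open (Collect P)" "P (norm v)" for P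
    using ev[OF that] that(2) by (simp add: eventually_nhds_conv_at)
  consider "norm v > 1" | "norm v < 1 - h" | "1 - h < norm v" "norm v < 1"
    using v by linarith
  then show ?thesis
  proof cases
    case 1
    have "\<forall>\<^sub>F t in nhds 0. cutoff h (v - t *\<^sub>R p) = 0"
      by (rule eventually_mono[OF ev'[of "\<lambda>x. x > 1"]])
         (use 1 h in \<open>auto intro!: cutoff_eq_0 open_Collect_less continuous_intros\<close>)
    moreover have "((\<lambda>t. 0::real) has_real_derivative 0) (at 0)" by simp
    ultimately show ?thesis using 1 by (subst DERIV_cong_ev[OF refl]) auto
  next
    case 2
    have "\<forall>\<^sub>F t in nhds 0. cutoff h (v - t *\<^sub>R p) = 1"
      by (rule eventually_mono[OF ev'[of "\<lambda>x. x < 1 - h"]])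
         (use 2 h in \<open>auto intro!: cutoff_eq_1 open_Collect_less continuous_intros\<close>)
    then show ?thesis using 2 by (subst DERIV_cong_ev[OF refl]) auto
  next
    case 3
    then have v0: "v \<noteq> 0" using h by auto
    have "\<forall>\<^sub>F t in nhds 0. cutoff h (v - t *\<^sub>R p) = (1 - norm (v - t *\<^sub>R p)) / h"
      by (rule eventually_mono[OF ev'[of "\<lambda>x. 1 - h < x \<and> x < 1"]])
         (use 3 h in \<open>auto intro!: cutoff_shell open_Collect_less open_Collect_conj continuous_intros\<close>)
    moreover have n: "(norm has_derivative (\<lambda>h. h \<bullet> sgn v)) (at (v - 0 *\<^sub>R p))"
      using has_derivative_norm[OF v0] by simp
    have "((\<lambda>t. v - t *\<^sub>R p) has_derivative (\<lambda>t. - (t *\<^sub>R p))) (at 0)"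
      by (auto intro!: derivative_eq_intros)
    from has_derivative_compose[OF this n]
    have "((\<lambda>t. norm (v - t *\<^sub>R p)) has_derivative (\<lambda>t. (- (t *\<^sub>R p)) \<bullet> sgn v)) (at 0)" .
    then have "((\<lambda>t. norm (v - t *\<^sub>R p)) has_real_derivative - (sgn v \<bullet> p)) (at 0)"
      by (rule has_derivative_imp_has_field_derivative) (simp add: inner_commute)
    then have "((\<lambda>t. (1 - norm (v - t *\<^sub>R p)) / h) has_real_derivative (sgn v \<bullet> p) / h) (at 0)"
      using h by (auto intro!: derivative_eq_intros)
    ultimately show ?thesis using 3 by (subst DERIV_cong_ev[OF refl]) auto
  qed
qed

text \<open>Convexity bounds the increment \<open>\<phi>(v + t p) - \<phi> v\<close> by \<open>t (\<phi>(v + p) - \<phi> v) \<le> t (\<phi> p + 2 L)\<close> for \<open>v\<close> in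
the unit ball.  Integrated against the cutoff, translation invariance moves the shift to the
cutoff, and the limit \<open>t \<rightarrow> 0\<close> produces the derivative of the cutoff: integration by parts for a
function \<open>\<phi>\<close> that need not be differentiable.\<close>

lemma shell_flux_le:
  fixes \<phi> :: "real^'d::finite \<Rightarrow> real"
  assumes cvx: "convex_on UNIV \<phi>" and lip: "L-lipschitz_on UNIV \<phi>" and zero: "\<phi> 0 = 0"
    and h: "0 < h" "h < 1"
  shows "(\<integral>v. indicator (ball 0 1 - ball 0 (1 - h)) v * ((sgn v \<bullet> p) * \<phi> v) \<partial>lborel) / h
    \<le> (\<phi> p + 2 * L) * (\<integral>v. cutoff h (v::real^'d) \<partial>lborel)"
proof -
  have L0: "L \<ge> 0" using lip by (rule lipschitz_on_nonneg)
  have cont: "continuous_on S \<phi>" for S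
    using lipschitz_on_continuous_on[OF lip] continuous_on_subset by blast
  have phi_le: "\<phi> v \<le> \<phi> w + L * norm (v - w)" for v w
    using lipschitz_onD[OF lip, of v w] by (simp add: dist_norm)
  note cont_cut = continuous_on_cutoff[OF h(1)]
  let ?\<rho> = "cutoff h :: real^'d \<Rightarrow> real"
  have int: "integrable lborel (\<lambda>v. indicator (cball 0 s) v * f v)"
    if "continuous_on UNIV f" for f :: "real^'d \<Rightarrow> real" and s
    using borel_integrable_compact[of "cball 0 s" f] that continuous_on_subset by fastforce
  have int\<rho>: "integrable lborel (\<lambda>v. ?\<rho> (v + a) * f v)" if "continuous_on UNIV f" for f a
  proof -
    have "integrable lborel (\<lambda>v. indicator (cball 0 (1 + norm a)) v * (?\<rho> (v + a) * f v))"
      by (intro int continuous_intros continuous_on_compose2[OF cont_cut] that) auto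
    moreover have "?\<rho> (v + a) = 0" if "v \<notin> cball 0 (1 + norm a)" for v
      using that norm_triangle_ineq4[of "v + a" a] by (intro cutoff_eq_0 h) auto
    then have "(\<lambda>v. indicator (cball 0 (1 + norm a)) v * (?\<rho> (v + a) * f v)) = (\<lambda>v. ?\<rho> (v + a) * f v)"
      by (auto simp: fun_eq_iff split: split_indicator)
    ultimately show ?thesis by simp
  qed
  have int1: "integrable lborel (\<lambda>v. ?\<rho> (v - t *\<^sub>R p) * \<phi> v)" for t
    using int\<rho>[of \<phi> "- t *\<^sub>R p"] cont by simp
  have int2: "integrable lborel (\<lambda>v. ?\<rho> v * f v)" if "continuous_on UNIV f" for f
    using int\<rho>[of f 0] that by simp
  let ?I = "\<integral>v. ?\<rho> v \<partial>lborel"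
  define q where "q t v = (?\<rho> (v - t *\<^sub>R p) - ?\<rho> v) / t * \<phi> v" for t v
  have step: "(\<integral>v. q t v \<partial>lborel) \<le> (\<phi> p + 2 * L) * ?I" if t: "0 < t" "t \<le> 1" for t
  proof -
    have ic: "continuous_on UNIV (\<lambda>v. \<phi> (v + t *\<^sub>R p))"
      by (intro continuous_on_compose2[OF cont[of UNIV]] continuous_intros) auto
    have "(\<integral>v. ?\<rho> (v - t *\<^sub>R p) * \<phi> v \<partial>lborel)
        = (\<integral>v. ?\<rho> (v - t *\<^sub>R p) * \<phi> v \<partial>distr lborel borel ((+) (t *\<^sub>R p)))"
      by (simp add: lborel_distr_plus)
    also have "\<dots> = (\<integral>v. ?\<rho> v * \<phi> (v + t *\<^sub>R p) \<partial>lborel)"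
      by (subst integral_distr) (use int1[of t] in \<open>auto simp: add.commute\<close>)
    finally have tr: "(\<integral>v. ?\<rho> (v - t *\<^sub>R p) * \<phi> v \<partial>lborel) = (\<integral>v. ?\<rho> v * \<phi> (v + t *\<^sub>R p) \<partial>lborel)" .
    have "(\<integral>v. q t v \<partial>lborel)
        = (\<integral>v. (?\<rho> (v - t *\<^sub>R p) * \<phi> v - ?\<rho> v * \<phi> v) / t \<partial>lborel)"
      by (simp add: q_def algebra_simps)
    also have "\<dots> = ((\<integral>v. ?\<rho> v * \<phi> (v + t *\<^sub>R p) \<partial>lborel) - (\<integral>v. ?\<rho> v * \<phi> v \<partial>lborel)) / t"
      using tr int1[of t] int2[OF cont] by simp
    also have "\<dots> = (\<integral>v. ?\<rho> v * (\<phi> (v + t *\<^sub>R p) - \<phi> v) \<partial>lborel) / t"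
      using int2[OF cont] int2[OF ic] by (simp add: right_diff_distrib)
    also have "(\<integral>v. ?\<rho> v * (\<phi> (v + t *\<^sub>R p) - \<phi> v) \<partial>lborel) \<le> (\<integral>v. ?\<rho> v * (t * (\<phi> p + 2 * L)) \<partial>lborel)"
    proof (rule integral_mono)
      fix v
      show "?\<rho> v * (\<phi> (v + t *\<^sub>R p) - \<phi> v) \<le> ?\<rho> v * (t * (\<phi> p + 2 * L))"
      proof (cases "norm v \<ge> 1")
        case True then show ?thesis by (simp add: cutoff_eq_0[OF h(1)])
      next
        case False
        have "\<phi> (v + t *\<^sub>R p) = \<phi> ((1 - t) *\<^sub>R v + t *\<^sub>R (p + v))"
          by (simp add: algebra_simps)
        also have "\<dots> \<le> (1 - t) * \<phi> v + t * \<phi> (p + v)"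
          using convex_onD[OF cvx, of t v "p + v"] t by simp
        also have "\<dots> \<le> (1 - t) * \<phi> v + t * (\<phi> p + L * norm v)"
          using phi_le[of "p + v" p] t by simp
        also have "\<dots> = \<phi> v + t * (\<phi> p + L * norm v - \<phi> v)"
          by (simp add: algebra_simps)
        also have "\<dots> \<le> \<phi> v + t * (\<phi> p + 2 * L)"
        proof -
          have "L * norm v \<le> L * 1" using False L0 by (intro mult_left_mono) auto
          moreover have "- \<phi> v \<le> L * norm v" using phi_le[of 0 v] zero by simp
          ultimately show ?thesis using t by simp
        qed
        finally show ?thesis by (intro mult_left_mono cutoff_bounds) simp
      qed
    qed (use int2[OF ic] int2[OF cont] int2[of "\<lambda>_. t * (\<phi> p + 2 * L)"] in \<open>simp_all add: right_diff_distrib\<close>)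
    also have "(\<integral>v. ?\<rho> v * (t * (\<phi> p + 2 * L)) \<partial>lborel) = ?I * (t * (\<phi> p + 2 * L))"
      by (rule integral_mult_left_zero)
    finally have "(\<integral>v. q t v \<partial>lborel) \<le> ?I * (t * (\<phi> p + 2 * L)) / t"
      using t by (simp only: divide_right_mono less_imp_le)
    also have "\<dots> = (\<phi> p + 2 * L) * ?I" using t by simp
    finally show ?thesis .
  qed
  define t where "t n = 1 / real (Suc n)" for n
  have t: "0 < t n" "t n \<le> 1" for n by (auto simp: t_def)
  have t0: "t \<longlonglongrightarrow> 0" unfolding t_def using LIMSEQ_inverse_real_of_nat by (simp add: inverse_eq_divide)
  let ?g = "\<lambda>v. indicator (ball 0 1 - ball 0 (1 - h)) v * (sgn v \<bullet> p) / h * \<phi> v"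
  have [measurable]: "\<phi> \<in> borel_measurable borel" "?\<rho> \<in> borel_measurable borel"
    by (intro borel_measurable_continuous_onI cont cont_cut)+
  have "(\<lambda>n. \<integral>v. q (t n) v \<partial>lborel) \<longlonglongrightarrow> (\<integral>v. ?g v \<partial>lborel)"
  proof (rule integral_dominated_convergence)
    show "?g \<in> borel_measurable lborel" by measurable
    show "q (t n) \<in> borel_measurable lborel" for n unfolding q_def by measurable
    \<comment> \<open>difference quotients of the cutoff are at most \<open>|p| / h\<close> and vanish outside this ball, as \<open>t n \<le> 1\<close>\<close>
    show "integrable lborel (\<lambda>v. indicator (cball 0 (1 + norm p)) v * (norm p / h * \<bar>\<phi> v\<bar>))"
      by (intro int continuous_intros cont)
    have null: "AE v::real^'d in lborel. norm v \<noteq> s" for s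
    proof -
      have "sphere (0::real^'d) s \<in> null_sets lborel"
        using negligible_sphere[of "0::real^'d" s] by (simp add: negligible_iff_null_sets null_sets_completion_iff)
      then show ?thesis by (auto dest!: AE_not_in)
    qed
    show "AE v in lborel. (\<lambda>n. q (t n) v) \<longlonglongrightarrow> ?g v"
      using null[of 1] null[of "1 - h"]
    proof eventually_elim
      fix v :: "real^'d" assume v: "norm v \<noteq> 1" "norm v \<noteq> 1 - h"
      have "((\<lambda>t. (?\<rho> (v - t *\<^sub>R p) - ?\<rho> v) / t) \<longlongrightarrow> indicator (ball 0 1 - ball 0 (1 - h)) v * (sgn v \<bullet> p) / h) (at 0)"
        using cutoff_deriv[OF h v, of p] by (simp add: DERIV_def)
      moreover have "filterlim t (at 0) sequentially"
        using t0 t(1) by (auto simp: filterlim_at less_imp_neq[symmetric])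
      ultimately have "(\<lambda>n. (?\<rho> (v - t n *\<^sub>R p) - ?\<rho> v) / t n) \<longlonglongrightarrow> indicator (ball 0 1 - ball 0 (1 - h)) v * (sgn v \<bullet> p) / h"
        by (rule filterlim_compose)
      then show "(\<lambda>n. q (t n) v) \<longlonglongrightarrow> ?g v" unfolding q_def by (intro tendsto_mult tendsto_const)
    qed
    show "AE v in lborel. norm (q (t n) v) \<le> indicator (cball 0 (1 + norm p)) v * (norm p / h * \<bar>\<phi> v\<bar>)" for n
    proof (rule AE_I2)
      fix v :: "real^'d"
      have tp: "norm (t n *\<^sub>R p) \<le> norm p" using t[of n] by (simp add: mult_left_le_one_le)
      show "norm (q (t n) v) \<le> indicator (cball 0 (1 + norm p)) v * (norm p / h * \<bar>\<phi> v\<bar>)"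
      proof (cases "norm v \<le> 1 + norm p")
        case True
        have "\<bar>?\<rho> (v - t n *\<^sub>R p) - ?\<rho> v\<bar> / t n \<le> (norm (t n *\<^sub>R p) / h) / t n"
          using cutoff_lipschitz[OF h(1), of "v - t n *\<^sub>R p" v] t[of n] by (intro divide_right_mono) auto
        also have "\<dots> = norm p / h" using t[of n] by simp
        finally have "\<bar>?\<rho> (v - t n *\<^sub>R p) - ?\<rho> v\<bar> / t n \<le> norm p / h" .
        from mult_right_mono[OF this, of "\<bar>\<phi> v\<bar>"] show ?thesis
          using True t[of n] by (simp add: q_def abs_mult)
      next
        case False
        have "norm v - norm (t n *\<^sub>R p) \<le> norm (v - t n *\<^sub>R p)" by (rule norm_triangle_ineq2)
        then have "?\<rho> (v - t n *\<^sub>R p) = 0" "?\<rho> v = 0"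
          using False tp norm_ge_zero[of p] by (intro cutoff_eq_0 h; linarith)+
        then show ?thesis using h by (simp add: q_def)
      qed
    qed
  qed
  then have "(\<integral>v. ?g v \<partial>lborel) \<le> (\<phi> p + 2 * L) * ?I"
    by (rule LIMSEQ_le_const2) (use step t in blast)
  then show ?thesis by (simp add: algebra_simps)
qed

lemma tendsto_annulus_ratio:
  "((\<lambda>h::real. (1 - (1 - h) ^ n) / h) \<longlongrightarrow> real n) (at_right 0)"
proof -
  have "((\<lambda>h::real. 1 - (1 - h) ^ n) has_real_derivative real n) (at 0)"
    by (auto intro!: derivative_eq_intros)
  then have "((\<lambda>h::real. (1 - (1 - h) ^ n) / h) \<longlongrightarrow> real n) (at 0)"
    by (simp add: DERIV_def)
  then show ?thesis by (rule filterlim_mono) (auto simp: at_le)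
qed

text \<open>The shell estimate in the limit \<open>h \<rightarrow> 0\<close>.  On the shell, \<open>\<phi> v\<close> differs from its value at the
direction of \<open>v\<close> by at most \<open>L h\<close>, and the shell has relative volume \<open>1 - (1 - h)^d\<close>, which divided by
\<open>h\<close> tends to the dimension factor of the claim.\<close>

lemma sphere_average_le:
  fixes \<phi> :: "real^'d::finite \<Rightarrow> real"
  assumes cvx: "convex_on UNIV \<phi>" and lip: "L-lipschitz_on UNIV \<phi>" and zero: "\<phi> 0 = 0"
  shows "real CARD('d) * (\<integral>u. \<phi> u * (u \<bullet> p) \<partial>uniform_sphere) \<le> \<phi> p + 2 * L"
proof -
  let ?V = "measure lborel (ball (0::real^'d) 1)" and ?d = "CARD('d)"
  let ?E = "\<integral>u. \<phi> u * (u \<bullet> p) \<partial>uniform_sphere"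
  have V: "?V > 0" by (rule ball_measure_pos)
  have L0: "L \<ge> 0" using lip by (rule lipschitz_on_nonneg)
  have cont: "continuous_on S \<phi>" for S
    using lipschitz_on_continuous_on[OF lip] continuous_on_subset by blast
  have [measurable]: "\<phi> \<in> borel_measurable borel"
    by (intro borel_measurable_continuous_onI cont)
  have fin: "emeasure lborel (A::(real^'d) set) < \<infinity>" if "A \<subseteq> ball 0 1" "A \<in> sets borel" for A
    using emeasure_mono[OF that(1), of lborel] emeasure_lborel_ball_finite[of "0::real^'d" 1] that(2)
    by (auto intro: le_less_trans)
  have intb: "integrable lborel (\<lambda>v. indicator A v * f v)"
    if A: "A \<subseteq> ball 0 1" "A \<in> sets borel" and f: "f \<in> borel_measurable borel" "\<And>v. v \<in> A \<Longrightarrow> \<bar>f v\<bar> \<le> B"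
    for A and f :: "real^'d \<Rightarrow> real" and B
  proof (rule Bochner_Integration.integrable_bound)
    show "integrable lborel (\<lambda>v. indicator A v * B)"
      using fin[OF A] A(2) by (intro integrable_mult_left integrable_real_indicator) auto
    show "(\<lambda>v. indicator A v * f v) \<in> borel_measurable lborel" using A(2) f(1) by simp
    show "AE v in lborel. norm (indicator A v * f v) \<le> norm (indicator A v * B)"
      using f(2) by (intro AE_I2) (fastforce split: split_indicator)
  qed
  let ?I = "\<lambda>h. \<integral>v. cutoff h (v::real^'d) \<partial>lborel"
  let ?a = "\<lambda>h::real. 1 - (1 - h) ^ ?d"
  have phi_bd: "\<bar>\<phi> v * (w \<bullet> p)\<bar> \<le> L * norm p" if "norm v \<le> 1" "norm w \<le> 1" for v w
  proof -
    have "\<bar>\<phi> v\<bar> \<le> L * norm v" using lipschitz_onD[OF lip, of v 0] zero by (simp add: dist_norm)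
    also have "\<dots> \<le> L * 1" using that L0 by (intro mult_left_mono) auto
    finally have "\<bar>\<phi> v\<bar> \<le> L" by simp
    moreover have "\<bar>w \<bullet> p\<bar> \<le> norm p"
      using Cauchy_Schwarz_ineq2[of w p] that mult_right_mono[of "norm w" 1 "norm p"] by simp
    ultimately show ?thesis using L0 by (simp add: abs_mult mult_mono)
  qed
  have main: "?a h / h * (?V * ?E) \<le> (\<phi> p + 2 * L) * ?I h + L * norm p * (?a h * ?V)"
    and low: "(1 - h) ^ ?d * ?V \<le> ?I h" and up: "?I h \<le> ?V" if h: "0 < h" "h < 1" for h
  proof -
    let ?S = "ball (0::real^'d) 1 - ball 0 (1 - h)"
    have sub: "ball (0::real^'d) (1 - h) \<subseteq> ball 0 1" using h by auto
    have ang: "(\<integral>v. indicator ?S v * f (sgn v) \<partial>lborel) = ?a h * (\<integral>v. indicator (ball 0 1) v * f (sgn v) \<partial>lborel)"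
      if [measurable]: "f \<in> borel_measurable borel" and f: "\<And>v. norm v \<le> 1 \<Longrightarrow> \<bar>f v\<bar> \<le> B"
      for f :: "real^'d \<Rightarrow> real" and B
    proof -
      have fs: "\<bar>f (sgn v)\<bar> \<le> B" for v by (rule f) (simp add: norm_sgn)
      have "(\<integral>v. indicator ?S v * f (sgn v) \<partial>lborel)
          = (\<integral>v. indicator (ball 0 1) v * f (sgn v) - indicator (ball 0 (1 - h)) v * f (sgn v) \<partial>lborel)"
        using sub by (intro Bochner_Integration.integral_cong) (auto split: split_indicator)
      also have "\<dots> = (\<integral>v. indicator (ball 0 1) v * f (sgn v) \<partial>lborel)
          - (\<integral>v. indicator (ball 0 (1 - h)) v * f (sgn v) \<partial>lborel)"
        by (intro Bochner_Integration.integral_diff intb[where B = B] sub) (use fs in auto)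
      also have "(\<integral>v. indicator (ball 0 (1 - h)) v * f (sgn v) \<partial>lborel)
          = (1 - h) ^ ?d * (\<integral>v. indicator (ball 0 1) v * f (sgn v) \<partial>lborel)"
        using h by (intro integral_ball_angular) auto
      finally show ?thesis by (simp add: algebra_simps)
    qed
    have mS: "(\<integral>v. indicator ?S v \<partial>lborel) = ?a h * ?V"
      using ang[of "\<lambda>_. 1" 1] by simp
    have E: "(\<integral>v. indicator (ball 0 1) v * (\<phi> (sgn v) * (sgn v \<bullet> p)) \<partial>lborel) = ?V * ?E"
      using V by (subst integral_uniform_sphere) auto
    have "?a h * (?V * ?E) = (\<integral>v. indicator ?S v * (\<phi> (sgn v) * (sgn v \<bullet> p)) \<partial>lborel)"
      using ang[of "\<lambda>u. \<phi> u * (u \<bullet> p)" "L * norm p"] phi_bd E by simp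
    also have "\<dots> \<le> (\<integral>v. indicator ?S v * ((sgn v \<bullet> p) * \<phi> v) + indicator ?S v * (L * h * norm p) \<partial>lborel)"
    proof (rule integral_mono)
      show "integrable lborel (\<lambda>v. indicator ?S v * (\<phi> (sgn v) * (sgn v \<bullet> p)))"
        by (rule intb[where B = "L * norm p"]) (auto intro!: phi_bd simp: norm_sgn)
      show "integrable lborel (\<lambda>v. indicator ?S v * ((sgn v \<bullet> p) * \<phi> v) + indicator ?S v * (L * h * norm p))"
        using phi_bd by (intro Bochner_Integration.integrable_add intb[where B = "L * norm p"] intb[where B = "\<bar>L * h * norm p\<bar>"])
           (auto simp: norm_sgn mult.commute[of "_ \<bullet> _"])
      fix v :: "real^'d"
      show "indicator ?S v * (\<phi> (sgn v) * (sgn v \<bullet> p)) \<le> indicator ?S v * ((sgn v \<bullet> p) * \<phi> v) + indicator ?S v * (L * h * norm p)"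
      proof (cases "v \<in> ?S")
        case True
        then have v: "norm v < 1" "1 - h \<le> norm v" "v \<noteq> 0" using h by auto
        have "sgn v - v = (1 - norm v) *\<^sub>R sgn v"
          using v(3) by (simp add: sgn_div_norm algebra_simps)
        then have "norm (sgn v - v) = 1 - norm v" using v by (simp add: norm_sgn)
        then have "\<bar>\<phi> (sgn v) - \<phi> v\<bar> \<le> L * (1 - norm v)"
          using lipschitz_onD[OF lip, of "sgn v" v] by (simp add: dist_norm)
        also have "\<dots> \<le> L * h" using v L0 by (intro mult_left_mono) auto
        finally have 1: "\<bar>\<phi> (sgn v) - \<phi> v\<bar> \<le> L * h" .
        have 2: "\<bar>sgn v \<bullet> p\<bar> \<le> norm p"
          using Cauchy_Schwarz_ineq2[of "sgn v" p] v by (simp add: norm_sgn)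
        have "(\<phi> (sgn v) - \<phi> v) * (sgn v \<bullet> p) \<le> \<bar>\<phi> (sgn v) - \<phi> v\<bar> * \<bar>sgn v \<bullet> p\<bar>"
          by (metis abs_ge_self abs_mult)
        also have "\<dots> \<le> L * h * norm p" using 1 2 by (intro mult_mono) auto
        finally show ?thesis using True by (simp add: algebra_simps)
      qed simp
    qed
    also have "\<dots> = (\<integral>v. indicator ?S v * ((sgn v \<bullet> p) * \<phi> v) \<partial>lborel) + (\<integral>v. indicator ?S v * (L * h * norm p) \<partial>lborel)"
      using phi_bd by (intro Bochner_Integration.integral_add intb[where B = "L * norm p"] intb[where B = "\<bar>L * h * norm p\<bar>"])
           (auto simp: norm_sgn mult.commute[of "_ \<bullet> _"])
    also have "(\<integral>v. indicator ?S v * (L * h * norm p) \<partial>lborel) = ?a h * ?V * (L * h * norm p)"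
      using mS by simp
    finally have "?a h * (?V * ?E) / h \<le> ((\<integral>v. indicator ?S v * ((sgn v \<bullet> p) * \<phi> v) \<partial>lborel) + ?a h * ?V * (L * h * norm p)) / h"
      using h by (intro divide_right_mono) auto
    also have "\<dots> = (\<integral>v. indicator ?S v * ((sgn v \<bullet> p) * \<phi> v) \<partial>lborel) / h + L * norm p * (?a h * ?V)"
      using h by (simp add: field_simps)
    also have "\<dots> \<le> (\<phi> p + 2 * L) * ?I h + L * norm p * (?a h * ?V)"
      using shell_flux_le[OF cvx lip zero h, of p] by simp
    finally show "?a h / h * (?V * ?E) \<le> (\<phi> p + 2 * L) * ?I h + L * norm p * (?a h * ?V)" by simp
    have ic: "integrable lborel (cutoff h :: real^'d \<Rightarrow> real)"
    proof -
      have "integrable lborel (\<lambda>v. indicator (ball (0::real^'d) 1) v * cutoff h v)"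
        by (intro intb[where B = 1] borel_measurable_continuous_onI continuous_on_cutoff h)
           (auto simp: cutoff_bounds abs_le_iff intro: order_trans[OF _ cutoff_bounds(1)])
      also have "(\<lambda>v. indicator (ball (0::real^'d) 1) v * cutoff h v) = cutoff h"
        by (auto simp: fun_eq_iff cutoff_eq_0[OF h(1)] not_less split: split_indicator)
      finally show ?thesis .
    qed
    have "(1 - h) ^ ?d * ?V = (\<integral>v. indicator (ball (0::real^'d) (1 - h)) v \<partial>lborel)"
      using integral_ball_angular[of "\<lambda>_::real^'d. 1" "1 - h"] h by simp
    also have "\<dots> \<le> ?I h"
      using ic h fin[OF sub] cutoff_bounds(1)[of h, where 'a = "real^'d"] cutoff_eq_1[OF h(1), where 'a = "real^'d"]
      by (intro integral_mono) (auto split: split_indicator intro!: integrable_real_indicator)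
    finally show "(1 - h) ^ ?d * ?V \<le> ?I h" .
    have "?I h \<le> (\<integral>v. indicator (ball (0::real^'d) 1) v \<partial>lborel)"
      using ic h fin[OF order_refl] cutoff_bounds(2)[of h, where 'a = "real^'d"] cutoff_eq_0[OF h(1), where 'a = "real^'d"]
      by (intro integral_mono) (auto split: split_indicator intro!: integrable_real_indicator)
    then show "?I h \<le> ?V" by simp
  qed
  have ev: "\<forall>\<^sub>F h in at_right (0::real). 0 < h \<and> h < 1"
    by (rule eventually_at_rightI[of 0 1]) auto
  have I_lim: "(?I \<longlongrightarrow> ?V) (at_right 0)"
  proof (rule tendsto_sandwich)
    show "\<forall>\<^sub>F h in at_right 0. (1 - h) ^ ?d * ?V \<le> ?I h"
      using ev by eventually_elim (use low in auto)
    show "\<forall>\<^sub>F h in at_right 0. ?I h \<le> ?V"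
      using ev by eventually_elim (use up in auto)
    show "((\<lambda>h::real. (1 - h) ^ ?d * ?V) \<longlongrightarrow> ?V) (at_right 0)"
      by (auto intro!: tendsto_eq_intros)
  qed simp
  have "real ?d * (?V * ?E) \<le> (\<phi> p + 2 * L) * ?V + L * norm p * (0 * ?V)"
  proof (rule tendsto_le)
    show "((\<lambda>h. ?a h / h * (?V * ?E)) \<longlongrightarrow> real ?d * (?V * ?E)) (at_right 0)"
      by (intro tendsto_mult tendsto_const tendsto_annulus_ratio)
    have "((\<lambda>h::real. 1 - (1 - h) ^ ?d) \<longlongrightarrow> 0) (at_right 0)"
      by (auto intro!: tendsto_eq_intros)
    then show "((\<lambda>h. (\<phi> p + 2 * L) * ?I h + L * norm p * (?a h * ?V)) \<longlongrightarrow>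
        (\<phi> p + 2 * L) * ?V + L * norm p * (0 * ?V)) (at_right 0)"
      by (intro tendsto_intros I_lim)
    show "\<forall>\<^sub>F h in at_right 0. ?a h / h * (?V * ?E) \<le> (\<phi> p + 2 * L) * ?I h + L * norm p * (?a h * ?V)"
      using ev by eventually_elim (use main in auto)
  qed simp
  then have "?V * (real ?d * ?E) \<le> ?V * (\<phi> p + 2 * L)" by (simp add: algebra_simps)
  then show ?thesis using V by simp
qed

text \<open>The inequality above for \<open>\<phi> v = f(x + \<mu> v) - f x\<close> and \<open>p = (y - x) / \<mu>\<close>; the Lipschitz constant
\<open>\<mu> L\<close> of \<open>\<phi>\<close> makes the error small although \<open>p\<close> is large.  Points outside \<open>D\<close> are handled by the
extension, which agrees with \<open>f\<close> at almost all query points.\<close>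

lemma sphere_estimator_le:
  fixes f :: "real^'d::finite \<Rightarrow> real"
  assumes cvx: "convex_on D f" and lip: "L-lipschitz_on D f"
    and x: "x \<in> D" and y: "y \<in> D" and \<mu>: "\<mu> > 0"
    and [measurable]: "f \<in> borel_measurable borel"
    and sphere: "AE u in uniform_sphere. x + \<mu> *\<^sub>R u \<in> D"
  shows "(\<integral>u. real CARD('d) / \<mu> * (f (x + \<mu> *\<^sub>R u) - f x) * (u \<bullet> (y - x)) \<partial>uniform_sphere)
    \<le> f y - f x + 2 * \<mu> * L"
proof -
  obtain g where g: "convex_on UNIV g" "L-lipschitz_on UNIV g" "\<And>x. x \<in> D \<Longrightarrow> g x = f x"
    using convex_lipschitz_extension[OF cvx lip] x by blast
  define \<phi> where "\<phi> v = g (x + \<mu> *\<^sub>R v) - g x" for v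
  have "convex_on UNIV \<phi>"
  proof (rule convex_onI)
    fix t :: real and a b :: "real^'d" assume t: "0 < t" "t < 1"
    have "x + \<mu> *\<^sub>R ((1 - t) *\<^sub>R a + t *\<^sub>R b) = (1 - t) *\<^sub>R (x + \<mu> *\<^sub>R a) + t *\<^sub>R (x + \<mu> *\<^sub>R b)"
      by (simp add: algebra_simps)
    then show "\<phi> ((1 - t) *\<^sub>R a + t *\<^sub>R b) \<le> (1 - t) * \<phi> a + t * \<phi> b"
      using convex_onD[OF g(1), of t "x + \<mu> *\<^sub>R a" "x + \<mu> *\<^sub>R b"] t
      by (simp add: \<phi>_def algebra_simps)
  qed simp
  moreover have "(\<mu> * L)-lipschitz_on UNIV \<phi>"
  proof (rule lipschitz_onI)
    fix a b :: "real^'d"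
    have "\<mu> *\<^sub>R a - \<mu> *\<^sub>R b = \<mu> *\<^sub>R (a - b)" by (simp add: algebra_simps)
    then show "dist (\<phi> a) (\<phi> b) \<le> \<mu> * L * dist a b"
      using lipschitz_onD[OF g(2), of "x + \<mu> *\<^sub>R a" "x + \<mu> *\<^sub>R b"] \<mu>
      by (simp add: \<phi>_def dist_norm mult_ac)
  qed (use \<mu> lipschitz_on_nonneg[OF g(2)] in simp)
  ultimately have "real CARD('d) * (\<integral>u. \<phi> u * (u \<bullet> ((1 / \<mu>) *\<^sub>R (y - x))) \<partial>uniform_sphere)
      \<le> \<phi> ((1 / \<mu>) *\<^sub>R (y - x)) + 2 * (\<mu> * L)"
    by (rule sphere_average_le) (simp add: \<phi>_def)
  also have "\<phi> ((1 / \<mu>) *\<^sub>R (y - x)) = f y - f x"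
    using \<mu> g(3) x y by (simp add: \<phi>_def)
  also have "real CARD('d) * (\<integral>u. \<phi> u * (u \<bullet> ((1 / \<mu>) *\<^sub>R (y - x))) \<partial>uniform_sphere)
      = (\<integral>u. real CARD('d) * (\<phi> u * (u \<bullet> ((1 / \<mu>) *\<^sub>R (y - x)))) \<partial>uniform_sphere)"
    by simp
  also have "\<dots> = (\<integral>u. real CARD('d) / \<mu> * (f (x + \<mu> *\<^sub>R u) - f x) * (u \<bullet> (y - x)) \<partial>uniform_sphere)"
  proof (rule integral_cong_AE)
    have [measurable]: "g \<in> borel_measurable borel"
      using lipschitz_on_continuous_on[OF g(2)] by (rule borel_measurable_continuous_onI)
    show "(\<lambda>u. real CARD('d) * (\<phi> u * (u \<bullet> ((1 / \<mu>) *\<^sub>R (y - x))))) \<in> borel_measurable uniform_sphere"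
      unfolding \<phi>_def by measurable
    show "AE u in uniform_sphere. real CARD('d) * (\<phi> u * (u \<bullet> ((1 / \<mu>) *\<^sub>R (y - x)))) =
        real CARD('d) / \<mu> * (f (x + \<mu> *\<^sub>R u) - f x) * (u \<bullet> (y - x))"
      using sphere by eventually_elim (use x g(3) in \<open>simp add: \<phi>_def\<close>)
  qed measurable
  finally show ?thesis by simp
qed

section \<open>Summation of a potential with growing weights\<close>

text \<open>Summation by parts puts the \<open>V k\<close> in front of the nonnegative increments of the weights, which add up
to \<open>s T\<close>; each \<open>V k\<close> is then replaced by \<open>m\<close>.\<close>

lemma abel_sum_le:
  fixes V s :: "nat \<Rightarrow> real"
  assumes V: "\<And>k. k \<ge> 1 \<Longrightarrow> 0 \<le> V k" "\<And>k. k \<ge> 1 \<Longrightarrow> V k \<le> m"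
    and s: "\<And>k. 0 \<le> s k" "\<And>k. s k \<le> s (Suc k)"
  shows "(\<Sum>k = 1..T. (V k - V (Suc k)) * s k) \<le> m * s T"
proof -
  have "(\<Sum>k = 1..T. (V k - V (Suc k)) * s k) \<le> m * s T - V (Suc T) * s T"
  proof (induction T)
    case 0
    show ?case using mult_right_mono[OF V(2)[of 1] s(1)[of 0]] by simp
  next
    case (Suc T)
    have "V (Suc T) * (s (Suc T) - s T) \<le> m * (s (Suc T) - s T)"
      using V(2) s(2) by (intro mult_right_mono) auto
    then show ?case using Suc by (simp add: algebra_simps)
  qed
  also have "\<dots> \<le> m * s T" using V(1)[of "Suc T"] s(1)[of T] by simp
  finally show ?thesis .
qed

lemma sum_inverse_sqrt_le:
  assumes "c \<ge> 0"
  shows "(\<Sum>k = 1..T. 1 / sqrt (real k + c)) \<le> 2 * sqrt (real T + c)"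
proof (induction T)
  case (Suc T)
  let ?a = "sqrt (real T + c)" and ?b = "sqrt (real (Suc T) + c)"
  have b: "?b > 0" and ab: "?a \<le> ?b" using assms by auto
  have "(?b - ?a) * (?b + ?a) = 1"
    using assms by (simp add: algebra_simps)
  moreover have "(?b - ?a) * (?b + ?a) \<le> (?b - ?a) * (2 * ?b)"
    using ab by (intro mult_left_mono) auto
  ultimately have "1 \<le> (?b - ?a) * (2 * ?b)" by simp
  then have "1 / ?b \<le> (?b - ?a) * (2 * ?b) / ?b" using b by (intro divide_right_mono) auto
  also have "\<dots> = 2 * ?b - 2 * ?a" using b by simp
  finally have "1 / ?b \<le> 2 * ?b - 2 * ?a" .
  then show ?case using Suc by simp
qed (use assms in simp)

text \<open>Dividing a potential decrease by the step size \<open>1 / (q sqrt (k + c))\<close> and summing: the potential costs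
\<open>m / \<eta>\<^sub>T\<close>, the second-order terms a sum of inverse square roots.\<close>

lemma sum_of_one_step_gains_le:
  fixes V gap \<eta> :: "nat \<Rightarrow> real"
  assumes V: "\<And>k. k \<ge> 1 \<Longrightarrow> 0 \<le> V k" "\<And>k. k \<ge> 1 \<Longrightarrow> V k \<le> m"
    and gain: "\<And>k. k \<ge> 1 \<Longrightarrow> \<eta> k * gap k \<le> V k - V (Suc k) + A * (\<eta> k)\<^sup>2 + b * \<eta> k"
    and \<eta>: "\<And>k. \<eta> k = 1 / (q * sqrt (real k + c))" and q: "q > 0" and c: "c > 0" and A: "A \<ge> 0"
  shows "(\<Sum>k = 1..T. gap k) \<le> (q * m + 2 * A / q) * sqrt (real T + c) + b * real T"
proof -
  let ?s = "\<lambda>k. sqrt (real k + c)"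
  have s: "?s k > 0" for k using c by (simp add: add_nonneg_pos)
  have eq: "\<eta> k * (q * ?s k) = 1" for k
    using s[of k] q by (simp add: \<eta> less_imp_neq[symmetric])
  have "gap k \<le> (V k - V (Suc k)) * (q * ?s k) + A / q * (1 / ?s k) + b" if "k \<ge> 1" for k
  proof -
    have "gap k = (\<eta> k * gap k) * (q * ?s k)" using eq[of k] by (simp add: mult_ac)
    also have "\<dots> \<le> (V k - V (Suc k) + A * (\<eta> k)\<^sup>2 + b * \<eta> k) * (q * ?s k)"
      using gain[OF that] s[of k] q by (intro mult_right_mono) auto
    also have "\<dots> = (V k - V (Suc k)) * (q * ?s k) + A * \<eta> k * (\<eta> k * (q * ?s k)) + b * (\<eta> k * (q * ?s k))"
      by (simp add: algebra_simps power2_eq_square)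
    finally show ?thesis using eq[of k] by (simp add: \<eta>)
  qed
  then have "(\<Sum>k = 1..T. gap k) \<le> (\<Sum>k = 1..T. (V k - V (Suc k)) * (q * ?s k) + A / q * (1 / ?s k) + b)"
    by (intro sum_mono) auto
  also have "\<dots> = (\<Sum>k = 1..T. (V k - V (Suc k)) * (q * ?s k)) + A / q * (\<Sum>k = 1..T. 1 / ?s k) + b * real T"
    by (simp add: sum.distrib sum_distrib_left mult.commute)
  also have "\<dots> \<le> m * (q * ?s T) + A / q * (2 * ?s T) + b * real T"
    using q A c by (intro add_mono[OF add_mono order_refl] mult_left_mono abel_sum_le V sum_inverse_sqrt_le) auto
  finally show ?thesis by (simp add: algebra_simps)
qed

lemma contraction_bounded:
  fixes e :: "nat \<Rightarrow> real"
  assumes "\<And>k. e (Suc k) \<le> (1 - a) * e k + b" and a: "0 < a" "a \<le> 1" and "b \<ge> 0" "e 0 \<le> m"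
    "m \<ge> 0"
  shows "e k \<le> m + b / a"
proof (induction k)
  case 0
  show ?case using assms by (simp add: add_increasing2)
next
  case (Suc k)
  have "e (Suc k) \<le> (1 - a) * e k + b" by fact
  also have "\<dots> \<le> (1 - a) * (m + b / a) + b"
    using Suc a by (intro add_right_mono mult_left_mono) auto
  also have "\<dots> = m + b / a - a * m" using a by (simp add: field_simps)
  also have "\<dots> \<le> m + b / a" using a \<open>m \<ge> 0\<close> by simp
  finally show ?case .
qed

section \<open>Disagreement and the projected step\<close>

lemma norm_add_sq_le: "(norm (a + b :: 'a::real_inner))\<^sup>2 \<le> 2 * (norm a)\<^sup>2 + 2 * (norm b)\<^sup>2"
proof -
  have "(norm (a + b))\<^sup>2 \<le> (norm a + norm b)\<^sup>2"
    by (intro power_mono norm_triangle_ineq) simp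
  also have "\<dots> \<le> 2 * (norm a)\<^sup>2 + 2 * (norm b)\<^sup>2"
    using zero_le_power2[of "norm a - norm b"] by (simp only: power2_eq_square algebra_simps)
  finally show ?thesis .
qed

lemma norm_sq_rows: "(norm (Z :: real^'d::finite^'n::finite))\<^sup>2 = (\<Sum>i\<in>UNIV. (norm (Z $ i))\<^sup>2)"
  by (simp add: norm_vec_def L2_set_def sum_nonneg)

lemma matrix_mult_row: "((W :: real^'n^'m) ** (Z :: real^'d^'n)) $ i = (\<Sum>j\<in>UNIV. W $ i $ j *\<^sub>R Z $ j)"
  by (simp add: vec_eq_iff matrix_matrix_mult_def)

lemma avg_matrix_row: "(avg_matrix ** (Z :: real^'d^'n::finite)) $ i = row_average Z"
  by (simp add: matrix_mult_row avg_matrix_def row_average_def scaleR_sum_right)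

lemma laplacian_bound:
  fixes W :: "real^'n::finite^'n"
  obtains k where "k \<ge> 0" "\<And>Z :: real^'d::finite^'n. norm (Z - W ** Z) \<le> k * norm Z"
proof -
  have "linear (\<lambda>Z :: real^'d^'n. Z - W ** Z)"
    by (rule linearI) (simp_all add: vec_eq_iff matrix_mult_row scaleR_add_right sum.distrib scaleR_diff_right
        scaleR_sum_right mult.commute sum_component)
  then obtain k where "k \<ge> 0" "\<And>Z :: real^'d^'n. norm (Z - W ** Z) \<le> norm Z * k"
    using bounded_linear.nonneg_bounded linear_conv_bounded_linear by blast
  then show ?thesis using that[of k] by (simp add: mult.commute)
qed

text \<open>Mass conservation of gossip: corrections of the form \<open>(I - W) Z\<close> do not move the average.\<close>

lemma laplacian_column_sum:
  assumes "doubly_stochastic W"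
  shows "(\<Sum>i\<in>UNIV. (Z - W ** Z) $ i) = (0 :: real^'d)"
proof -
  have "(\<Sum>i\<in>UNIV. (W ** Z) $ i) = (\<Sum>j\<in>UNIV. \<Sum>i\<in>UNIV. W $ i $ j *\<^sub>R Z $ j)"
    unfolding matrix_mult_row by (rule sum.swap)
  also have "\<dots> = (\<Sum>j\<in>UNIV. Z $ j)"
    using assms by (simp add: doubly_stochastic_def flip: scaleR_left.sum)
  finally show ?thesis by (simp add: sum_subtractf)
qed

lemma laplacian_avg:
  assumes "doubly_stochastic W"
  shows "avg_matrix ** Z - W ** (avg_matrix ** Z) = (0 :: real^'d^'n::finite)"
proof -
  have "(W ** (avg_matrix ** Z)) $ i = row_average Z" for i
    using assms by (simp add: matrix_mult_row[of W] avg_matrix_row doubly_stochastic_def flip: scaleR_left.sum)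
  then show ?thesis by (simp add: vec_eq_iff[of "_ - _"] avg_matrix_row)
qed

text \<open>Expand the square after discarding the projection.  The communication step
\<open>B = Z - W Z\<close> pairs with \<open>X - y\<close> only through the disagreement part of \<open>X\<close>, and \<open>B\<close> itself depends only on
the disagreement and on the lag \<open>Z - X\<close>; so it costs a multiple of the squared errors and nothing
linear.\<close>

lemma projected_step_le:
  fixes X X' Z G :: "real^'d::finite^'n::finite" and W :: "real^'n^'n"
  assumes W: "doubly_stochastic W" and k: "k \<ge> 0" "\<And>Z :: real^'d^'n. norm (Z - W ** Z) \<le> k * norm Z"
    and S: "closed S" "convex S" "y \<in> S" and \<gamma>: "\<gamma> \<ge> 0"
    and X': "\<And>i. X' $ i = closest_point S (X $ i - \<gamma> *\<^sub>R (Z - W ** Z) $ i - \<eta> *\<^sub>R G $ i)"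
  shows "(\<Sum>i\<in>UNIV. (norm (X' $ i - y))\<^sup>2) \<le> (\<Sum>i\<in>UNIV. (norm (X $ i - y))\<^sup>2)
    + 2 * \<eta> * (\<Sum>i\<in>UNIV. G $ i \<bullet> (y - X $ i))
    + (4 * \<gamma> * k + 4 * (\<gamma> * k)\<^sup>2) * ((norm (X - avg_matrix ** X))\<^sup>2 + (norm (Z - X))\<^sup>2)
    + 2 * \<eta>\<^sup>2 * (norm G)\<^sup>2"
proof -
  define B where "B = Z - W ** Z"
  define Y where "Y = X - avg_matrix ** X"
  let ?a = "norm Y" and ?b = "norm (Z - X)"
  have Brow: "B = (Y + (Z - X)) - W ** (Y + (Z - X))"
  proof -
    have e1: "Y + (Z - X) = Z - avg_matrix ** X" by (simp add: Y_def)
    have e2: "W ** (Z - avg_matrix ** X) = W ** Z - W ** (avg_matrix ** X)"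
      by (simp add: vec_eq_iff matrix_mult_row scaleR_diff_right sum_subtractf)
    have e3: "W ** (avg_matrix ** X) = avg_matrix ** X" using laplacian_avg[OF W, of X] by simp
    show ?thesis unfolding B_def e1 e2 e3 by simp
  qed
  have nB: "norm B \<le> k * (?a + ?b)"
    using k(2)[of "Y + (Z - X)"] norm_triangle_ineq[of Y "Z - X"] k(1) unfolding Brow
    by (meson mult_left_mono order_trans)
  \<comment> \<open>the zero column sums of \<open>B\<close> remove both the average of \<open>X\<close> and the point \<open>y\<close>\<close>
  have "(\<Sum>i\<in>UNIV. B $ i \<bullet> (X $ i - y)) = (\<Sum>i\<in>UNIV. B $ i \<bullet> Y $ i) + (\<Sum>i\<in>UNIV. B $ i) \<bullet> (row_average X - y)"
    by (simp add: Y_def avg_matrix_row inner_sum_left inner_diff_right sum_subtractf sum.distrib)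
  then have cross: "(\<Sum>i\<in>UNIV. B $ i \<bullet> (X $ i - y)) = B \<bullet> Y"
    using laplacian_column_sum[OF W, of Z] by (simp only: B_def inner_zero_left add_0_right inner_vec_def[of "Z - W ** Z" Y])
  have "- (B \<bullet> Y) \<le> k * (?a + ?b) * ?a"
    using Cauchy_Schwarz_ineq2[of B Y] mult_right_mono[OF nB, of ?a] by simp
  also have "\<dots> = k * ((?a + ?b) * ?a)" by simp
  also have "(?a + ?b) * ?a \<le> 2 * (?a\<^sup>2 + ?b\<^sup>2)"
  proof -
    have "?a * ?b \<ge> 0" by simp
    moreover have "2 * (?a * ?b) \<le> ?a\<^sup>2 + ?b\<^sup>2"
      using sum_squares_bound[of ?a ?b] by (simp only: mult.assoc)
    moreover have "0 \<le> ?b\<^sup>2" by simp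
    ultimately have "?a\<^sup>2 + ?a * ?b \<le> 2 * (?a\<^sup>2 + ?b\<^sup>2)" by argo
    then show ?thesis by (simp only: power2_eq_square distrib_right mult.commute[of ?b ?a])
  qed
  finally have c1: "- (B \<bullet> Y) \<le> k * (2 * (?a\<^sup>2 + ?b\<^sup>2))" using k(1) by (simp add: mult_left_mono)
  have "(norm B)\<^sup>2 \<le> (k * (?a + ?b))\<^sup>2" using nB by (intro power_mono) auto
  also have "\<dots> = k\<^sup>2 * (?a + ?b)\<^sup>2" by (simp add: power_mult_distrib)
  also have "(?a + ?b)\<^sup>2 \<le> 2 * (?a\<^sup>2 + ?b\<^sup>2)"
    using zero_le_power2[of "?a - ?b"] by (simp add: power2_eq_square algebra_simps)
  finally have c2: "(norm B)\<^sup>2 \<le> k\<^sup>2 * (2 * (?a\<^sup>2 + ?b\<^sup>2))" by (simp add: mult_left_mono)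
  have row: "(norm (X' $ i - y))\<^sup>2 \<le> (norm (X $ i - y))\<^sup>2 - 2 * \<gamma> * (B $ i \<bullet> (X $ i - y))
      + 2 * \<eta> * (G $ i \<bullet> (y - X $ i)) + 2 * \<gamma>\<^sup>2 * (norm (B $ i))\<^sup>2 + 2 * \<eta>\<^sup>2 * (norm (G $ i))\<^sup>2" for i
  proof -
    let ?v = "\<gamma> *\<^sub>R B $ i + \<eta> *\<^sub>R G $ i"
    have "norm (X' $ i - y) \<le> norm (X $ i - \<gamma> *\<^sub>R B $ i - \<eta> *\<^sub>R G $ i - y)"
      using closest_point_lipschitz[OF S(2,1), of "X $ i - \<gamma> *\<^sub>R B $ i - \<eta> *\<^sub>R G $ i" y] S(3)
        closest_point_self[OF S(3)] by (auto simp: X' B_def dist_norm)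
    also have "X $ i - \<gamma> *\<^sub>R B $ i - \<eta> *\<^sub>R G $ i - y = (X $ i - y) - ?v" by simp
    finally have "(norm (X' $ i - y))\<^sup>2 \<le> (norm ((X $ i - y) - ?v))\<^sup>2" by (intro power_mono) auto
    also have "\<dots> = (norm (X $ i - y))\<^sup>2 - 2 * (?v \<bullet> (X $ i - y)) + (norm ?v)\<^sup>2"
      by (simp add: power2_norm_eq_inner algebra_simps inner_commute)
    also have "?v \<bullet> (X $ i - y) = \<gamma> * (B $ i \<bullet> (X $ i - y)) - \<eta> * (G $ i \<bullet> (y - X $ i))"
      by (simp add: algebra_simps)
    finally have 1: "(norm (X' $ i - y))\<^sup>2 \<le> (norm (X $ i - y))\<^sup>2
        - 2 * (\<gamma> * (B $ i \<bullet> (X $ i - y)) - \<eta> * (G $ i \<bullet> (y - X $ i))) + (norm ?v)\<^sup>2" .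
    have 2: "(norm ?v)\<^sup>2 \<le> 2 * \<gamma>\<^sup>2 * (norm (B $ i))\<^sup>2 + 2 * \<eta>\<^sup>2 * (norm (G $ i))\<^sup>2"
      using norm_add_sq_le[of "\<gamma> *\<^sub>R B $ i" "\<eta> *\<^sub>R G $ i"] by (simp add: power_mult_distrib)
    show ?thesis using 1 2 by (simp add: algebra_simps)
  qed
  have "(\<Sum>i\<in>UNIV. (norm (X' $ i - y))\<^sup>2) \<le> (\<Sum>i\<in>UNIV. (norm (X $ i - y))\<^sup>2 - 2 * \<gamma> * (B $ i \<bullet> (X $ i - y))
      + 2 * \<eta> * (G $ i \<bullet> (y - X $ i)) + 2 * \<gamma>\<^sup>2 * (norm (B $ i))\<^sup>2 + 2 * \<eta>\<^sup>2 * (norm (G $ i))\<^sup>2)"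
    by (rule sum_mono) (rule row)
  also have "\<dots> = (\<Sum>i\<in>UNIV. (norm (X $ i - y))\<^sup>2) - 2 * \<gamma> * (B \<bullet> Y)
      + 2 * \<eta> * (\<Sum>i\<in>UNIV. G $ i \<bullet> (y - X $ i)) + 2 * \<gamma>\<^sup>2 * (norm B)\<^sup>2 + 2 * \<eta>\<^sup>2 * (norm G)\<^sup>2"
    by (simp only: sum.distrib sum_subtractf sum_distrib_left[symmetric] cross norm_sq_rows[symmetric])
  also have "\<dots> \<le> (\<Sum>i\<in>UNIV. (norm (X $ i - y))\<^sup>2) + 2 * \<gamma> * (k * (2 * (?a\<^sup>2 + ?b\<^sup>2)))
      + 2 * \<eta> * (\<Sum>i\<in>UNIV. G $ i \<bullet> (y - X $ i)) + 2 * \<gamma>\<^sup>2 * (k\<^sup>2 * (2 * (?a\<^sup>2 + ?b\<^sup>2))) + 2 * \<eta>\<^sup>2 * (norm G)\<^sup>2"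
    using mult_left_mono[OF c1, of "2 * \<gamma>"] mult_left_mono[OF c2, of "2 * \<gamma>\<^sup>2"] \<gamma> by simp
  finally show ?thesis by (simp add: Y_def[symmetric] power_mult_distrib algebra_simps)
qed

section \<open>The state and the draws of a round\<close>

lemma borel_measurable_closest_point:
  fixes S :: "(real^'d::finite) set"
  assumes "closed S" "convex S" "S \<noteq> {}" and [measurable]: "f \<in> borel_measurable G"
  shows "(\<lambda>w. closest_point S (f w)) \<in> borel_measurable G"
  by (rule borel_measurable_continuous_on[OF continuous_on_closest_point[OF assms(2,1,3)] assms(4)])

lemma distr_pair_snd:
  assumes "prob_space A" and "sigma_finite_measure B"
  shows "distr (A \<Otimes>\<^sub>M B) B snd = B"
proof (rule measure_eqI)
  interpret A: prob_space A by fact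
  interpret B: sigma_finite_measure B by fact
  fix E assume "E \<in> sets (distr (A \<Otimes>\<^sub>M B) B snd)"
  then have E: "E \<in> sets B" by simp
  have "snd -` E \<inter> space (A \<Otimes>\<^sub>M B) = space A \<times> E"
    using sets.sets_into_space[OF E] by (auto simp: space_pair_measure)
  then show "emeasure (distr (A \<Otimes>\<^sub>M B) B snd) E = emeasure B E"
    unfolding emeasure_distr[OF measurable_snd E]
    by (simp only: B.emeasure_pair_measure_Times[OF sets.top E] A.emeasure_space_1 mult_1)
qed simp

text \<open>One execution of the algorithm, for a single horizon.  The smoothing radius, the shrinkage and the
step sizes are parameters; only the sum over the rounds ties them to the horizon.\<close>

locale zeroth_order_run =
  fixes M :: "'w measure" and N :: "'n::finite \<Rightarrow> 'n set" and W :: "real^'n^'n"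
    and \<Omega> D :: "(real^'d::finite) set"
    and P :: "'n \<Rightarrow> 's measure" and F :: "'n \<Rightarrow> real^'d \<Rightarrow> 's \<Rightarrow> real"
    and K :: "'c measure" and C :: "'c \<Rightarrow> real^'d \<Rightarrow> real^'d"
    and R_out R_in Lf r \<omega> \<psi> \<gamma> \<mu> \<epsilon> :: real and \<eta> :: "nat \<Rightarrow> real" and b1 b2 :: nat
    and x0 :: "real^'d^'n"
    and \<zeta> :: "nat \<Rightarrow> 'n \<Rightarrow> 'w \<Rightarrow> 'c"
    and u :: "nat \<Rightarrow> 'n \<Rightarrow> nat \<Rightarrow> 'w \<Rightarrow> real^'d"
    and \<xi> :: "nat \<Rightarrow> 'n \<Rightarrow> nat \<Rightarrow> 'w \<Rightarrow> 's"
    and X Xh B Q :: "nat \<Rightarrow> 'w \<Rightarrow> real^'d^'n"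
  assumes network: "network N W"
    and region: "feasible_region \<Omega> R_out R_in"
    and samples: "random_functions P F \<Omega>"
    and regular: "convex_lipschitz_functions P F \<Omega> D Lf"
    and compr: "compressor K C r \<omega>"
    and batches: "b1 \<ge> 1" "b2 \<ge> 1"
    and mu_pos: "0 < \<mu>" and eps: "0 \<le> \<epsilon>" "\<epsilon> \<le> 1" and psi: "0 < \<psi>" "\<psi> \<le> 1 / r"
    and gamma_nonneg: "0 \<le> \<gamma>" and eta_nonneg: "\<And>k. 0 \<le> \<eta> k"
    and draws: "fresh_draws M K P b1 b2 \<zeta> u \<xi>"
    and run: "vr_com_dszo M N W \<Omega> F C \<eta> \<mu> \<epsilon> \<psi> \<gamma> b1 b2 x0 \<zeta> u \<xi> X Xh B Q"
    and queries: "queries_in D M \<mu> b1 u X"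
begin

lemma doubly_stochastic: "doubly_stochastic W"
  using network by (simp add: network_def)

lemma region_facts: "closed \<Omega>" "convex \<Omega>" "0 < R_out" "0 \<in> \<Omega>" "\<Omega> \<subseteq> cball 0 R_out"
  using region by (auto simp: feasible_region_def subset_iff)

lemma shrunk_facts: "closed (shrunk \<epsilon> \<Omega>)" "convex (shrunk \<epsilon> \<Omega>)" "shrunk \<epsilon> \<Omega> \<noteq> {}" "shrunk \<epsilon> \<Omega> \<subseteq> \<Omega>"
proof -
  show "closed (shrunk \<epsilon> \<Omega>)" "convex (shrunk \<epsilon> \<Omega>)" "shrunk \<epsilon> \<Omega> \<noteq> {}"
    unfolding shrunk_def using region_facts by (auto intro: closed_scaling convex_scaling)
  show "shrunk \<epsilon> \<Omega> \<subseteq> \<Omega>"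
  proof
    fix z assume "z \<in> shrunk \<epsilon> \<Omega>"
    then obtain x where "x \<in> \<Omega>" "z = (1 - \<epsilon>) *\<^sub>R x" by (auto simp: shrunk_def)
    then show "z \<in> \<Omega>"
      using convexD[OF region_facts(2), of x 0 "1 - \<epsilon>" \<epsilon>] region_facts(4) eps by simp
  qed
qed

sublocale prob_space M
  using draws by (simp add: fresh_draws_def)

abbreviation law :: "'n \<Rightarrow> ('c \<times> (nat \<Rightarrow> real^'d) \<times> (nat \<Rightarrow> 's)) measure" where
  "law i \<equiv> round_law K (P i) b1 b2"

abbreviation draw :: "nat \<Rightarrow> 'n \<Rightarrow> 'w \<Rightarrow> 'c \<times> (nat \<Rightarrow> real^'d) \<times> (nat \<Rightarrow> 's)" where
  "draw k i \<equiv> round_draw \<zeta> u \<xi> b1 b2 k i"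

text \<open>The state at the start of round \<open>k\<close> is a function of the draws indexed by \<open>past k\<close>.  This dependence is
expressed as measurability for the sigma-algebra generated by \<open>history k\<close>, which spares writing the
function down.\<close>

definition past :: "nat \<Rightarrow> (nat \<times> 'n) set" where
  "past k = {..<k} \<times> UNIV"

definition history :: "nat \<Rightarrow> 'w \<Rightarrow> nat \<times> 'n \<Rightarrow> 'c \<times> (nat \<Rightarrow> real^'d) \<times> (nat \<Rightarrow> 's)" where
  "history k w = (\<lambda>j\<in>past k. draw (fst j) (snd j) w)"

definition filtration :: "nat \<Rightarrow> 'w measure" where
  "filtration k = vimage_algebra (space M) (history k) (PiM (past k) (\<lambda>j. law (snd j)))"

lemma prob_space_samples: "prob_space (P i)"
  using samples by (simp add: random_functions_def)

lemma prob_space_compressor: "prob_space K"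
  using compr by (simp add: compressor_def)

lemma F_measurable [measurable (raw)]:
  assumes "g \<in> borel_measurable G" "s \<in> measurable G (P i)"
  shows "(\<lambda>w. F i (g w) (s w)) \<in> borel_measurable G"
proof -
  have "(\<lambda>(x, \<xi>). F i x \<xi>) \<in> borel_measurable (borel \<Otimes>\<^sub>M P i)"
    using samples by (simp add: random_functions_def)
  from measurable_compose[OF measurable_Pair[OF assms] this] show ?thesis by simp
qed

lemma C_measurable [measurable (raw)]:
  assumes "z \<in> measurable G K" "g \<in> borel_measurable G"
  shows "(\<lambda>w. C (z w) (g w)) \<in> borel_measurable G"
proof -
  have "(\<lambda>(z, x). C z x) \<in> borel_measurable (K \<Otimes>\<^sub>M borel)"
    using compr by (simp add: compressor_def)
  from measurable_compose[OF measurable_Pair[OF assms] this] show ?thesis by simp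
qed

lemma indep_draws: "indep_vars (\<lambda>j. law (snd j)) (\<lambda>j. draw (fst j) (snd j)) UNIV"
  using draws by (simp add: fresh_draws_def case_prod_beta')

lemma draw_measurable: "draw k i \<in> measurable M (law i)"
proof -
  have "\<forall>j\<in>UNIV. random_variable (law (snd j)) (draw (fst j) (snd j))"
    using indep_draws unfolding indep_vars_def by blast
  from bspec[OF this, of "(k, i)"] show ?thesis by simp
qed

lemma distr_draw: "distr M (law i) (draw k i) = law i"
  using draws by (simp add: fresh_draws_def)

lemma history_measurable: "history k \<in> measurable M (PiM (past k) (\<lambda>j. law (snd j)))"
  unfolding history_def by (intro measurable_restrict draw_measurable)

lemma history_in: "history k \<in> space M \<rightarrow> space (PiM (past k) (\<lambda>j. law (snd j)))"
  using history_measurable by (auto dest: measurable_space)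

lemma space_filtration [simp]: "space (filtration k) = space M"
  by (simp add: filtration_def)

lemma history_measurable_filtration:
  "history k \<in> measurable (filtration k) (PiM (past k) (\<lambda>j. law (snd j)))"
  unfolding filtration_def by (rule measurable_vimage_algebra1[OF history_in])

lemma sets_filtration_mono: "sets (filtration k) \<subseteq> sets (filtration (Suc k))"
proof -
  have sub: "past k \<subseteq> past (Suc k)" by (auto simp: past_def)
  have "(\<lambda>w. restrict (history (Suc k) w) (past k)) \<in> measurable (filtration (Suc k)) (PiM (past k) (\<lambda>j. law (snd j)))"
    by (rule measurable_compose[OF history_measurable_filtration measurable_restrict_subset[OF sub]])
  moreover have "(\<lambda>w. restrict (history (Suc k) w) (past k)) = history k"
    using sub by (auto simp: history_def fun_eq_iff restrict_def)
  ultimately have "history k \<in> measurable (filtration (Suc k)) (PiM (past k) (\<lambda>j. law (snd j)))" by simp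
  from sets_image_in_sets[OF _ this] show ?thesis by (simp add: filtration_def)
qed

lemma sets_filtration: "sets (filtration k) \<subseteq> sets M"
  unfolding filtration_def by (rule sets_image_in_sets[OF refl history_measurable])

lemma filtration_Suc: "f \<in> measurable (filtration k) G \<Longrightarrow> f \<in> measurable (filtration (Suc k)) G"
  using measurable_mono[of G G "filtration k" "filtration (Suc k)"] sets_filtration_mono by auto

lemma filtration_M: "f \<in> measurable (filtration k) G \<Longrightarrow> f \<in> measurable M G"
  using measurable_mono[of G G "filtration k" M] sets_filtration by auto

lemma draw_filtration: "draw k i \<in> measurable (filtration (Suc k)) (law i)"
proof -
  have j: "(k, i) \<in> past (Suc k)" by (simp add: past_def)
  have "(\<lambda>w. history (Suc k) w (k, i)) \<in> measurable (filtration (Suc k)) (law i)"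
    using measurable_compose[OF history_measurable_filtration measurable_component_singleton[OF j]] by simp
  then show ?thesis using j by (simp add: history_def)
qed

lemma draw_components:
  assumes "draw k i \<in> measurable G (law i)"
  shows "\<zeta> k i \<in> measurable G K"
    and "\<tau> \<in> {1..b1} \<Longrightarrow> u k i \<tau> \<in> borel_measurable G"
    and "\<tau> \<in> {1..b2} \<Longrightarrow> \<xi> k i \<tau> \<in> measurable G (P i)"
proof -
  have "(\<lambda>w. fst (draw k i w)) \<in> measurable G K"
    by (rule measurable_compose[OF assms]) (simp add: round_law_def)
  then show "\<zeta> k i \<in> measurable G K" by (simp add: round_draw_def)
  have "(\<lambda>w. (fst (snd (draw k i w))) \<tau>) \<in> measurable G uniform_sphere" if "\<tau> \<in> {1..b1}"
    by (rule measurable_compose[OF assms]) (use that in \<open>simp add: round_law_def\<close>)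
  then show "\<tau> \<in> {1..b1} \<Longrightarrow> u k i \<tau> \<in> borel_measurable G"
    by (simp add: round_draw_def measurable_cong_sets[OF refl sets_uniform_sphere])
  have "(\<lambda>w. (snd (snd (draw k i w))) \<tau>) \<in> measurable G (P i)" if "\<tau> \<in> {1..b2}"
    by (rule measurable_compose[OF assms]) (use that in \<open>simp add: round_law_def\<close>)
  then show "\<tau> \<in> {1..b2} \<Longrightarrow> \<xi> k i \<tau> \<in> measurable G (P i)" by (simp add: round_draw_def)
qed

abbreviation G :: "nat \<Rightarrow> 'w \<Rightarrow> real^'d^'n" where
  "G \<equiv> estimator_matrix F \<mu> b1 b2 u \<xi> X"

lemma run_0: "w \<in> space M \<Longrightarrow> X 0 w = x0" "w \<in> space M \<Longrightarrow> Xh 0 w = 0" "x0 $ i \<in> \<Omega>"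
  using run by (auto simp: vr_com_dszo_def vec_eq_iff)

lemma run_Q:
  assumes "w \<in> space M"
  shows "Q k w $ i = C (\<zeta> k i w) (X k w $ i - Xh k w $ i)"
  using run assms by (cases k) (auto simp: vr_com_dszo_def)

lemma run_Xh: "w \<in> space M \<Longrightarrow> Xh (Suc k) w $ i = Xh k w $ i + \<psi> *\<^sub>R Q k w $ i"
  using run by (auto simp: vr_com_dszo_def)

text \<open>The communication variable accumulates \<open>\<psi> (I - W) Q\<close> while \<open>Xh\<close> accumulates \<open>\<psi> Q\<close>, so it is redundant:
the pair \<open>(X, Xh)\<close> is the whole state.\<close>

lemma run_B:
  assumes w: "w \<in> space M"
  shows "B k w = Xh k w - W ** Xh k w"
proof (induction k)
  case 0
  show ?case using run w by (simp add: vr_com_dszo_def vec_eq_iff matrix_mult_row)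
next
  case (Suc k)
  have nb: "(\<Sum>j\<in>N i. W $ i $ j *\<^sub>R Q k w $ j) = (\<Sum>j\<in>UNIV. W $ i $ j *\<^sub>R Q k w $ j)" for i
    using network by (intro sum.mono_neutral_left) (auto simp: network_def)
  show ?case
  proof (subst vec_eq_iff, intro allI)
    fix i
    have "B (Suc k) w $ i = B k w $ i + \<psi> *\<^sub>R (Q k w $ i - (\<Sum>j\<in>N i. W $ i $ j *\<^sub>R Q k w $ j))"
      using run w by (auto simp: vr_com_dszo_def)
    then show "B (Suc k) w $ i = (Xh (Suc k) w - W ** Xh (Suc k) w) $ i"
      by (simp add: Suc matrix_mult_row run_Xh[OF w] nb scaleR_add_right scaleR_diff_right sum.distrib
          scaleR_sum_right mult.commute)
  qed
qed

lemma run_X: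
  assumes "w \<in> space M"
  shows "X (Suc k) w $ i = closest_point (shrunk \<epsilon> \<Omega>)
    (X k w $ i - \<gamma> *\<^sub>R (Xh (Suc k) w - W ** Xh (Suc k) w) $ i - \<eta> k *\<^sub>R G k w $ i)"
  using run run_B[OF assms, of "Suc k"] assms by (auto simp: vr_com_dszo_def)

lemma X_in: "w \<in> space M \<Longrightarrow> X k w $ i \<in> \<Omega>"
proof (cases k)
  case (Suc k')
  assume "w \<in> space M"
  then show ?thesis
    using closest_point_in_set[OF shrunk_facts(1,3)] shrunk_facts(4) Suc by (auto simp: run_X)
qed (auto simp: run_0)

lemma G_measurable:
  assumes [measurable]: "(\<lambda>w. X k w $ i) \<in> borel_measurable H" and d: "draw k i \<in> measurable H (law i)"
  shows "(\<lambda>w. G k w $ i) \<in> borel_measurable H"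
proof -
  have summand: "(\<lambda>w. (F i (X k w $ i + \<mu> *\<^sub>R u k i \<tau>1 w) (\<xi> k i \<tau>2 w) - F i (X k w $ i) (\<xi> k i \<tau>2 w)) *\<^sub>R u k i \<tau>1 w)
      \<in> borel_measurable H" if "\<tau>1 \<in> {1..b1}" "\<tau>2 \<in> {1..b2}" for \<tau>1 \<tau>2
  proof -
    note [measurable] = draw_components(2)[OF d that(1)] draw_components(3)[OF d that(2)]
    show ?thesis by measurable
  qed
  show ?thesis
    unfolding estimator_matrix_def gradient_estimator_def vec_lambda_beta
    by (intro borel_measurable_scaleR borel_measurable_const borel_measurable_sum summand)
qed

text \<open>By induction along the rounds: a step composes the state with the draws of the round through
measurable maps, the projection being continuous.\<close>

lemma state_filtration:
  "(\<lambda>w. X k w $ i) \<in> borel_measurable (filtration k) \<and> (\<lambda>w. Xh k w $ i) \<in> borel_measurable (filtration k)"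
proof (induction k arbitrary: i)
  case 0
  have "(\<lambda>w. X 0 w $ i) \<in> borel_measurable (filtration 0) \<longleftrightarrow> (\<lambda>w. x0 $ i) \<in> borel_measurable (filtration 0)"
    "(\<lambda>w. Xh 0 w $ i) \<in> borel_measurable (filtration 0) \<longleftrightarrow> (\<lambda>w. 0 $ i :: real^'d) \<in> borel_measurable (filtration 0)"
    by (rule measurable_cong, simp add: run_0)+
  then show ?case by simp
next
  case (Suc k)
  let ?H = "filtration (Suc k)"
  have X [measurable]: "(\<lambda>w. X k w $ i) \<in> borel_measurable ?H"
    and Xh [measurable]: "(\<lambda>w. Xh k w $ i) \<in> borel_measurable ?H" for i
    using Suc[of i] by (auto intro: filtration_Suc)
  note [measurable] = draw_components(1)[OF draw_filtration[of k]]
  have "(\<lambda>w. Xh (Suc k) w $ i) \<in> borel_measurable ?H \<longleftrightarrow>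
      (\<lambda>w. Xh k w $ i + \<psi> *\<^sub>R C (\<zeta> k i w) (X k w $ i - Xh k w $ i)) \<in> borel_measurable ?H" for i
    by (rule measurable_cong) (simp add: run_Xh run_Q)
  then have Xh' [measurable]: "(\<lambda>w. Xh (Suc k) w $ i) \<in> borel_measurable ?H" for i by simp
  have [measurable]: "(\<lambda>w. G k w $ i) \<in> borel_measurable ?H" for i
    by (rule G_measurable[OF X draw_filtration])
  have "(\<lambda>w. X (Suc k) w $ i) \<in> borel_measurable ?H \<longleftrightarrow>
      (\<lambda>w. closest_point (shrunk \<epsilon> \<Omega>) (X k w $ i
        - \<gamma> *\<^sub>R (Xh (Suc k) w $ i - (\<Sum>j\<in>UNIV. W $ i $ j *\<^sub>R Xh (Suc k) w $ j)) - \<eta> k *\<^sub>R G k w $ i))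
      \<in> borel_measurable ?H"
    by (rule measurable_cong) (simp add: run_X matrix_mult_row)
  also have \<dots>
    by (rule borel_measurable_closest_point[OF shrunk_facts(1-3)]) measurable
  finally show ?case using Xh' by simp
qed

lemma X_measurable: "(\<lambda>w. X k w $ i) \<in> borel_measurable M"
  and Xh_measurable: "(\<lambda>w. Xh k w $ i) \<in> borel_measurable M"
  using state_filtration filtration_M by blast+

lemma G_measurable_M: "(\<lambda>w. G k w $ i) \<in> borel_measurable M"
  by (rule G_measurable[OF X_measurable draw_measurable])

text \<open>What is determined by the past is independent of the draws of the current round, stated as a product
law so that expectations become iterated integrals by Fubini.  The notion
\<open>indep_var\<close> relates random variables with values in one type, whereas state and draw have different
types; so the product formula is taken for \<open>history k\<close> and a block consisting of the single draw, and
transported to the events that these generate.\<close>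

lemma distr_filtration_draw:
  assumes Z: "Z \<in> measurable (filtration k) S" and g: "g \<in> measurable (law i) T"
  shows "distr M (S \<Otimes>\<^sub>M T) (\<lambda>w. (Z w, g (draw k i w))) = distr M S Z \<Otimes>\<^sub>M distr (law i) T g"
proof -
  let ?L = "\<lambda>j. law (snd j)" and ?j = "(k, i)"
  let ?d = "\<lambda>w. \<lambda>j\<in>{?j}. draw (fst j) (snd j) w" and ?g = "\<lambda>w. g (draw k i w)"
  have ZM: "Z \<in> measurable M S" by (rule filtration_M[OF Z])
  have gM: "?g \<in> measurable M T" by (rule measurable_compose[OF draw_measurable g])
  have "past k \<inter> {?j} = {}" by (auto simp: past_def)
  from indep_var_restrict[OF indep_draws this]
  have iv: "indep_var (PiM (past k) ?L) (history k) (PiM {?j} ?L) ?d"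
    by (simp add: history_def[abs_def])
  have gj: "(\<lambda>f. g (f ?j)) \<in> measurable (PiM {?j} ?L) T"
    by (rule measurable_compose[OF measurable_component_singleton[of ?j "{?j}" ?L]]) (simp_all add: g)
  have dg: "distr (law i) T g = distr M T ?g"
    using distr_distr[OF g draw_measurable[of k i]] distr_draw[of i k] by (simp add: comp_def)
  interpret dZ: prob_space "distr M S Z" by (rule prob_space_distr[OF ZM])
  interpret dG: prob_space "distr M T ?g" by (rule prob_space_distr[OF gM])
  have "distr M S Z \<Otimes>\<^sub>M distr M T ?g = distr M (S \<Otimes>\<^sub>M T) (\<lambda>w. (Z w, ?g w))"
  proof (rule pair_measure_eqI)
    show "sigma_finite_measure (distr M S Z)" "sigma_finite_measure (distr M T ?g)" by unfold_locales
    show "sets (distr M S Z \<Otimes>\<^sub>M distr M T ?g) = sets (distr M (S \<Otimes>\<^sub>M T) (\<lambda>w. (Z w, ?g w)))"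
      by (simp cong: sets_pair_measure_cong)
    fix A E assume "A \<in> sets (distr M S Z)" "E \<in> sets (distr M T ?g)"
    then have A: "A \<in> sets S" and E: "E \<in> sets T" by auto
    obtain A' where A': "A' \<in> sets (PiM (past k) ?L)" "Z -` A \<inter> space M = history k -` A' \<inter> space M"
      using measurable_sets[OF Z A] sets_vimage_algebra2[OF history_in[of k]] by (auto simp: filtration_def)
    define E' where "E' = (\<lambda>f. g (f ?j)) -` E \<inter> space (PiM {?j} ?L)"
    have E': "E' \<in> sets (PiM {?j} ?L)" unfolding E'_def by (rule measurable_sets[OF gj E])
    have dsp: "?d w \<in> space (PiM {?j} ?L)" if "w \<in> space M" for w
      using measurable_space[OF draw_measurable[of k i] that] by (auto simp: space_PiM)
    have dE: "?d -` E' \<inter> space M = ?g -` E \<inter> space M"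
      using dsp by (auto simp: E'_def)
    have "prob ((\<lambda>w. (Z w, ?g w)) -` (A \<times> E) \<inter> space M) = prob ((\<lambda>w. (history k w, ?d w)) -` (A' \<times> E') \<inter> space M)"
    proof -
      have "(\<lambda>w. (Z w, ?g w)) -` (A \<times> E) \<inter> space M = (Z -` A \<inter> space M) \<inter> (?g -` E \<inter> space M)" by auto
      also have "\<dots> = (\<lambda>w. (history k w, ?d w)) -` (A' \<times> E') \<inter> space M"
        unfolding A'(2) dE[symmetric] by auto
      finally show ?thesis by simp
    qed
    also have "\<dots> = prob (history k -` A' \<inter> space M) * prob (?d -` E' \<inter> space M)"
      by (rule indep_varD[OF iv A'(1) E'])
    also have "\<dots> = prob (Z -` A \<inter> space M) * prob (?g -` E \<inter> space M)"
      unfolding A'(2) dE ..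
    finally show "emeasure (distr M S Z) A * emeasure (distr M T ?g) E
        = emeasure (distr M (S \<Otimes>\<^sub>M T) (\<lambda>w. (Z w, ?g w))) (A \<times> E)"
      using A E ZM gM
      by (simp add: emeasure_distr emeasure_eq_measure pair_measureI ennreal_mult'')
  qed
  then show ?thesis unfolding dg by simp
qed

lemma law_compressor: "distr (law i) K fst = K"
proof -
  let ?A = "PiM {1..b1} (\<lambda>_. uniform_sphere :: (real^'d) measure)" and ?B = "PiM {1..b2} (\<lambda>_. P i)"
  have "prob_space ?A" "prob_space ?B"
    by (intro prob_space_PiM prob_space_uniform_sphere prob_space_samples)+
  then have "prob_space (?A \<Otimes>\<^sub>M ?B)" by (rule prob_space_pair)
  then show ?thesis unfolding round_law_def by (rule prob_space.distr_pair_fst)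
qed

text \<open>One direction and one sample of a round have the product law whatever the batch sizes are; this
reduces the doubly batched estimator to a single pair.\<close>

lemma law_query:
  assumes \<tau>: "\<tau>1 \<in> {1..b1}" "\<tau>2 \<in> {1..b2}"
  shows "(\<lambda>z. (fst (snd z) \<tau>1, snd (snd z) \<tau>2)) \<in> measurable (law i) (uniform_sphere \<Otimes>\<^sub>M P i)"
    and "distr (law i) (uniform_sphere \<Otimes>\<^sub>M P i) (\<lambda>z. (fst (snd z) \<tau>1, snd (snd z) \<tau>2)) = uniform_sphere \<Otimes>\<^sub>M P i"
proof -
  let ?A = "PiM {1..b1} (\<lambda>_. uniform_sphere :: (real^'d) measure)" and ?B = "PiM {1..b2} (\<lambda>_. P i)"
  let ?g = "\<lambda>(v, s). (v \<tau>1, s \<tau>2)"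
  have A: "(\<lambda>v. v \<tau>1) \<in> measurable ?A uniform_sphere" and B: "(\<lambda>s. s \<tau>2) \<in> measurable ?B (P i)"
    using \<tau> by (auto intro: measurable_component_singleton)
  have cA: "distr ?A uniform_sphere (\<lambda>v. v \<tau>1) = uniform_sphere"
    by (rule distr_PiM_component[OF prob_space_uniform_sphere \<tau>(1)])
  have cB: "distr ?B (P i) (\<lambda>s. s \<tau>2) = P i"
    using distr_PiM_component[of "{1..b2}" "\<lambda>_. P i" \<tau>2] prob_space_samples \<tau>(2) by simp
  have g: "?g \<in> measurable (?A \<Otimes>\<^sub>M ?B) (uniform_sphere \<Otimes>\<^sub>M P i)"
    using A B by (auto simp: case_prod_beta' intro!: measurable_Pair measurable_compose[OF measurable_fst A] measurable_compose[OF measurable_snd B])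
  have eq: "(\<lambda>z. (fst (snd z) \<tau>1, snd (snd z) \<tau>2)) = (\<lambda>z. ?g (snd z))" by (simp add: case_prod_beta')
  have s: "snd \<in> measurable (law i) (?A \<Otimes>\<^sub>M ?B)" by (simp add: round_law_def)
  show "(\<lambda>z. (fst (snd z) \<tau>1, snd (snd z) \<tau>2)) \<in> measurable (law i) (uniform_sphere \<Otimes>\<^sub>M P i)"
    unfolding eq by (rule measurable_compose[OF s g])
  have "prob_space ?A" "prob_space ?B"
    by (intro prob_space_PiM prob_space_uniform_sphere prob_space_samples)+
  then have "prob_space (?A \<Otimes>\<^sub>M ?B)" by (rule prob_space_pair)
  then have snd: "distr (law i) (?A \<Otimes>\<^sub>M ?B) snd = ?A \<Otimes>\<^sub>M ?B"
    unfolding round_law_def by (intro distr_pair_snd prob_space_compressor prob_space_imp_sigma_finite)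
  have "distr (law i) (uniform_sphere \<Otimes>\<^sub>M P i) (\<lambda>z. ?g (snd z))
      = distr (?A \<Otimes>\<^sub>M ?B) (uniform_sphere \<Otimes>\<^sub>M P i) ?g"
    using distr_distr[OF g s] snd by (simp add: comp_def)
  also have "\<dots> = distr ?A uniform_sphere (\<lambda>v. v \<tau>1) \<Otimes>\<^sub>M distr ?B (P i) (\<lambda>s. s \<tau>2)"
    by (intro pair_measure_distr[symmetric] A B)
      (simp only: cB prob_space_imp_sigma_finite prob_space_samples)
  also have "\<dots> = uniform_sphere \<Otimes>\<^sub>M P i"
    by (simp only: cA cB)
  finally show "distr (law i) (uniform_sphere \<Otimes>\<^sub>M P i) (\<lambda>z. (fst (snd z) \<tau>1, snd (snd z) \<tau>2)) = uniform_sphere \<Otimes>\<^sub>M P i"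
    unfolding eq .
qed


section \<open>Size and mean of the gradient estimator\<close>

lemma regular_facts: "\<Omega> \<subseteq> D" "convex D" "D \<in> sets borel" "0 < Lf"
  "AE s in P i. convex_on D (\<lambda>x. F i x s) \<and> Lf-lipschitz_on D (\<lambda>x. F i x s)"
  using regular by (auto simp: convex_lipschitz_functions_def)

lemma query_measurable:
  assumes "\<tau>1 \<in> {1..b1}" "\<tau>2 \<in> {1..b2}"
  shows "(\<lambda>w. (u k i \<tau>1 w, \<xi> k i \<tau>2 w)) \<in> measurable M (uniform_sphere \<Otimes>\<^sub>M P i)"
  using measurable_compose[OF draw_measurable[of k i] law_query(1)[OF assms]] assms by (simp add: round_draw_def)

lemma distr_query:
  assumes "\<tau>1 \<in> {1..b1}" "\<tau>2 \<in> {1..b2}"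
  shows "distr M (uniform_sphere \<Otimes>\<^sub>M P i) (\<lambda>w. (u k i \<tau>1 w, \<xi> k i \<tau>2 w)) = uniform_sphere \<Otimes>\<^sub>M P i"
proof -
  have "distr M (uniform_sphere \<Otimes>\<^sub>M P i) ((\<lambda>z. (fst (snd z) \<tau>1, snd (snd z) \<tau>2)) \<circ> draw k i)
      = uniform_sphere \<Otimes>\<^sub>M P i"
    using distr_distr[OF law_query(1)[OF assms] draw_measurable[of k i]] distr_draw[of i k] law_query(2)[OF assms] by simp
  then show ?thesis using assms by (simp add: comp_def round_draw_def)
qed

lemma distr_state_query:
  assumes Z: "Z \<in> borel_measurable (filtration k)" and \<tau>: "\<tau>1 \<in> {1..b1}" "\<tau>2 \<in> {1..b2}"
  shows "distr M (borel \<Otimes>\<^sub>M (uniform_sphere \<Otimes>\<^sub>M P i)) (\<lambda>w. (Z w, (u k i \<tau>1 w, \<xi> k i \<tau>2 w)))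
    = distr M borel Z \<Otimes>\<^sub>M (uniform_sphere \<Otimes>\<^sub>M P i)"
  using distr_filtration_draw[OF Z law_query(1)[OF \<tau>], of i] law_query(2)[OF \<tau>, of i] \<tau>
  by (simp add: round_draw_def)

lemma AE_direction_norm:
  assumes "\<tau>1 \<in> {1..b1}"
  shows "AE w in M. norm (u k i \<tau>1 w) \<le> 1"
proof -
  have \<tau>2: "1 \<in> {1..b2}" using batches by simp
  interpret Pi: prob_space "P i" by (rule prob_space_samples)
  let ?U = "uniform_sphere :: (real^'d) measure"
  have "AE v in distr (?U \<Otimes>\<^sub>M P i) ?U fst. norm v \<le> 1"
    unfolding Pi.distr_pair_fst by (rule AE_uniform_sphere_norm)
  from AE_distrD[OF measurable_fst this]
  have "AE z in ?U \<Otimes>\<^sub>M P i. norm (fst z) \<le> 1" .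
  then have "AE z in distr M (uniform_sphere \<Otimes>\<^sub>M P i) (\<lambda>w. (u k i \<tau>1 w, \<xi> k i 1 w)). norm (fst z) \<le> 1"
    by (simp only: distr_query[OF assms \<tau>2])
  from AE_distrD[OF query_measurable[OF assms \<tau>2] this] show ?thesis by simp
qed

lemma AE_sample_regular:
  assumes "\<tau>2 \<in> {1..b2}"
  shows "AE w in M. convex_on D (\<lambda>x. F i x (\<xi> k i \<tau>2 w)) \<and> Lf-lipschitz_on D (\<lambda>x. F i x (\<xi> k i \<tau>2 w))"
proof -
  have \<tau>1: "1 \<in> {1..b1}" using batches by simp
  interpret Pi: prob_space "P i" by (rule prob_space_samples)
  let ?R = "\<lambda>s. convex_on D (\<lambda>x. F i x s) \<and> Lf-lipschitz_on D (\<lambda>x. F i x s)"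
  let ?U = "uniform_sphere :: (real^'d) measure"
  have d: "distr (?U \<Otimes>\<^sub>M P i) (P i) snd = P i"
    by (rule distr_pair_snd[OF prob_space_uniform_sphere]) unfold_locales
  have "AE s in distr (?U \<Otimes>\<^sub>M P i) (P i) snd. ?R s"
    unfolding d by (rule regular_facts(5))
  from AE_distrD[OF measurable_snd this]
  have "AE z in ?U \<Otimes>\<^sub>M P i. ?R (snd z)" .
  then have "AE z in distr M (uniform_sphere \<Otimes>\<^sub>M P i) (\<lambda>w. (u k i 1 w, \<xi> k i \<tau>2 w)). ?R (snd z)"
    by (simp only: distr_query[OF \<tau>1 assms])
  from AE_distrD[OF query_measurable[OF \<tau>1 assms] this] show ?thesis by simp
qed

lemma AE_increment_le:
  assumes "\<tau>1 \<in> {1..b1}" "\<tau>2 \<in> {1..b2}"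
  shows "AE w in M. \<bar>F i (X k w $ i + \<mu> *\<^sub>R u k i \<tau>1 w) (\<xi> k i \<tau>2 w) - F i (X k w $ i) (\<xi> k i \<tau>2 w)\<bar> \<le> Lf * \<mu>
      \<and> norm (u k i \<tau>1 w) \<le> 1"
proof -
  have "AE w in M. X k w $ i + \<mu> *\<^sub>R u k i \<tau>1 w \<in> D"
    using queries assms(1) by (auto simp: queries_in_def)
  with AE_direction_norm[OF assms(1), of k i] AE_sample_regular[OF assms(2), of i k] AE_space
  show ?thesis
  proof eventually_elim
    fix w assume w: "norm (u k i \<tau>1 w) \<le> 1"
      "convex_on D (\<lambda>x. F i x (\<xi> k i \<tau>2 w)) \<and> Lf-lipschitz_on D (\<lambda>x. F i x (\<xi> k i \<tau>2 w))"
      "w \<in> space M" "X k w $ i + \<mu> *\<^sub>R u k i \<tau>1 w \<in> D"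
    have "X k w $ i \<in> D" using X_in[OF w(3)] regular_facts(1) by blast
    then have "\<bar>F i (X k w $ i + \<mu> *\<^sub>R u k i \<tau>1 w) (\<xi> k i \<tau>2 w) - F i (X k w $ i) (\<xi> k i \<tau>2 w)\<bar>
        \<le> Lf * norm (\<mu> *\<^sub>R u k i \<tau>1 w)"
      using lipschitz_onD[OF conjunct2[OF w(2)] w(4), of "X k w $ i"] unfolding dist_norm by simp
    also have "\<dots> \<le> Lf * (\<mu> * 1)"
      using w(1) mu_pos regular_facts(4) by (intro mult_left_mono) auto
    finally show "\<bar>F i (X k w $ i + \<mu> *\<^sub>R u k i \<tau>1 w) (\<xi> k i \<tau>2 w) - F i (X k w $ i) (\<xi> k i \<tau>2 w)\<bar> \<le> Lf * \<mu>
      \<and> norm (u k i \<tau>1 w) \<le> 1" using w(1) by simp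
  qed
qed

lemma AE_estimator_le: "AE w in M. norm (G k w $ i) \<le> real CARD('d) * Lf"
proof -
  let ?a = "\<lambda>\<tau>1 \<tau>2 w. F i (X k w $ i + \<mu> *\<^sub>R u k i \<tau>1 w) (\<xi> k i \<tau>2 w) - F i (X k w $ i) (\<xi> k i \<tau>2 w)"
  have "AE w in M. \<forall>\<tau>1\<in>{1..b1}. \<forall>\<tau>2\<in>{1..b2}. \<bar>?a \<tau>1 \<tau>2 w\<bar> \<le> Lf * \<mu> \<and> norm (u k i \<tau>1 w) \<le> 1"
    using AE_increment_le by (intro AE_finite_allI) auto
  then show ?thesis
  proof eventually_elim
    fix w assume w: "\<forall>\<tau>1\<in>{1..b1}. \<forall>\<tau>2\<in>{1..b2}. \<bar>?a \<tau>1 \<tau>2 w\<bar> \<le> Lf * \<mu> \<and> norm (u k i \<tau>1 w) \<le> 1"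
    have "norm (\<Sum>\<tau>1 = 1..b1. \<Sum>\<tau>2 = 1..b2. ?a \<tau>1 \<tau>2 w *\<^sub>R u k i \<tau>1 w)
        \<le> (\<Sum>\<tau>1 = 1..b1. \<Sum>\<tau>2 = 1..b2. (Lf * \<mu>) * 1)"
    proof (intro order_trans[OF norm_sum] sum_mono)
      fix \<tau>1 \<tau>2 assume "\<tau>1 \<in> {1..b1}" "\<tau>2 \<in> {1..b2}"
      then show "norm (?a \<tau>1 \<tau>2 w *\<^sub>R u k i \<tau>1 w) \<le> (Lf * \<mu>) * 1"
        using w mu_pos regular_facts(4) unfolding norm_scaleR by (intro mult_mono) auto
    qed
    also have "\<dots> = real b1 * real b2 * (Lf * \<mu>)" by simp
    finally have "real CARD('d) / (real b1 * real b2 * \<mu>) * norm (\<Sum>\<tau>1 = 1..b1. \<Sum>\<tau>2 = 1..b2. ?a \<tau>1 \<tau>2 w *\<^sub>R u k i \<tau>1 w)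
        \<le> real CARD('d) / (real b1 * real b2 * \<mu>) * (real b1 * real b2 * (Lf * \<mu>))"
      using mu_pos by (intro mult_left_mono) auto
    also have "\<dots> = real CARD('d) * Lf" using mu_pos batches by simp
    finally show "norm (G k w $ i) \<le> real CARD('d) * Lf"
      using mu_pos by (simp add: estimator_matrix_def gradient_estimator_def)
  qed
qed

lemma objective_measurable [measurable (raw)]:
  assumes [measurable]: "g \<in> borel_measurable H"
  shows "(\<lambda>w. local_objective P F i (g w)) \<in> borel_measurable H"
proof -
  interpret Pi: prob_space "P i" by (rule prob_space_samples)
  show ?thesis unfolding local_objective_def by measurable
qed

lemma objective_lipschitz:
  assumes x: "x \<in> \<Omega>" and y: "y \<in> \<Omega>"
  shows "\<bar>local_objective P F i x - local_objective P F i y\<bar> \<le> Lf * norm (x - y)"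
proof -
  interpret Pi: prob_space "P i" by (rule prob_space_samples)
  have int: "integrable (P i) (F i z)" if "z \<in> \<Omega>" for z
    using samples that by (auto simp: random_functions_def)
  have "\<bar>local_objective P F i x - local_objective P F i y\<bar> = \<bar>\<integral>s. F i x s - F i y s \<partial>P i\<bar>"
    using int x y by (simp add: local_objective_def)
  also have "\<dots> \<le> (\<integral>s. \<bar>F i x s - F i y s\<bar> \<partial>P i)" by (rule integral_abs_bound)
  also have "\<dots> \<le> (\<integral>s. Lf * norm (x - y) \<partial>P i)"
  proof (rule integral_mono_AE)
    show "AE s in P i. \<bar>F i x s - F i y s\<bar> \<le> Lf * norm (x - y)"
      using regular_facts(5)[of i]
    proof eventually_elim
      fix s assume "convex_on D (\<lambda>x. F i x s) \<and> Lf-lipschitz_on D (\<lambda>x. F i x s)"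
      then show "\<bar>F i x s - F i y s\<bar> \<le> Lf * norm (x - y)"
        using lipschitz_onD[of Lf D "\<lambda>x. F i x s" x y] x y regular_facts(1) by (auto simp: dist_norm)
    qed
  qed (use int x y in auto)
  also have "\<dots> = Lf * norm (x - y)" by (simp add: Pi.prob_space)
  finally show ?thesis .
qed

lemma norm_le_R: "x \<in> \<Omega> \<Longrightarrow> norm x \<le> R_out"
  using region_facts(5) by auto

lemma dist_le_R: "x \<in> \<Omega> \<Longrightarrow> y \<in> \<Omega> \<Longrightarrow> norm (x - y) \<le> 2 * R_out"
  using norm_triangle_ineq4[of x y] norm_le_R[of x] norm_le_R[of y] by linarith

lemma integrable_objective_diff:
  assumes y: "y \<in> \<Omega>" and [measurable]: "Z \<in> borel_measurable M" and Z: "\<And>w. w \<in> space M \<Longrightarrow> Z w \<in> \<Omega>"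
  shows "integrable M (\<lambda>w. local_objective P F i y - local_objective P F i (Z w))"
proof (rule integrable_const_bound[where B = "Lf * (2 * R_out)"])
  show "AE w in M. norm (local_objective P F i y - local_objective P F i (Z w)) \<le> Lf * (2 * R_out)"
  proof (rule AE_I2)
    fix w assume w: "w \<in> space M"
    have "norm (local_objective P F i y - local_objective P F i (Z w)) \<le> Lf * norm (y - Z w)"
      using objective_lipschitz[OF y Z[OF w]] by simp
    also have "\<dots> \<le> Lf * (2 * R_out)"
      using dist_le_R[OF y Z[OF w]] regular_facts(4) by (intro mult_left_mono) auto
    finally show "norm (local_objective P F i y - local_objective P F i (Z w)) \<le> Lf * (2 * R_out)" .
  qed
qed measurable

text \<open>Given the iterate and the sample, the inequality on the sphere holds for the sampled function; averaging
over the sample gives \<open>f\<^sub>i\<close>, and averaging over the iterate is legitimate by the product law.  That almost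
every direction leads from the iterate into \<open>D\<close> is read off from the joint law of iterate and
direction.\<close>

lemma query_progress:
  fixes i k
  assumes y: "y \<in> \<Omega>" and \<tau>: "\<tau>1 \<in> {1..b1}" "\<tau>2 \<in> {1..b2}"
  defines "\<Phi> \<equiv> \<lambda>(x, v, s). real CARD('d) / \<mu> * (F i (x + \<mu> *\<^sub>R v) s - F i x s) * (v \<bullet> (y - x))"
  shows "integrable M (\<lambda>w. \<Phi> (X k w $ i, u k i \<tau>1 w, \<xi> k i \<tau>2 w))" (is ?int)
    and "(\<integral>w. \<Phi> (X k w $ i, u k i \<tau>1 w, \<xi> k i \<tau>2 w) \<partial>M)
      \<le> (\<integral>w. local_objective P F i y - local_objective P F i (X k w $ i) \<partial>M) + 2 * \<mu> * Lf" (is "?l \<le> ?r")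
proof -
  let ?U = "uniform_sphere :: (real^'d) measure"
  let ?Z = "\<lambda>w. X k w $ i"
  let ?\<nu> = "distr M borel ?Z"
  let ?J = "\<lambda>w. (?Z w, u k i \<tau>1 w, \<xi> k i \<tau>2 w)"
  interpret Pi: prob_space "P i" by (rule prob_space_samples)
  interpret U: prob_space ?U by (rule prob_space_uniform_sphere)
  interpret UP: pair_prob_space ?U "P i" ..
  interpret \<nu>: prob_space ?\<nu> by (rule prob_space_distr[OF X_measurable])
  interpret J: pair_prob_space ?\<nu> "?U \<Otimes>\<^sub>M P i" ..
  have Zf: "?Z \<in> borel_measurable (filtration k)" using state_filtration by blast
  have J_meas: "?J \<in> measurable M (borel \<Otimes>\<^sub>M (?U \<Otimes>\<^sub>M P i))"
    by (intro measurable_Pair1' measurable_Pair X_measurable query_measurable[OF \<tau>])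
  have law: "distr M (borel \<Otimes>\<^sub>M (?U \<Otimes>\<^sub>M P i)) ?J = ?\<nu> \<Otimes>\<^sub>M (?U \<Otimes>\<^sub>M P i)"
    by (rule distr_state_query[OF Zf \<tau>])
  have \<Phi>_meas [measurable]: "\<Phi> \<in> borel_measurable (borel \<Otimes>\<^sub>M (?U \<Otimes>\<^sub>M P i))"
    unfolding \<Phi>_def case_prod_beta' by measurable
  have dy: "norm (y - ?Z w) \<le> 2 * R_out" if "w \<in> space M" for w
    by (rule dist_le_R[OF y X_in[OF that]])
  show ?int
  proof (rule integrable_const_bound[where B = "real CARD('d) / \<mu> * (Lf * \<mu>) * (1 * (2 * R_out))"])
    show "(\<lambda>w. \<Phi> (?J w)) \<in> borel_measurable M" using measurable_compose[OF J_meas \<Phi>_meas] .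
    show "AE w in M. norm (\<Phi> (?J w)) \<le> real CARD('d) / \<mu> * (Lf * \<mu>) * (1 * (2 * R_out))"
      using AE_increment_le[OF \<tau>, of i k] AE_space
    proof eventually_elim
      fix w assume w: "\<bar>F i (?Z w + \<mu> *\<^sub>R u k i \<tau>1 w) (\<xi> k i \<tau>2 w) - F i (?Z w) (\<xi> k i \<tau>2 w)\<bar> \<le> Lf * \<mu> \<and> norm (u k i \<tau>1 w) \<le> 1"
        "w \<in> space M"
      have "\<bar>u k i \<tau>1 w \<bullet> (y - ?Z w)\<bar> \<le> 1 * (2 * R_out)"
        using w dy[OF w(2)] by (intro order_trans[OF Cauchy_Schwarz_ineq2] mult_mono) auto
      with w show "norm (\<Phi> (?J w)) \<le> real CARD('d) / \<mu> * (Lf * \<mu>) * (1 * (2 * R_out))"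
        using mu_pos regular_facts(4) region_facts(3) unfolding \<Phi>_def prod.case real_norm_def abs_mult
        by (intro mult_mono) auto
    qed
  qed
  then have intJ: "integrable (?\<nu> \<Otimes>\<^sub>M (?U \<Otimes>\<^sub>M P i)) \<Phi>"
    unfolding law[symmetric] by (subst integrable_distr_eq[OF J_meas]) auto
  have "?l = integral\<^sup>L (distr M (borel \<Otimes>\<^sub>M (?U \<Otimes>\<^sub>M P i)) ?J) \<Phi>"
    by (rule integral_distr[OF J_meas, symmetric]) measurable
  also have "\<dots> = (\<integral>x. (\<integral>z. \<Phi> (x, z) \<partial>(?U \<Otimes>\<^sub>M P i)) \<partial>?\<nu>)"
    unfolding law by (rule J.integral_fst'[OF intJ, symmetric])
  also have "\<dots> \<le> (\<integral>x. local_objective P F i y - local_objective P F i x + 2 * \<mu> * Lf \<partial>?\<nu>)"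
  proof (rule integral_mono_AE)
    show "integrable ?\<nu> (\<lambda>x. \<integral>z. \<Phi> (x, z) \<partial>(?U \<Otimes>\<^sub>M P i))" by (rule J.integrable_fst'[OF intJ])
    show "integrable ?\<nu> (\<lambda>x. local_objective P F i y - local_objective P F i x + 2 * \<mu> * Lf)"
      using integrable_objective_diff[OF y X_measurable X_in]
      by (subst integrable_distr_eq[OF X_measurable]) auto
    have query_in: "AE x in ?\<nu>. AE v in ?U. x + \<mu> *\<^sub>R v \<in> D"
    proof -
      have [measurable]: "D \<in> sets borel" by (rule regular_facts(3))
      have "AE w in M. fst (?J w) + \<mu> *\<^sub>R fst (snd (?J w)) \<in> D"
        using queries \<tau>(1) by (auto simp: queries_in_def)
      moreover have ms: "{z \<in> space (borel \<Otimes>\<^sub>M (?U \<Otimes>\<^sub>M P i)). fst z + \<mu> *\<^sub>R fst (snd z) \<in> D} \<in> sets (borel \<Otimes>\<^sub>M (?U \<Otimes>\<^sub>M P i))"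
        by measurable
      ultimately have "AE z in ?\<nu> \<Otimes>\<^sub>M (?U \<Otimes>\<^sub>M P i). fst z + \<mu> *\<^sub>R fst (snd z) \<in> D"
        unfolding law[symmetric] by (subst AE_distr_iff[OF J_meas ms])
      from J.AE_pair[OF this]
      have "AE x in ?\<nu>. AE z in ?U \<Otimes>\<^sub>M P i. x + \<mu> *\<^sub>R fst z \<in> D" by simp
      then show ?thesis
      proof eventually_elim
        fix x assume "AE z in ?U \<Otimes>\<^sub>M P i. x + \<mu> *\<^sub>R fst z \<in> D"
        then have "AE v in ?U. AE s in P i. x + \<mu> *\<^sub>R v \<in> D" using UP.AE_pair[of "\<lambda>z. x + \<mu> *\<^sub>R fst z \<in> D"] by simp
        then show "AE v in ?U. x + \<mu> *\<^sub>R v \<in> D" by (simp add: Pi.AE_const)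
      qed
    qed
    have "AE x in ?\<nu>. x \<in> \<Omega>"
      using region_facts(1) X_in by (subst AE_distr_iff[OF X_measurable]) auto
    with query_in J.AE_integrable_fst'[OF intJ]
    show "AE x in ?\<nu>. (\<integral>z. \<Phi> (x, z) \<partial>(?U \<Otimes>\<^sub>M P i)) \<le> local_objective P F i y - local_objective P F i x + 2 * \<mu> * Lf"
    proof eventually_elim
      fix x assume x: "AE v in ?U. x + \<mu> *\<^sub>R v \<in> D" "integrable (?U \<Otimes>\<^sub>M P i) (\<lambda>z. \<Phi> (x, z))" "x \<in> \<Omega>"
      have int': "integrable (?U \<Otimes>\<^sub>M P i) (case_prod (\<lambda>v s. \<Phi> (x, v, s)))"
        using x(2) by (simp add: case_prod_beta')
      have intF: "integrable (P i) (F i z)" if "z \<in> \<Omega>" for z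
        using samples that by (auto simp: random_functions_def)
      have "(\<integral>z. \<Phi> (x, z) \<partial>(?U \<Otimes>\<^sub>M P i)) = (\<integral>s. (\<integral>v. \<Phi> (x, v, s) \<partial>?U) \<partial>P i)"
        using UP.integral_snd[OF int'] by (simp add: case_prod_beta')
      also have "\<dots> \<le> (\<integral>s. F i y s - F i x s + 2 * \<mu> * Lf \<partial>P i)"
      proof (rule integral_mono_AE)
        show "integrable (P i) (\<lambda>s. \<integral>v. \<Phi> (x, v, s) \<partial>?U)" by (rule UP.integrable_snd[OF int'])
        show "integrable (P i) (\<lambda>s. F i y s - F i x s + 2 * \<mu> * Lf)" using intF x(3) y by auto
        show "AE s in P i. (\<integral>v. \<Phi> (x, v, s) \<partial>?U) \<le> F i y s - F i x s + 2 * \<mu> * Lf"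
          using regular_facts(5)[of i] AE_space
        proof eventually_elim
          fix s assume s: "convex_on D (\<lambda>x. F i x s) \<and> Lf-lipschitz_on D (\<lambda>x. F i x s)" "s \<in> space (P i)"
          have m: "(\<lambda>x. F i x s) \<in> borel_measurable borel"
            by (rule F_measurable) (use s(2) in auto)
          show "(\<integral>v. \<Phi> (x, v, s) \<partial>?U) \<le> F i y s - F i x s + 2 * \<mu> * Lf"
            unfolding \<Phi>_def prod.case
            by (rule sphere_estimator_le[OF conjunct1[OF s(1)] conjunct2[OF s(1)] _ _ mu_pos m x(1)])
               (use x(3) y regular_facts(1) in auto)
        qed
      qed
      also have "\<dots> = local_objective P F i y - local_objective P F i x + 2 * \<mu> * Lf"
        using intF[OF x(3)] intF[OF y] by (simp add: local_objective_def Pi.prob_space)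
      finally show "(\<integral>z. \<Phi> (x, z) \<partial>(?U \<Otimes>\<^sub>M P i)) \<le> local_objective P F i y - local_objective P F i x + 2 * \<mu> * Lf" .
    qed
  qed
  also have "\<dots> = (\<integral>w. local_objective P F i y - local_objective P F i (?Z w) + 2 * \<mu> * Lf \<partial>M)"
    by (rule integral_distr[OF X_measurable]) measurable
  also have "\<dots> = ?r"
    using integrable_objective_diff[OF y X_measurable X_in, of i k i] by (simp add: prob_space)
  finally show "?l \<le> ?r" .
qed

lemma estimator_progress:
  assumes y: "y \<in> \<Omega>"
  shows "integrable M (\<lambda>w. G k w $ i \<bullet> (y - X k w $ i))"
    and "(\<integral>w. G k w $ i \<bullet> (y - X k w $ i) \<partial>M)
      \<le> (\<integral>w. local_objective P F i y - local_objective P F i (X k w $ i) \<partial>M) + 2 * \<mu> * Lf"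
proof -
  let ?q = "\<lambda>\<tau>1 \<tau>2 w. real CARD('d) / \<mu> * (F i (X k w $ i + \<mu> *\<^sub>R u k i \<tau>1 w) (\<xi> k i \<tau>2 w) - F i (X k w $ i) (\<xi> k i \<tau>2 w)) *
      (u k i \<tau>1 w \<bullet> (y - X k w $ i))"
  let ?r = "(\<integral>w. local_objective P F i y - local_objective P F i (X k w $ i) \<partial>M) + 2 * \<mu> * Lf"
  have eq: "G k w $ i \<bullet> (y - X k w $ i) = 1 / (real b1 * real b2) * (\<Sum>\<tau>1 = 1..b1. \<Sum>\<tau>2 = 1..b2. ?q \<tau>1 \<tau>2 w)" for w
    by (simp add: estimator_matrix_def gradient_estimator_def inner_sum_left sum_distrib_left sum_divide_distrib mult_ac)
  note q = query_progress[OF y, of _ _ i k, unfolded prod.case]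
  show "integrable M (\<lambda>w. G k w $ i \<bullet> (y - X k w $ i))"
    unfolding eq by (intro integrable_mult_right Bochner_Integration.integrable_sum q(1))
  have "(\<integral>w. G k w $ i \<bullet> (y - X k w $ i) \<partial>M) = 1 / (real b1 * real b2) * (\<Sum>\<tau>1 = 1..b1. \<Sum>\<tau>2 = 1..b2. \<integral>w. ?q \<tau>1 \<tau>2 w \<partial>M)"
  proof -
    have "(\<integral>w. (\<Sum>\<tau>1 = 1..b1. \<Sum>\<tau>2 = 1..b2. ?q \<tau>1 \<tau>2 w) \<partial>M) = (\<Sum>\<tau>1 = 1..b1. \<integral>w. (\<Sum>\<tau>2 = 1..b2. ?q \<tau>1 \<tau>2 w) \<partial>M)"
      by (intro Bochner_Integration.integral_sum Bochner_Integration.integrable_sum q(1))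
    also have "\<dots> = (\<Sum>\<tau>1 = 1..b1. \<Sum>\<tau>2 = 1..b2. \<integral>w. ?q \<tau>1 \<tau>2 w \<partial>M)"
      by (intro sum.cong[OF refl] Bochner_Integration.integral_sum q(1))
    finally show ?thesis unfolding eq by (simp only: integral_mult_right_zero)
  qed
  also have "\<dots> \<le> 1 / (real b1 * real b2) * (\<Sum>\<tau>1 = 1..b1. \<Sum>\<tau>2 = 1..b2. ?r)"
    using q(2) by (intro mult_left_mono sum_mono) auto
  also have "\<dots> = ?r" using batches by simp
  finally show "(\<integral>w. G k w $ i \<bullet> (y - X k w $ i) \<partial>M) \<le> ?r" .
qed


section \<open>Integrability and size of the consensus error\<close>

text \<open>The compressor bound holds for each fixed input; independence of the compressor noise from \<open>Z\<close> makes
it available for the random input.\<close>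

lemma compression_error:
  fixes k i
  assumes Z: "Z \<in> borel_measurable (filtration k)" and int: "integrable M (\<lambda>w. (norm (Z w))\<^sup>2)"
  defines "E \<equiv> \<lambda>w. (norm ((1 / r) *\<^sub>R C (\<zeta> k i w) (Z w) - Z w))\<^sup>2"
  shows "integrable M E" and "(\<integral>w. E w \<partial>M) \<le> (\<integral>w. (norm (Z w))\<^sup>2 \<partial>M)"
proof -
  interpret K: prob_space K by (rule prob_space_compressor)
  have ZM [measurable]: "Z \<in> borel_measurable M" by (rule filtration_M[OF Z])
  have zM [measurable]: "\<zeta> k i \<in> measurable M K" by (rule draw_components(1)[OF draw_measurable])
  have fst: "fst \<in> measurable (law i) K" by (simp add: round_law_def)
  have law: "distr M (borel \<Otimes>\<^sub>M K) (\<lambda>w. (Z w, \<zeta> k i w)) = distr M borel Z \<Otimes>\<^sub>M K"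
    using distr_filtration_draw[OF Z fst] law_compressor[of i] by (simp add: round_draw_def)
  define e where "e = (\<lambda>(x, z). (norm ((1 / r) *\<^sub>R C z x - x))\<^sup>2)"
  have e [measurable]: "e \<in> borel_measurable (borel \<Otimes>\<^sub>M K)"
    unfolding e_def case_prod_beta' by measurable
  have pair [measurable]: "(\<lambda>w. (Z w, \<zeta> k i w)) \<in> measurable M (borel \<Otimes>\<^sub>M K)" by measurable
  have inner: "(\<integral>\<^sup>+z. ennreal (e (x, z)) \<partial>K) \<le> ennreal ((norm x)\<^sup>2)" for x
  proof -
    have *: "integrable K (\<lambda>z. e (x, z))" "(\<integral>z. e (x, z) \<partial>K) \<le> (1 - \<omega>) * (norm x)\<^sup>2" "0 < \<omega>"
      using compr by (auto simp: compressor_def e_def)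
    have "(\<integral>\<^sup>+z. ennreal (e (x, z)) \<partial>K) = ennreal (\<integral>z. e (x, z) \<partial>K)"
      using *(1) by (intro nn_integral_eq_integral) (auto simp: e_def)
    also have "\<dots> \<le> ennreal ((norm x)\<^sup>2)"
      using *(2,3) mult_right_mono[of "1 - \<omega>" 1 "(norm x)\<^sup>2"] by (intro ennreal_leI) simp
    finally show ?thesis .
  qed
  have "(\<integral>\<^sup>+w. ennreal (E w) \<partial>M) = (\<integral>\<^sup>+w. ennreal (e (Z w, \<zeta> k i w)) \<partial>M)"
    by (simp add: E_def e_def)
  also have "\<dots> = (\<integral>\<^sup>+p. ennreal (e p) \<partial>distr M (borel \<Otimes>\<^sub>M K) (\<lambda>w. (Z w, \<zeta> k i w)))"
    by (rule nn_integral_distr[symmetric]) measurable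
  also have "\<dots> = (\<integral>\<^sup>+x. (\<integral>\<^sup>+z. ennreal (e (x, z)) \<partial>K) \<partial>distr M borel Z)"
    unfolding law by (rule K.nn_integral_fst[symmetric]) simp
  also have "\<dots> \<le> (\<integral>\<^sup>+x. ennreal ((norm x)\<^sup>2) \<partial>distr M borel Z)"
    by (intro nn_integral_mono inner)
  also have "\<dots> = (\<integral>\<^sup>+w. ennreal ((norm (Z w))\<^sup>2) \<partial>M)"
    by (rule nn_integral_distr) measurable
  also have "\<dots> = ennreal (\<integral>w. (norm (Z w))\<^sup>2 \<partial>M)"
    by (rule nn_integral_eq_integral[OF int]) simp
  finally have le: "(\<integral>\<^sup>+w. ennreal (E w) \<partial>M) \<le> ennreal (\<integral>w. (norm (Z w))\<^sup>2 \<partial>M)" .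
  have E_meas: "E \<in> borel_measurable M" unfolding E_def by measurable
  show iE: "integrable M E"
  proof (rule integrableI_bounded[OF E_meas])
    have "(\<integral>\<^sup>+w. ennreal (norm (E w)) \<partial>M) = (\<integral>\<^sup>+w. ennreal (E w) \<partial>M)" by (simp add: E_def)
    also have "\<dots> < \<infinity>" using le by (auto intro: le_less_trans)
    finally show "(\<integral>\<^sup>+w. ennreal (norm (E w)) \<partial>M) < \<infinity>" .
  qed
  have "(\<integral>\<^sup>+w. ennreal (E w) \<partial>M) = ennreal (\<integral>w. E w \<partial>M)"
    by (rule nn_integral_eq_integral[OF iE]) (simp add: E_def)
  with le show "(\<integral>w. E w \<partial>M) \<le> (\<integral>w. (norm (Z w))\<^sup>2 \<partial>M)"
    by (simp add: ennreal_le_iff integral_nonneg_AE)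
qed

lemma r_pos: "0 < r"
  using compr by (simp add: compressor_def)

lemma psi_r: "0 < \<psi> * r" "\<psi> * r \<le> 1"
  using psi r_pos by (simp_all add: field_simps)

text \<open>Up to the compression error \<open>e\<close>, the message equals \<open>r\<close> times the gap \<open>Z\<close>, so that
\<open>Xh\<^sub>k\<^sub>+\<^sub>1 - X\<^sub>k = \<psi> r e - (1 - \<psi> r) Z\<close> with both coefficients of absolute value at most 1.\<close>

lemma lag_le:
  fixes k i
  assumes w: "w \<in> space M"
  defines "Z \<equiv> X k w $ i - Xh k w $ i"
  shows "(norm ((Xh (Suc k) w - X k w) $ i))\<^sup>2
    \<le> 2 * (norm ((1 / r) *\<^sub>R C (\<zeta> k i w) Z - Z))\<^sup>2 + 2 * (norm Z)\<^sup>2"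
proof -
  let ?e = "(1 / r) *\<^sub>R C (\<zeta> k i w) Z - Z"
  have "(Xh (Suc k) w - X k w) $ i = (\<psi> * r) *\<^sub>R ?e + (\<psi> * r - 1) *\<^sub>R Z"
    using r_pos by (simp add: run_Xh[OF w] run_Q[OF w] Z_def algebra_simps)
  then have "(norm ((Xh (Suc k) w - X k w) $ i))\<^sup>2 \<le> 2 * (norm ((\<psi> * r) *\<^sub>R ?e))\<^sup>2 + 2 * (norm ((\<psi> * r - 1) *\<^sub>R Z))\<^sup>2"
    using norm_add_sq_le by metis
  also have "\<dots> \<le> 2 * (norm ?e)\<^sup>2 + 2 * (norm Z)\<^sup>2"
    using psi_r by (intro add_mono mult_left_mono power_mono) (auto intro!: mult_left_le_one_le)
  finally show ?thesis .
qed

text \<open>Both facts are needed in one induction: the compressed message of a round is square integrable if the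
gap it compresses is, and the next gap differs from the lag by a bounded move of \<open>X\<close>.\<close>

lemma state_gap_integrable: "integrable M (\<lambda>w. (norm (X k w $ i - Xh k w $ i))\<^sup>2)"
  and lag_integrable: "integrable M (\<lambda>w. (norm ((Xh (Suc k) w - X k w) $ i))\<^sup>2)"
proof -
  have [measurable]: "(\<lambda>w. X k w $ i) \<in> borel_measurable M" "(\<lambda>w. Xh k w $ i) \<in> borel_measurable M" for k i
    by (rule X_measurable Xh_measurable)+
  have lag: "integrable M (\<lambda>w. (norm ((Xh (Suc k) w - X k w) $ i))\<^sup>2)"
    if int: "integrable M (\<lambda>w. (norm (X k w $ i - Xh k w $ i))\<^sup>2)" for k
  proof (rule Bochner_Integration.integrable_bound)
    have Z: "(\<lambda>w. X k w $ i - Xh k w $ i) \<in> borel_measurable (filtration k)"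
      using state_filtration by (intro borel_measurable_diff) auto
    show "integrable M (\<lambda>w. 2 * (norm ((1 / r) *\<^sub>R C (\<zeta> k i w) (X k w $ i - Xh k w $ i) - (X k w $ i - Xh k w $ i)))\<^sup>2
        + 2 * (norm (X k w $ i - Xh k w $ i))\<^sup>2)"
      by (intro Bochner_Integration.integrable_add integrable_mult_right compression_error(1)[OF Z int] int)
    show "(\<lambda>w. (norm ((Xh (Suc k) w - X k w) $ i))\<^sup>2) \<in> borel_measurable M"
      unfolding vector_minus_component by measurable
    show "AE w in M. norm ((norm ((Xh (Suc k) w - X k w) $ i))\<^sup>2)
        \<le> norm (2 * (norm ((1 / r) *\<^sub>R C (\<zeta> k i w) (X k w $ i - Xh k w $ i) - (X k w $ i - Xh k w $ i)))\<^sup>2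
        + 2 * (norm (X k w $ i - Xh k w $ i))\<^sup>2)"
      using lag_le by (intro AE_I2) (simp add: abs_of_nonneg)
  qed
  have gap: "integrable M (\<lambda>w. (norm (X k w $ i - Xh k w $ i))\<^sup>2)" for k
  proof (induction k)
    case 0
    show ?case
      by (rule integrable_const_bound[where B = "(norm (x0 $ i))\<^sup>2"]) (auto simp: run_0)
  next
    case (Suc k)
    show ?case
    proof (rule Bochner_Integration.integrable_bound)
      show "integrable M (\<lambda>w. 2 * (2 * R_out)\<^sup>2 + 2 * (norm ((Xh (Suc k) w - X k w) $ i))\<^sup>2)"
        by (intro Bochner_Integration.integrable_add integrable_mult_right lag[OF Suc] integrable_const)
      show "AE w in M. norm ((norm (X (Suc k) w $ i - Xh (Suc k) w $ i))\<^sup>2)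
          \<le> norm (2 * (2 * R_out)\<^sup>2 + 2 * (norm ((Xh (Suc k) w - X k w) $ i))\<^sup>2)"
      proof (rule AE_I2)
        fix w assume w: "w \<in> space M"
        have eq: "X (Suc k) w $ i - Xh (Suc k) w $ i = (X (Suc k) w $ i - X k w $ i) + - ((Xh (Suc k) w - X k w) $ i)" by simp
        have "(norm (X (Suc k) w $ i - Xh (Suc k) w $ i))\<^sup>2
            \<le> 2 * (norm (X (Suc k) w $ i - X k w $ i))\<^sup>2 + 2 * (norm ((Xh (Suc k) w - X k w) $ i))\<^sup>2"
          unfolding eq using norm_add_sq_le[of "X (Suc k) w $ i - X k w $ i" "- ((Xh (Suc k) w - X k w) $ i)"]
          by (simp only: norm_minus_cancel)
        also have "(norm (X (Suc k) w $ i - X k w $ i))\<^sup>2 \<le> (2 * R_out)\<^sup>2"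
          by (intro power_mono dist_le_R X_in w) simp
        finally show "norm ((norm (X (Suc k) w $ i - Xh (Suc k) w $ i))\<^sup>2)
          \<le> norm (2 * (2 * R_out)\<^sup>2 + 2 * (norm ((Xh (Suc k) w - X k w) $ i))\<^sup>2)" by simp
      qed
    qed measurable
  qed
  show "integrable M (\<lambda>w. (norm (X k w $ i - Xh k w $ i))\<^sup>2)" by (rule gap)
  show "integrable M (\<lambda>w. (norm ((Xh (Suc k) w - X k w) $ i))\<^sup>2)" by (rule lag[OF gap])
qed

lemma average_in: "w \<in> space M \<Longrightarrow> row_average (X k w) \<in> \<Omega>"
proof -
  assume w: "w \<in> space M"
  have "row_average (X k w) = (\<Sum>i\<in>UNIV. (1 / real CARD('n)) *\<^sub>R X k w $ i)"
    by (simp add: row_average_def scaleR_sum_right)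
  also have "\<dots> \<in> \<Omega>"
    by (rule convex_sum) (use region_facts X_in[OF w] in auto)
  finally show ?thesis .
qed

lemma average_measurable: "(\<lambda>w. row_average (X k w)) \<in> borel_measurable M"
proof -
  have [measurable]: "(\<lambda>w. X k w $ i) \<in> borel_measurable M" for i by (rule X_measurable)
  show ?thesis unfolding row_average_def by measurable
qed

lemma disagreement_rows:
  "(norm (X k w - avg_matrix ** X k w))\<^sup>2 = (\<Sum>i\<in>UNIV. (norm (X k w $ i - row_average (X k w)))\<^sup>2)"
  by (simp add: norm_sq_rows avg_matrix_row)

lemma bounded_row_integrable:
  assumes [measurable]: "Z \<in> borel_measurable M" and "\<And>w. w \<in> space M \<Longrightarrow> Z w \<in> \<Omega>"
  shows "integrable M (\<lambda>w. (norm (X k w $ i - Z w))\<^sup>2)"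
proof (rule integrable_const_bound[where B = "(2 * R_out)\<^sup>2"])
  have [measurable]: "(\<lambda>w. X k w $ i) \<in> borel_measurable M" by (rule X_measurable)
  show "(\<lambda>w. (norm (X k w $ i - Z w))\<^sup>2) \<in> borel_measurable M" by measurable
  show "AE w in M. norm ((norm (X k w $ i - Z w))\<^sup>2) \<le> (2 * R_out)\<^sup>2"
  proof (rule AE_I2)
    fix w assume w: "w \<in> space M"
    have "(norm (X k w $ i - Z w))\<^sup>2 \<le> (2 * R_out)\<^sup>2"
      by (intro power_mono dist_le_R X_in assms(2) w) simp
    then show "norm ((norm (X k w $ i - Z w))\<^sup>2) \<le> (2 * R_out)\<^sup>2" by simp
  qed
qed

lemma disagreement_integrable: "integrable M (\<lambda>w. (norm (X k w - avg_matrix ** X k w))\<^sup>2)"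
  unfolding disagreement_rows
  by (intro Bochner_Integration.integrable_sum bounded_row_integrable average_measurable average_in)

lemma lag_norm_integrable: "integrable M (\<lambda>w. (norm (Xh (Suc k) w - X k w))\<^sup>2)"
  unfolding norm_sq_rows by (intro Bochner_Integration.integrable_sum lag_integrable)

abbreviation err :: "nat \<Rightarrow> real" where
  "err \<equiv> consensus_error M X Xh"

lemma err_nonneg: "0 \<le> err k"
  by (simp add: consensus_error_def integral_nonneg_AE)

text \<open>The starting error depends on the initial points only through the size of \<open>\<Omega>\<close>, so the bound is the same
for all horizons.\<close>

lemma err_0_le: "err 0 \<le> 8 * real CARD('n) * R_out\<^sup>2"
proof -
  have "err 0 = (\<integral>w. (norm (X 0 w - avg_matrix ** X 0 w))\<^sup>2 \<partial>M) + (\<integral>w. (norm (Xh 1 w - X 0 w))\<^sup>2 \<partial>M)"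
    unfolding consensus_error_def using disagreement_integrable lag_norm_integrable[of 0] by simp
  also have "(\<integral>w. (norm (X 0 w - avg_matrix ** X 0 w))\<^sup>2 \<partial>M) \<le> real CARD('n) * (2 * R_out)\<^sup>2"
  proof (rule integral_le_const[OF disagreement_integrable])
    show "AE w in M. (norm (X 0 w - avg_matrix ** X 0 w))\<^sup>2 \<le> real CARD('n) * (2 * R_out)\<^sup>2"
    proof (rule AE_I2)
      fix w assume w: "w \<in> space M"
      have "(norm (X 0 w - avg_matrix ** X 0 w))\<^sup>2 \<le> (\<Sum>i\<in>(UNIV :: 'n set). (2 * R_out)\<^sup>2)"
        unfolding disagreement_rows by (intro sum_mono power_mono dist_le_R X_in average_in w) simp
      then show "(norm (X 0 w - avg_matrix ** X 0 w))\<^sup>2 \<le> real CARD('n) * (2 * R_out)\<^sup>2" by simp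
    qed
  qed
  also have "(\<integral>w. (norm (Xh 1 w - X 0 w))\<^sup>2 \<partial>M) \<le> real CARD('n) * (4 * R_out\<^sup>2)"
  proof -
    have row: "(\<integral>w. (norm ((Xh 1 w - X 0 w) $ i))\<^sup>2 \<partial>M) \<le> 4 * R_out\<^sup>2" for i
    proof -
      let ?Z = "\<lambda>w. X 0 w $ i - Xh 0 w $ i"
      let ?E = "\<lambda>w. (norm ((1 / r) *\<^sub>R C (\<zeta> 0 i w) (?Z w) - ?Z w))\<^sup>2"
      have Z: "?Z \<in> borel_measurable (filtration 0)"
        using state_filtration by (intro borel_measurable_diff) auto
      note ce = compression_error[OF Z state_gap_integrable[of 0 i], of i]
      have "(\<integral>w. (norm ((Xh 1 w - X 0 w) $ i))\<^sup>2 \<partial>M) \<le> (\<integral>w. 2 * ?E w + 2 * (norm (?Z w))\<^sup>2 \<partial>M)"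
        using lag_integrable[of 0 i] ce(1) state_gap_integrable[of 0 i] lag_le[of _ 0 i]
        by (intro integral_mono) auto
      also have "\<dots> = 2 * (\<integral>w. ?E w \<partial>M) + 2 * (\<integral>w. (norm (?Z w))\<^sup>2 \<partial>M)"
        using ce(1) state_gap_integrable[of 0 i] by simp
      also have "\<dots> \<le> 4 * (\<integral>w. (norm (?Z w))\<^sup>2 \<partial>M)" using ce(2) by simp
      also have "(\<integral>w. (norm (?Z w))\<^sup>2 \<partial>M) \<le> R_out\<^sup>2"
        using norm_le_R[OF run_0(3)[of i]]
        by (intro integral_le_const[OF state_gap_integrable] AE_I2 power_mono) (simp_all add: run_0)
      finally show ?thesis by simp
    qed
    have "(\<integral>w. (norm (Xh 1 w - X 0 w))\<^sup>2 \<partial>M) = (\<Sum>i\<in>UNIV. \<integral>w. (norm ((Xh 1 w - X 0 w) $ i))\<^sup>2 \<partial>M)"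
      unfolding norm_sq_rows using lag_integrable[of 0] by (intro Bochner_Integration.integral_sum) simp
    also have "\<dots> \<le> (\<Sum>i\<in>(UNIV :: 'n set). 4 * R_out\<^sup>2)" by (intro sum_mono row)
    finally show ?thesis by simp
  qed
  finally show ?thesis by (simp add: power_mult_distrib)
qed

lemma AE_G_le: "AE w in M. (norm (G k w))\<^sup>2 \<le> real CARD('n) * (real CARD('d) * Lf)\<^sup>2"
proof -
  have "AE w in M. \<forall>i\<in>(UNIV :: 'n set). norm (G k w $ i) \<le> real CARD('d) * Lf"
    by (intro AE_finite_allI AE_estimator_le) simp
  then show ?thesis
  proof eventually_elim
    fix w assume "\<forall>i\<in>(UNIV :: 'n set). norm (G k w $ i) \<le> real CARD('d) * Lf"
    then have "(norm (G k w))\<^sup>2 \<le> (\<Sum>i\<in>(UNIV :: 'n set). (real CARD('d) * Lf)\<^sup>2)"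
      unfolding norm_sq_rows by (intro sum_mono power_mono) auto
    then show "(norm (G k w))\<^sup>2 \<le> real CARD('n) * (real CARD('d) * Lf)\<^sup>2" by simp
  qed
qed

lemma G_sq_integrable: "integrable M (\<lambda>w. (norm (G k w))\<^sup>2)"
proof (rule integrable_const_bound)
  have [measurable]: "(\<lambda>w. G k w $ i) \<in> borel_measurable M" for i by (rule G_measurable_M)
  show "(\<lambda>w. (norm (G k w))\<^sup>2) \<in> borel_measurable M" unfolding norm_sq_rows by measurable
  show "AE w in M. norm ((norm (G k w))\<^sup>2) \<le> real CARD('n) * (real CARD('d) * Lf)\<^sup>2"
    using AE_G_le[of k] by simp
qed

lemma G_sq_le: "(\<integral>w. (norm (G k w))\<^sup>2 \<partial>M) \<le> real CARD('n) * (real CARD('d) * Lf)\<^sup>2"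
  by (rule integral_le_const[OF G_sq_integrable AE_G_le])

section \<open>Regret\<close>

definition spread :: "real^'d \<Rightarrow> nat \<Rightarrow> real" where
  "spread y k = (\<integral>w. (\<Sum>i\<in>UNIV. (norm (X k w $ i - y))\<^sup>2) \<partial>M)"

lemma spread_integrable: "y \<in> \<Omega> \<Longrightarrow> integrable M (\<lambda>w. \<Sum>i\<in>UNIV. (norm (X k w $ i - y))\<^sup>2)"
  by (intro Bochner_Integration.integrable_sum bounded_row_integrable) auto

lemma spread_bounds:
  assumes y: "y \<in> \<Omega>"
  shows "0 \<le> spread y k" "spread y k \<le> 4 * real CARD('n) * R_out\<^sup>2"
proof -
  show "0 \<le> spread y k" unfolding spread_def by (intro integral_nonneg_AE AE_I2 sum_nonneg) simp
  have "AE w in M. (\<Sum>i\<in>UNIV. (norm (X k w $ i - y))\<^sup>2) \<le> (\<Sum>i\<in>(UNIV :: 'n set). (2 * R_out)\<^sup>2)"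
    by (intro AE_I2 sum_mono power_mono dist_le_R X_in y) simp_all
  from integral_le_const[OF spread_integrable[OF y] this]
  show "spread y k \<le> 4 * real CARD('n) * R_out\<^sup>2" by (simp add: spread_def power_mult_distrib)
qed

text \<open>The first-order inequality compares each \<open>f\<^sub>i\<close> at the iterate of its own agent with the shrunk optimum;
Lipschitz continuity moves it to the average iterate and to the optimum itself.\<close>

lemma row_gap_le:
  assumes xs: "xs \<in> \<Omega>" and w: "w \<in> space M"
  shows "(\<Sum>i\<in>UNIV. local_objective P F i ((1 - \<epsilon>) *\<^sub>R xs) - local_objective P F i (X k w $ i))
    \<le> real CARD('n) * (objective P F xs - objective P F (row_average (X k w)) + Lf * \<epsilon> * R_out)
      + Lf * (\<Sum>i\<in>UNIV. norm (X k w $ i - row_average (X k w)))"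
proof -
  let ?y = "(1 - \<epsilon>) *\<^sub>R xs" and ?a = "row_average (X k w)" and ?f = "local_objective P F"
  have y: "?y \<in> \<Omega>" using shrunk_facts(4) xs by (auto simp: shrunk_def)
  have 1: "?f i ?y - ?f i (X k w $ i) \<le> (?f i xs - ?f i ?a + Lf * \<epsilon> * R_out) + Lf * norm (X k w $ i - ?a)" for i
  proof -
    have "?y - xs = (- \<epsilon>) *\<^sub>R xs" by (simp add: algebra_simps)
    then have "norm (?y - xs) \<le> \<epsilon> * R_out"
      using eps norm_le_R[OF xs] by (simp add: mult_left_mono)
    then have "Lf * norm (?y - xs) \<le> Lf * (\<epsilon> * R_out)" using regular_facts(4) by (simp add: mult_left_mono)
    then show ?thesis
      using objective_lipschitz[OF y xs, of i] objective_lipschitz[OF X_in[OF w] average_in[OF w], of i k i k]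
      by (simp add: mult.assoc)
  qed
  have "(\<Sum>i\<in>UNIV. ?f i ?y - ?f i (X k w $ i))
      \<le> (\<Sum>i\<in>UNIV. (?f i xs - ?f i ?a + Lf * \<epsilon> * R_out) + Lf * norm (X k w $ i - ?a))"
    by (rule sum_mono) (rule 1)
  also have "\<dots> = real CARD('n) * (objective P F xs - objective P F ?a + Lf * \<epsilon> * R_out) + Lf * (\<Sum>i\<in>UNIV. norm (X k w $ i - ?a))"
  proof -
    have "(\<Sum>i\<in>UNIV. ?f i z) = real CARD('n) * objective P F z" for z by (simp add: objective_def)
    then show ?thesis
      by (simp only: sum.distrib sum_subtractf sum_distrib_left[symmetric] sum_constant)
         (simp add: algebra_simps)
  qed
  finally show ?thesis .
qed

lemma gap_integrable:
  assumes "xs \<in> \<Omega>"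
  shows "integrable M (\<lambda>w. objective P F (row_average (X k w)) - objective P F xs)"
proof -
  have "integrable M (\<lambda>w. - ((\<Sum>i\<in>UNIV. local_objective P F i xs - local_objective P F i (row_average (X k w))) / real CARD('n)))"
    by (intro Bochner_Integration.integrable_minus integrable_divide Bochner_Integration.integrable_sum
        integrable_objective_diff assms average_measurable average_in)
  then show ?thesis by (simp add: objective_def sum_subtractf diff_divide_distrib)
qed

text \<open>The expectation of the projected step.  The linear disagreement term left by \<open>row_gap_le\<close> is split by
\<open>2 a b \<le> a\<^sup>2 + b\<^sup>2\<close> into \<open>\<eta>\<^sub>k\<^sup>2\<close> and the squared disagreement, which joins the consensus error.\<close>

lemma one_round_progress:
  assumes xs: "xs \<in> \<Omega>" and \<Lambda>: "\<Lambda> \<ge> 0" "\<And>Z :: real^'d^'n. norm (Z - W ** Z) \<le> \<Lambda> * norm Z"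
  defines "y \<equiv> (1 - \<epsilon>) *\<^sub>R xs"
  shows "2 * real CARD('n) * \<eta> k * (\<integral>w. objective P F (row_average (X k w)) - objective P F xs \<partial>M)
    \<le> spread y k - spread y (Suc k) + (4 * \<gamma> * \<Lambda> + 4 * (\<gamma> * \<Lambda>)\<^sup>2 + 1) * err k
      + real CARD('n) * (Lf\<^sup>2 + 2 * (real CARD('d) * Lf)\<^sup>2) * (\<eta> k)\<^sup>2
      + 2 * real CARD('n) * Lf * (\<epsilon> * R_out + 2 * \<mu>) * \<eta> k"
proof -
  let ?n = "real CARD('n)" and ?c = "4 * \<gamma> * \<Lambda> + 4 * (\<gamma> * \<Lambda>)\<^sup>2"
  let ?S = "\<lambda>k w. \<Sum>i\<in>UNIV. (norm (X k w $ i - y))\<^sup>2"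
  let ?p = "\<lambda>w. \<Sum>i\<in>UNIV. G k w $ i \<bullet> (y - X k w $ i)"
  let ?e = "\<lambda>w. (norm (X k w - avg_matrix ** X k w))\<^sup>2 + (norm (Xh (Suc k) w - X k w))\<^sup>2"
  let ?f = "local_objective P F" and ?g = "\<lambda>w. objective P F (row_average (X k w)) - objective P F xs"
  have yS: "y \<in> shrunk \<epsilon> \<Omega>" using xs by (auto simp: shrunk_def y_def)
  then have y: "y \<in> \<Omega>" using shrunk_facts(4) by blast
  have ie: "integrable M ?e" by (intro Bochner_Integration.integrable_add disagreement_integrable lag_norm_integrable)
  have ip: "integrable M ?p" by (intro Bochner_Integration.integrable_sum estimator_progress(1) y)
  note iS = spread_integrable[OF y]
  note int = iS ie ip G_sq_integrable
  have "spread y (Suc k) \<le> (\<integral>w. ?S k w + 2 * \<eta> k * ?p w + ?c * ?e w + 2 * (\<eta> k)\<^sup>2 * (norm (G k w))\<^sup>2 \<partial>M)"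
    unfolding spread_def
  proof (rule integral_mono)
    show "integrable M (\<lambda>w. ?S k w + 2 * \<eta> k * ?p w + ?c * ?e w + 2 * (\<eta> k)\<^sup>2 * (norm (G k w))\<^sup>2)"
      by (intro Bochner_Integration.integrable_add integrable_mult_right int)
    fix w assume w: "w \<in> space M"
    show "?S (Suc k) w \<le> ?S k w + 2 * \<eta> k * ?p w + ?c * ?e w + 2 * (\<eta> k)\<^sup>2 * (norm (G k w))\<^sup>2"
      by (rule projected_step_le[OF doubly_stochastic \<Lambda> shrunk_facts(1,2) yS gamma_nonneg run_X[OF w]])
  qed (rule iS)
  also have "\<dots> = spread y k + 2 * \<eta> k * (\<integral>w. ?p w \<partial>M) + ?c * err k + 2 * (\<eta> k)\<^sup>2 * (\<integral>w. (norm (G k w))\<^sup>2 \<partial>M)"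
    unfolding spread_def consensus_error_def
    by (simp only: Bochner_Integration.integral_add integral_mult_right_zero Bochner_Integration.integrable_add integrable_mult_right int)
  finally have 1: "spread y (Suc k) \<le> spread y k + 2 * \<eta> k * (\<integral>w. ?p w \<partial>M) + ?c * err k
      + 2 * (\<eta> k)\<^sup>2 * (\<integral>w. (norm (G k w))\<^sup>2 \<partial>M)" .
  have io: "integrable M (\<lambda>w. ?f i y - ?f i (X k w $ i))" for i
    by (rule integrable_objective_diff[OF y X_measurable X_in])
  have "(\<integral>w. ?p w \<partial>M) = (\<Sum>i\<in>UNIV. \<integral>w. G k w $ i \<bullet> (y - X k w $ i) \<partial>M)"
    by (intro Bochner_Integration.integral_sum estimator_progress(1) y)
  also have "\<dots> \<le> (\<Sum>i\<in>UNIV. (\<integral>w. ?f i y - ?f i (X k w $ i) \<partial>M) + 2 * \<mu> * Lf)"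
    by (intro sum_mono estimator_progress(2) y)
  also have "\<dots> = (\<integral>w. (\<Sum>i\<in>UNIV. ?f i y - ?f i (X k w $ i)) \<partial>M) + ?n * (2 * \<mu> * Lf)"
    by (simp only: sum.distrib sum_constant Bochner_Integration.integral_sum io)
  finally have 2: "2 * \<eta> k * (\<integral>w. ?p w \<partial>M)
      \<le> 2 * \<eta> k * ((\<integral>w. (\<Sum>i\<in>UNIV. ?f i y - ?f i (X k w $ i)) \<partial>M) + ?n * (2 * \<mu> * Lf))"
    using eta_nonneg[of k] by (intro mult_left_mono) auto
  have ig: "integrable M ?g" by (rule gap_integrable[OF xs])
  have "(\<integral>w. 2 * \<eta> k * (\<Sum>i\<in>UNIV. ?f i y - ?f i (X k w $ i)) \<partial>M)
      \<le> (\<integral>w. (2 * \<eta> k * ?n * (Lf * \<epsilon> * R_out) + ?n * (\<eta> k * Lf)\<^sup>2) - 2 * \<eta> k * ?n * ?g w + ?e w \<partial>M)"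
  proof (rule integral_mono)
    show "integrable M (\<lambda>w. 2 * \<eta> k * (\<Sum>i\<in>UNIV. ?f i y - ?f i (X k w $ i)))"
      by (intro integrable_mult_right Bochner_Integration.integrable_sum io)
    show "integrable M (\<lambda>w. (2 * \<eta> k * ?n * (Lf * \<epsilon> * R_out) + ?n * (\<eta> k * Lf)\<^sup>2) - 2 * \<eta> k * ?n * ?g w + ?e w)"
      by (intro Bochner_Integration.integrable_add Bochner_Integration.integrable_diff integrable_const integrable_mult_right ig
          disagreement_integrable lag_norm_integrable)
    fix w assume w: "w \<in> space M"
    let ?Y = "\<lambda>i. norm (X k w $ i - row_average (X k w))"
    have amgm: "2 * \<eta> k * (Lf * ?Y i) \<le> (\<eta> k * Lf)\<^sup>2 + (?Y i)\<^sup>2" for i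
      using sum_squares_bound[of "\<eta> k * Lf" "?Y i"] by (simp add: mult_ac)
    have "2 * \<eta> k * (Lf * (\<Sum>i\<in>UNIV. ?Y i)) = (\<Sum>i\<in>UNIV. 2 * \<eta> k * (Lf * ?Y i))"
      by (simp add: sum_distrib_left)
    also have "\<dots> \<le> (\<Sum>i\<in>UNIV. (\<eta> k * Lf)\<^sup>2 + (?Y i)\<^sup>2)" by (intro sum_mono amgm)
    also have "\<dots> = ?n * (\<eta> k * Lf)\<^sup>2 + (norm (X k w - avg_matrix ** X k w))\<^sup>2"
      by (simp add: disagreement_rows sum.distrib)
    also have "\<dots> \<le> ?n * (\<eta> k * Lf)\<^sup>2 + ?e w" by simp
    finally have a: "2 * \<eta> k * (Lf * (\<Sum>i\<in>UNIV. ?Y i)) \<le> ?n * (\<eta> k * Lf)\<^sup>2 + ?e w" .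
    have "2 * \<eta> k * (\<Sum>i\<in>UNIV. ?f i y - ?f i (X k w $ i))
        \<le> 2 * \<eta> k * (?n * (- ?g w + Lf * \<epsilon> * R_out) + Lf * (\<Sum>i\<in>UNIV. ?Y i))"
      using row_gap_le[OF xs w, of k] eta_nonneg[of k] unfolding y_def by (intro mult_left_mono) auto
    also have "\<dots> = 2 * \<eta> k * ?n * (Lf * \<epsilon> * R_out) - 2 * \<eta> k * ?n * ?g w + 2 * \<eta> k * (Lf * (\<Sum>i\<in>UNIV. ?Y i))"
      by (simp add: algebra_simps)
    finally show "2 * \<eta> k * (\<Sum>i\<in>UNIV. ?f i y - ?f i (X k w $ i))
        \<le> (2 * \<eta> k * ?n * (Lf * \<epsilon> * R_out) + ?n * (\<eta> k * Lf)\<^sup>2) - 2 * \<eta> k * ?n * ?g w + ?e w"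
      using a by linarith
  qed
  also have "\<dots> = (2 * \<eta> k * ?n * (Lf * \<epsilon> * R_out) + ?n * (\<eta> k * Lf)\<^sup>2) - 2 * \<eta> k * ?n * (\<integral>w. ?g w \<partial>M) + err k"
    unfolding consensus_error_def
    using Bochner_Integration.integral_add[of M "\<lambda>w. (2 * \<eta> k * ?n * (Lf * \<epsilon> * R_out) + ?n * (\<eta> k * Lf)\<^sup>2) - 2 * \<eta> k * ?n * ?g w" ?e]
      Bochner_Integration.integral_diff[of M "\<lambda>_. 2 * \<eta> k * ?n * (Lf * \<epsilon> * R_out) + ?n * (\<eta> k * Lf)\<^sup>2" "\<lambda>w. 2 * \<eta> k * ?n * ?g w"]
      ie ig by (simp only: Bochner_Integration.integrable_diff integrable_const integrable_mult_right integral_mult_right_zero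
          lebesgue_integral_const prob_space scaleR_one)
  finally have 3: "2 * \<eta> k * (\<integral>w. (\<Sum>i\<in>UNIV. ?f i y - ?f i (X k w $ i)) \<partial>M)
      \<le> (2 * \<eta> k * ?n * (Lf * \<epsilon> * R_out) + ?n * (\<eta> k * Lf)\<^sup>2) - 2 * \<eta> k * ?n * (\<integral>w. ?g w \<partial>M) + err k"
    by (simp only: integral_mult_right_zero)
  have 4: "2 * (\<eta> k)\<^sup>2 * (\<integral>w. (norm (G k w))\<^sup>2 \<partial>M) \<le> 2 * (\<eta> k)\<^sup>2 * (?n * (real CARD('d) * Lf)\<^sup>2)"
    using G_sq_le[of k] by (intro mult_left_mono) auto
  have "2 * ?n * \<eta> k * (\<integral>w. ?g w \<partial>M) \<le> spread y k - spread y (Suc k) + ?c * err k + err k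
      + (?n * (\<eta> k * Lf)\<^sup>2 + 2 * (\<eta> k)\<^sup>2 * (?n * (real CARD('d) * Lf)\<^sup>2))
      + (2 * \<eta> k * ?n * (Lf * \<epsilon> * R_out) + 2 * \<eta> k * (?n * (2 * \<mu> * Lf)))"
    using 1 2 3 4 by (simp only: distrib_left mult_ac)
  also have "\<dots> = spread y k - spread y (Suc k) + (?c + 1) * err k + ?n * (Lf\<^sup>2 + 2 * (real CARD('d) * Lf)\<^sup>2) * (\<eta> k)\<^sup>2
      + 2 * ?n * Lf * (\<epsilon> * R_out + 2 * \<mu>) * \<eta> k"
    by (simp add: algebra_simps power_mult_distrib)
  finally show ?thesis .
qed

text \<open>The factor \<open>\<kappa>\<close> is chosen such that the decrease of \<open>\<kappa> err\<close> in the recursion pays for the consensus error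
in \<open>one_round_progress\<close>; the sum of spread and \<open>\<kappa> err\<close> is then a bounded potential.\<close>

lemma regret_le:
  assumes xs: "xs \<in> \<Omega>" and \<Lambda>: "\<Lambda> \<ge> 0" "\<And>Z :: real^'d^'n. norm (Z - W ** Z) \<le> \<Lambda> * norm Z"
    and recursion: "error_recursion M X Xh G \<eta> c3 (1 - a)" and a: "0 < a" "a \<le> 1"
    and \<eta>: "\<And>k. \<eta> k = 1 / (q * sqrt (real k + c))" and q: "q > 0" and c: "c > 0"
  defines "n \<equiv> real CARD('n)" and "\<kappa> \<equiv> (4 * \<gamma> * \<Lambda> + 4 * (\<gamma> * \<Lambda>)\<^sup>2 + 1) / a"
    and "g \<equiv> \<bar>c3\<bar> * (real CARD('n) * (real CARD('d) * Lf)\<^sup>2)"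
  shows "2 * n * (\<Sum>k = 1..T. \<integral>w. objective P F (row_average (X k w)) - objective P F xs \<partial>M)
    \<le> (q * (4 * n * R_out\<^sup>2 + \<kappa> * (8 * n * R_out\<^sup>2 + g / (q\<^sup>2 * c) / a))
        + 2 * (n * (Lf\<^sup>2 + 2 * (real CARD('d) * Lf)\<^sup>2) + \<kappa> * g) / q) * sqrt (real T + c)
      + 2 * n * Lf * (\<epsilon> * R_out + 2 * \<mu>) * real T"
proof -
  define y where "y = (1 - \<epsilon>) *\<^sub>R xs"
  have y: "y \<in> \<Omega>" using shrunk_facts(4) xs by (auto simp: shrunk_def y_def)
  let ?gap = "\<lambda>k. \<integral>w. objective P F (row_average (X k w)) - objective P F xs \<partial>M"
  define V where "V k = spread y k + \<kappa> * err k" for k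
  have \<kappa>: "\<kappa> \<ge> 0" using a \<Lambda>(1) gamma_nonneg by (simp add: \<kappa>_def)
  have g: "g \<ge> 0" by (simp add: g_def)
  have err_step: "err (Suc k) \<le> (1 - a) * err k + g * (\<eta> k)\<^sup>2" for k
  proof -
    have "c3 * (\<eta> k)\<^sup>2 * (\<integral>w. (norm (G k w))\<^sup>2 \<partial>M) \<le> \<bar>c3\<bar> * (\<eta> k)\<^sup>2 * (real CARD('n) * (real CARD('d) * Lf)\<^sup>2)"
      by (intro mult_mono G_sq_le) (auto intro!: mult_right_mono integral_nonneg_AE)
    also have "\<dots> = g * (\<eta> k)\<^sup>2" by (simp add: g_def)
    finally have "c3 * (\<eta> k)\<^sup>2 * (\<integral>w. (norm (G k w))\<^sup>2 \<partial>M) \<le> g * (\<eta> k)\<^sup>2" .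
    then show ?thesis using recursion[unfolded error_recursion_def, rule_format, of k] by linarith
  qed
  have \<eta>_sq: "(\<eta> k)\<^sup>2 \<le> 1 / (q\<^sup>2 * c)" for k
    using q c by (simp add: \<eta> power_divide power_mult_distrib frac_le)
  have err_bound: "err k \<le> 8 * n * R_out\<^sup>2 + g / (q\<^sup>2 * c) / a" for k
  proof (rule contraction_bounded[OF _ a])
    show "err (Suc k) \<le> (1 - a) * err k + g / (q\<^sup>2 * c)" for k
      using err_step[of k] mult_left_mono[OF \<eta>_sq[of k] g] by simp
    show "err 0 \<le> 8 * n * R_out\<^sup>2" using err_0_le by (simp add: n_def)
  qed (use g q c in \<open>auto simp: n_def\<close>)
  have "(\<Sum>k = 1..T. 2 * n * ?gap k)
      \<le> (q * (4 * n * R_out\<^sup>2 + \<kappa> * (8 * n * R_out\<^sup>2 + g / (q\<^sup>2 * c) / a))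
        + 2 * (n * (Lf\<^sup>2 + 2 * (real CARD('d) * Lf)\<^sup>2) + \<kappa> * g) / q) * sqrt (real T + c)
      + (2 * n * Lf * (\<epsilon> * R_out + 2 * \<mu>)) * real T"
  proof (rule sum_of_one_step_gains_le[where V = V and \<eta> = \<eta>, OF _ _ _ \<eta> q c])
    show "0 \<le> V k" for k
      using spread_bounds(1)[OF y] err_nonneg \<kappa> by (simp add: V_def)
    show "V k \<le> 4 * n * R_out\<^sup>2 + \<kappa> * (8 * n * R_out\<^sup>2 + g / (q\<^sup>2 * c) / a)" for k
      unfolding V_def using spread_bounds(2)[OF y] err_bound \<kappa>
      by (intro add_mono mult_left_mono) (auto simp: n_def)
    show "\<eta> k * (2 * n * ?gap k) \<le> V k - V (Suc k)
        + (n * (Lf\<^sup>2 + 2 * (real CARD('d) * Lf)\<^sup>2) + \<kappa> * g) * (\<eta> k)\<^sup>2 + (2 * n * Lf * (\<epsilon> * R_out + 2 * \<mu>)) * \<eta> k" for k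
    proof -
      have "(4 * \<gamma> * \<Lambda> + 4 * (\<gamma> * \<Lambda>)\<^sup>2 + 1) * err k = \<kappa> * (a * err k)" using a by (simp add: \<kappa>_def)
      also have "\<dots> \<le> \<kappa> * (err k - err (Suc k) + g * (\<eta> k)\<^sup>2)"
        using err_step[of k] \<kappa> by (intro mult_left_mono) (simp_all add: algebra_simps)
      finally have 1: "(4 * \<gamma> * \<Lambda> + 4 * (\<gamma> * \<Lambda>)\<^sup>2 + 1) * err k \<le> \<kappa> * (err k - err (Suc k) + g * (\<eta> k)\<^sup>2)" .
      have "\<eta> k * (2 * n * ?gap k) = 2 * real CARD('n) * \<eta> k * ?gap k" by (simp add: n_def)
      also have "\<dots> \<le> spread y k - spread y (Suc k) + \<kappa> * (err k - err (Suc k) + g * (\<eta> k)\<^sup>2)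
          + n * (Lf\<^sup>2 + 2 * (real CARD('d) * Lf)\<^sup>2) * (\<eta> k)\<^sup>2 + (2 * n * Lf * (\<epsilon> * R_out + 2 * \<mu>)) * \<eta> k"
        using one_round_progress[OF xs \<Lambda>, of k] 1 unfolding y_def n_def by linarith
      also have "\<dots> = V k - V (Suc k)
        + (n * (Lf\<^sup>2 + 2 * (real CARD('d) * Lf)\<^sup>2) + \<kappa> * g) * (\<eta> k)\<^sup>2 + (2 * n * Lf * (\<epsilon> * R_out + 2 * \<mu>)) * \<eta> k"
        by (simp add: V_def algebra_simps)
      finally show ?thesis .
    qed
    show "n * (Lf\<^sup>2 + 2 * (real CARD('d) * Lf)\<^sup>2) + \<kappa> * g \<ge> 0" using \<kappa> g by (simp add: n_def)
  qed
  then show ?thesis by (simp add: sum_distrib_left)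
qed

end

theorem theorem3:
  fixes N :: "'n::finite \<Rightarrow> 'n set" and W :: "real^'n^'n"
    and \<Omega> D :: "(real^'d::finite) set"
    and P :: "'n \<Rightarrow> 's measure" and F :: "'n \<Rightarrow> real^'d \<Rightarrow> 's \<Rightarrow> real"
    and gradF :: "'n \<Rightarrow> real^'d \<Rightarrow> 's \<Rightarrow> real^'d" and gradf :: "'n \<Rightarrow> real^'d \<Rightarrow> real^'d"
    and K :: "'c measure" and C :: "'c \<Rightarrow> real^'d \<Rightarrow> real^'d"
    and R_out R_in Lf Lm \<sigma> r \<omega> \<psi> \<gamma> c M1 \<kappa>0 :: real and b1 b2 :: nat
    and \<mu> \<epsilon> :: "nat \<Rightarrow> real" and \<eta> :: "nat \<Rightarrow> real"
    and M :: "nat \<Rightarrow> 'w measure"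
    and x0 :: "nat \<Rightarrow> real^'d^'n"
    and \<zeta> :: "nat \<Rightarrow> nat \<Rightarrow> 'n \<Rightarrow> 'w \<Rightarrow> 'c"
    and u :: "nat \<Rightarrow> nat \<Rightarrow> 'n \<Rightarrow> nat \<Rightarrow> 'w \<Rightarrow> real^'d"
    and \<xi> :: "nat \<Rightarrow> nat \<Rightarrow> 'n \<Rightarrow> nat \<Rightarrow> 'w \<Rightarrow> 's"
    and X Xh B Q :: "nat \<Rightarrow> nat \<Rightarrow> 'w \<Rightarrow> real^'d^'n"
    and xstar :: "real^'d"
  assumes A1: "network N W"
    and A2: "feasible_region \<Omega> R_out R_in"
    and samples: "random_functions P F \<Omega>"
    and A3: "convex_lipschitz_functions P F \<Omega> D Lf"
    and A4: "bounded_gradient_variance P F \<Omega> gradF gradf \<sigma>"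
    and A5: "compressor K C r \<omega>"
    and A6: "lipschitz_gradients P F \<Omega> gradf Lm"
    and batches: "b1 \<ge> 1" "b2 \<ge> 1"
    and psi: "0 < \<psi>" "\<psi> \<le> 1 / r"
    and mu: "\<And>T. \<mu> T = 1 / sqrt (real T)"
    and eps: "\<And>T. \<epsilon> T = \<mu> T / (2 * R_in)"
    and M1: "M1 = (5 + 10 / real CARD('n)) * 4 * real CARD('d) * Lm"
    and c: "c > 4"
    and eta: "\<And>k. \<eta> k = 1 / (M1 * sqrt (real k + c))"
    and gamma: "\<gamma> > 0"
      "\<gamma> < min 1 (min
         (spectral_gap W / kappa1 (spectral_gap W) (laplacian_norm W) (c0_const \<psi> r \<omega>) \<gamma>)
         (c0_const \<psi> r \<omega> / kappa2 (spectral_gap W) (laplacian_norm W) (c0_const \<psi> r \<omega>) \<gamma>))"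
    and draws: "\<And>T. T \<ge> 1 \<Longrightarrow> fresh_draws (M T) K P b1 b2 (\<zeta> T) (u T) (\<xi> T)"
    and run: "\<And>T. T \<ge> 1 \<Longrightarrow>
      vr_com_dszo (M T) N W \<Omega> F C \<eta> (\<mu> T) (\<epsilon> T) \<psi> \<gamma> b1 b2 (x0 T) (\<zeta> T) (u T) (\<xi> T)
        (X T) (Xh T) (B T) (Q T)"
    and queries: "\<And>T. T \<ge> 1 \<Longrightarrow> queries_in D (M T) (\<mu> T) b1 (u T) (X T)"
    and recursion: "\<And>T. T \<ge> 1 \<Longrightarrow>
      error_recursion (M T) (X T) (Xh T) (estimator_matrix F (\<mu> T) b1 b2 (u T) (\<xi> T) (X T)) \<eta>
        (C3_const (spectral_gap W) \<gamma> \<psi> r \<omega>) \<kappa>0"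
    and kappa0: "\<kappa>0 = 1 - \<psi> * r * \<omega> / 2"
    and optimal: "optimal_point P F \<Omega> xstar"
  shows "limsup (\<lambda>T. ereal (
      (\<Sum>k = 1..T. \<integral>w. (objective P F (row_average (X T k w)) - objective P F xstar) \<partial>M T) /
      ((real CARD('d))\<^sup>2 * sqrt (real T + c) / (real b1 * real b2 * (\<psi> * r * \<omega>)\<^sup>2)))) < \<infinity>"
proof -
  obtain \<Lambda> where \<Lambda>: "\<Lambda> \<ge> 0" "\<And>Z :: real^'d^'n. norm (Z - W ** Z) \<le> \<Lambda> * norm Z"
    using laplacian_bound[of W, where 'd = 'd] by blast
  define a where "a = \<psi> * r * \<omega> / 2"
  have r: "r > 0" and \<omega>: "0 < \<omega>" "\<omega> \<le> 1" using A5 by (auto simp: compressor_def)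
  have pr: "0 < \<psi> * r" "\<psi> * r \<le> 1" using psi r by (simp_all add: field_simps)
  have a: "0 < a" "a \<le> 1"
    using pr \<omega> mult_mono[of "\<psi> * r" 1 \<omega> 1] by (auto simp: a_def)
  have R: "R_in > 0" "R_out > 0" using A2 by (auto simp: feasible_region_def)
  have Lf: "Lf > 0" using A3 by (simp add: convex_lipschitz_functions_def)
  have "Lm > 0" using A6 by (simp add: lipschitz_gradients_def)
  then have M1_pos: "M1 > 0" unfolding M1 by (intro mult_pos_pos add_pos_nonneg) auto
  have xs: "xstar \<in> \<Omega>" using optimal by (simp add: optimal_point_def)
  let ?n = "real CARD('n)" and ?c3 = "C3_const (spectral_gap W) \<gamma> \<psi> r \<omega>"
  let ?regret = "\<lambda>T. \<Sum>k = 1..T. \<integral>w. (objective P F (row_average (X T k w)) - objective P F xstar) \<partial>M T"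
  define \<kappa> where "\<kappa> = (4 * \<gamma> * \<Lambda> + 4 * (\<gamma> * \<Lambda>)\<^sup>2 + 1) / a"
  define g where "g = \<bar>?c3\<bar> * (?n * (real CARD('d) * Lf)\<^sup>2)"
  \<comment> \<open>neither \<open>B1\<close> nor \<open>B2\<close> depends on the horizon: they bound the potential and its drift, and the bias per unit of \<open>\<mu>\<close>\<close>
  define B1 where "B1 = M1 * (4 * ?n * R_out\<^sup>2 + \<kappa> * (8 * ?n * R_out\<^sup>2 + g / (M1\<^sup>2 * c) / a))
        + 2 * (?n * (Lf\<^sup>2 + 2 * (real CARD('d) * Lf)\<^sup>2) + \<kappa> * g) / M1"
  define B2 where "B2 = 2 * ?n * Lf * (R_out / (2 * R_in) + 2)"
  \<comment> \<open>for \<open>\<epsilon> T > 1\<close>, at finitely many horizons, the set projected onto need not lie in \<open>\<Omega>\<close>\<close>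
  have bound: "?regret T \<le> (B1 + B2) / (2 * ?n) * sqrt (real T + c)"
    if T: "T \<ge> 1" "real T \<ge> (1 / (2 * R_in))\<^sup>2" for T
  proof -
    have sT: "sqrt (real T) > 0" using T by simp
    have "1 / (2 * R_in) \<le> sqrt (real T)" using T by (intro real_le_rsqrt)
    then have eps1: "\<epsilon> T \<le> 1" using R sT by (simp add: eps mu field_simps)
    interpret T: zeroth_order_run "M T" N W \<Omega> D P F K C R_out R_in Lf r \<omega> \<psi> \<gamma> "\<mu> T" "\<epsilon> T" \<eta> b1 b2
      "x0 T" "\<zeta> T" "u T" "\<xi> T" "X T" "Xh T" "B T" "Q T"
    proof
      show "0 < \<mu> T" "0 \<le> \<epsilon> T" using sT R by (simp_all add: mu eps)
      show "0 \<le> \<eta> k" for k using M1_pos c by (simp add: eta)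
    qed (use A1 A2 samples A3 A5 batches psi gamma draws[OF T(1)] run[OF T(1)] queries[OF T(1)] eps1 in auto)
    have "2 * ?n * ?regret T \<le> B1 * sqrt (real T + c) + 2 * ?n * Lf * (\<epsilon> T * R_out + 2 * \<mu> T) * real T"
      unfolding B1_def \<kappa>_def g_def
      by (rule T.regret_le[OF xs \<Lambda> _ a eta M1_pos])
         (use recursion[OF T(1)] c in \<open>simp_all add: kappa0 a_def\<close>)
    also have "2 * ?n * Lf * (\<epsilon> T * R_out + 2 * \<mu> T) * real T = B2 * (\<mu> T * real T)"
      by (simp add: B2_def eps algebra_simps)
    also have "\<mu> T * real T = sqrt (real T)" by (simp add: mu real_div_sqrt)
    also have "B2 * sqrt (real T) \<le> B2 * sqrt (real T + c)"
      using Lf R c by (intro mult_left_mono) (auto simp: B2_def)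
    finally have "2 * ?n * ?regret T \<le> (B1 + B2) * sqrt (real T + c)" by (simp add: algebra_simps)
    then show ?thesis by (simp add: field_simps)
  qed
  let ?s = "(real CARD('d))\<^sup>2 / (real b1 * real b2 * (\<psi> * r * \<omega>)\<^sup>2)"
  have s: "?s > 0" using batches pr \<omega> by (intro divide_pos_pos mult_pos_pos) auto
  have "\<forall>\<^sub>F T in sequentially. ereal (?regret T /
      ((real CARD('d))\<^sup>2 * sqrt (real T + c) / (real b1 * real b2 * (\<psi> * r * \<omega>)\<^sup>2))) \<le> ereal ((B1 + B2) / (2 * ?n) / ?s)"
    using eventually_ge_at_top[of 1] eventually_ge_at_top[of "nat \<lceil>(1 / (2 * R_in))\<^sup>2\<rceil>"]
  proof eventually_elim
    fix T :: nat assume T: "1 \<le> T" "nat \<lceil>(1 / (2 * R_in))\<^sup>2\<rceil> \<le> T"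
    have q: "sqrt (real T + c) > 0" using c by simp
    have "?regret T / (?s * sqrt (real T + c)) \<le> (B1 + B2) / (2 * ?n) * sqrt (real T + c) / (?s * sqrt (real T + c))"
      using bound[of T] T s q by (intro divide_right_mono) (auto simp: nat_ceiling_le_eq)
    also have "\<dots> = (B1 + B2) / (2 * ?n) / ?s" using q by simp
    finally show "ereal (?regret T /
      ((real CARD('d))\<^sup>2 * sqrt (real T + c) / (real b1 * real b2 * (\<psi> * r * \<omega>)\<^sup>2))) \<le> ereal ((B1 + B2) / (2 * ?n) / ?s)"
      by simp
  qed
  from Limsup_bounded[OF this] show ?thesis by (auto intro: le_less_trans)
qed

end
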